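(* Let $p$ be a prime, $X$ a nonempty totally ordered set, $S$ the free profinite group on $X$, and $n\geq 2$. Let $\mathrm{Lyn}_{\leq n}(X)$, the set of Lyndon words in $X$ of length $\leq n$, be totally ordered by $\preceq$. Then the matrix $$\Bigl((\tau_w^{p^{n-|w|}},\alpha_{w',n})_n\Bigr),$$ where $w,w'\in\mathrm{Lyn}_{\leq n}(X)$, is upper-triangular unipotent, i.e. its diagonal entries are $1$ and its $(w,w')$ entry is $0$ whenever $w'\prec w$.
   Context: For a profinite group $G$: $G^{(1,p)}=G$, $G^{(n+1,p)}=(G^{(n,p)})^p[G,G^{(n,p)}]$ (closed subgroup generated by all $h^p$ and $[g,h]=g^{-1}h^{-1}gh$, $g\in G$, $h\in G^{(n,p)}$), and $G^{[n,p]}=G/G^{(n,p)}$. Cohomology is profinite cohomology with trivial action on $\mathbb{Z}/p$. The free profinite group $S=S_X$ on basis $X$: $X\subseteq S$ generates $S$ topologically, the inclusion converges to $1$ (every open normal subgroup contains all but finitely many elements of $X$), and every map $X\to G$ to a profinite group converging to $1$ extends uniquely to a continuous homomorphism $S\to G$. $X^*$ is the free monoid of words in $X$; $|w|$ is the length of $w$. $w_1\leq_{\rm alp}w_2$ iff $w_2=w_1v$ for some $v\in X^*$, or $w_1=vx_1u_1$, $w_2=vx_2u_2$ with $v,u_1,u_2\in X^*$ and letters $x_1<x_2$. $w_1\preceq w_2$ iff $|w_1|<|w_2|$, or $|w_1|=|w_2|$ and $w_1\leq_{\rm alp}w_2$; $\prec$ is the strict version. A nonempty word is Lyndon if it is strictly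 smaller in $\leq_{\rm alp}$ than all its nontrivial proper suffixes. For a Lyndon word $w$ define $\tau_w\in S$ inductively: $\tau_{(x)}=x$ for $x\in X$; if $|w|>1$, let $w=w'w''$ be the standard factorization of $w$, i.e. $w''$ is the longest proper suffix of $w$ that is a Lyndon word (then $w'$ is Lyndon too), and $\tau_w=[\tau_{w'},\tau_{w''}]$. One has $\tau_w^{p^{n-|w|}}\in S^{(n,p)}$ for $|w|\le n$. For a profinite commutative ring $R$, $\Lambda_R\colon S\to R\langle\langle X\rangle\rangle^\times$ is the continuous (Magnus) homomorphism into the units of the ring of non-commuting formal power series with $\Lambda_R(x)=1+x$, $x\in X$; $\epsilon_{w,R}(\sigma)$ is the coefficient of $w$ in $\Lambda_R(\sigma)$. For $1\leq s\leq n$ let $\mathbb{U}=\mathbb{U}_{s+1}(\mathbb{Z}/p^{n-s+1})$ be the group of unipotent upper-triangular $(s+1)\times(s+1)$ matrices over $\mathbb{Z}/p^{n-s+1}$. It is known that $\mathbb{U}^{(n,p)}=I_{s+1}+\mathbb{Z}p^{n-s}E_{1,s+1}$ is central in $\mathbb{U}$; identify it with $\mathbb{Z}/p$ via $I_{s+1}+ap^{n-s}E_{1,s+1}\mapsto a\pmod p$. Let $\gamma_{n,s}\in H^2(\mathbb{U}^{[n,p]},\mathbb{Z}/p)$ be the class of the central extension $0\to\mathbb{Z}/p\to\mathbb{U}\to\mathbb{U}^{[n,p]}\to1$ (represented by the cocycle $\lambda(\bar u)\lambda(\bar u')\lambda(\bar u\bar u')^{-1}$ for a section $\lambda$ with $\lambda(1)=1$).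 For a word $w=(x_1\cdots x_s)$, let $\rho^w\colon S\to\mathbb{U}$ be the continuous homomorphism with $(i,j)$ entry $\epsilon_{(x_i\cdots x_{j-1}),\mathbb{Z}/p^{n-s+1}}(\sigma)$ for $i<j$, $\bar\rho^w\colon S^{[n,p]}\to\mathbb{U}^{[n,p]}$ the induced map, and $\alpha_{w,n}=(\bar\rho^w)^*\gamma_{n,s}\in H^2(S^{[n,p]},\mathbb{Z}/p)$. For $n\geq2$ the transgression $\mathrm{trg}\colon H^1(S^{(n,p)},\mathbb{Z}/p)^S\to H^2(S^{[n,p]},\mathbb{Z}/p)$ is an isomorphism; here $\mathrm{trg}([x])=[\partial y]$ for any continuous $1$-cochain $y$ on $S$ with $y|_{S^{(n,p)}}=x$ such that $(\partial y)(\sigma_1,\sigma_2)=y(\sigma_1)+y(\sigma_2)-y(\sigma_1\sigma_2)$ depends only on the cosets of $\sigma_1,\sigma_2$ modulo $S^{(n,p)}$. The bilinear map $(\cdot,\cdot)_n\colon S^{(n,p)}\times H^2(S^{[n,p]},\mathbb{Z}/p)\to\mathbb{Z}/p$ is $(\sigma,\alpha)_n=-(\mathrm{trg}^{-1}(\alpha))(\sigma)$. *)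

theory Defs
  imports
    "HOL-Number_Theory.Residues"
    "HOL-Analysis.Analysis"
begin

section \<open>Profinite groups\<close>

definition topological_group :: "'a monoid \<Rightarrow> 'a topology \<Rightarrow> bool" where
  "topological_group G T \<longleftrightarrow>
     group G \<and> topspace T = carrier G \<and>
     continuous_map (prod_topology T T) T (\<lambda>(g, h). g \<otimes>\<^bsub>G\<^esub> h) \<and>
     continuous_map T T (\<lambda>g. inv\<^bsub>G\<^esub> g)"

definition profinite_group :: "'a monoid \<Rightarrow> 'a topology \<Rightarrow> bool" where
  "profinite_group G T \<longleftrightarrow>
     topological_group G T \<and> compact_space T \<and> Hausdorff_space T \<and>
     (\<forall>C. connectedin T C \<longrightarrow> (\<forall>x\<in>C. \<forall>y\<in>C. x = y))"

definition closed_generate :: "'a monoid \<Rightarrow> 'a topology \<Rightarrow> 'a set \<Rightarrow> 'a set" where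
  "closed_generate G T A = \<Inter>{H. subgroup H G \<and> closedin T H \<and> A \<subseteq> H}"

definition commutator :: "('a, 'b) monoid_scheme \<Rightarrow> 'a \<Rightarrow> 'a \<Rightarrow> 'a" where
  "commutator G g h = inv\<^bsub>G\<^esub> g \<otimes>\<^bsub>G\<^esub> inv\<^bsub>G\<^esub> h \<otimes>\<^bsub>G\<^esub> g \<otimes>\<^bsub>G\<^esub> h"

text \<open>
  The lower \<open>p\<close>-central filtration; indices start at 1, and the value at index 0 is a dummy.
\<close>

fun lower_p_central :: "'a monoid \<Rightarrow> 'a topology \<Rightarrow> nat \<Rightarrow> nat \<Rightarrow> 'a set" where
  "lower_p_central G T p 0 = carrier G"
| "lower_p_central G T p (Suc 0) = carrier G"
| "lower_p_central G T p (Suc (Suc n)) =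
     closed_generate G T
       ({h [^]\<^bsub>G\<^esub> p | h. h \<in> lower_p_central G T p (Suc n)} \<union>
        {commutator G g h | g h. g \<in> carrier G \<and> h \<in> lower_p_central G T p (Suc n)})"

definition converges_to_one :: "'x set \<Rightarrow> 'a monoid \<Rightarrow> 'a topology \<Rightarrow> ('x \<Rightarrow> 'a) \<Rightarrow> bool" where
  "converges_to_one X G T f \<longleftrightarrow> (\<forall>U. U \<lhd> G \<and> openin T U \<longrightarrow> finite {x \<in> X. f x \<notin> U})"

text \<open>
  HOL cannot quantify over types inside a formula, so the universal property is stated for the
  profinite groups \<open>G\<close> carried by the type \<^typ>\<open>'a list \<Rightarrow> int\<close>. This is no restriction: given
  \<open>f\<close> from \<open>X\<close> to an arbitrary profinite group converging to 1, only the closed subgroup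
  generated by the image of \<open>f\<close> matters. It has at most max(card \<open>X\<close>, aleph 0) open normal
  subgroups, all of finite index, hence at most 2 to the power max(card \<open>X\<close>, aleph 0) elements,
  and \<^typ>\<open>'a list \<Rightarrow> int\<close> is at least that large because \<open>X\<close> lies in \<^typ>\<open>'a\<close>.
\<close>

definition free_profinite_group :: "'a monoid \<Rightarrow> 'a topology \<Rightarrow> 'a set \<Rightarrow> bool" where
  "free_profinite_group S T X \<longleftrightarrow>
     profinite_group S T \<and> X \<subseteq> carrier S \<and> closed_generate S T X = carrier S \<and>
     converges_to_one X S T (\<lambda>x. x) \<and>
     (\<forall>(G :: ('a list \<Rightarrow> int) monoid) TG f.
        profinite_group G TG \<and> f \<in> X \<rightarrow> carrier G \<and> converges_to_one X G TG f \<longrightarrow>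
        (\<exists>!\<phi>. \<phi> \<in> extensional (carrier S) \<and> \<phi> \<in> hom S G \<and> continuous_map T TG \<phi> \<and>
              (\<forall>x\<in>X. \<phi> x = f x)))"


section \<open>Lyndon words\<close>

text \<open>
  Words in \<open>X\<close> are the elements of \<^term>\<open>lists X\<close>; \<open>r\<close> is the (reflexive) total order of \<open>X\<close>.
\<close>

definition alp_less :: "'x rel \<Rightarrow> 'x list \<Rightarrow> 'x list \<Rightarrow> bool" where
  "alp_less r v w \<longleftrightarrow> (v, w) \<in> lexord (r - Id)"

definition alp_le :: "'x rel \<Rightarrow> 'x list \<Rightarrow> 'x list \<Rightarrow> bool" where
  "alp_le r v w \<longleftrightarrow> v = w \<or> alp_less r v w"

lemma alp_le_iff:
  "alp_le r v w \<longleftrightarrow>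
     (\<exists>u. w = v @ u) \<or>
     (\<exists>u x y s t. v = u @ x # s \<and> w = u @ y # t \<and> (x, y) \<in> r \<and> x \<noteq> y)"
  unfolding alp_le_def alp_less_def lexord_def
  by (auto simp: neq_Nil_conv) (metis append_Nil2 list.exhaust)

definition prec_eq :: "'x rel \<Rightarrow> 'x list \<Rightarrow> 'x list \<Rightarrow> bool" where
  "prec_eq r v w \<longleftrightarrow> length v < length w \<or> length v = length w \<and> alp_le r v w"

definition prec :: "'x rel \<Rightarrow> 'x list \<Rightarrow> 'x list \<Rightarrow> bool" where
  "prec r v w \<longleftrightarrow> prec_eq r v w \<and> v \<noteq> w"

definition lyndon :: "'x rel \<Rightarrow> 'x list \<Rightarrow> bool" where
  "lyndon r w \<longleftrightarrow>
     w \<noteq> [] \<and> (\<forall>u v. w = u @ v \<and> u \<noteq> [] \<and> v \<noteq> [] \<longrightarrow> alp_less r w v)"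

definition Lyn_le :: "'x rel \<Rightarrow> 'x set \<Rightarrow> nat \<Rightarrow> 'x list set" where
  "Lyn_le r X n = {w \<in> lists X. lyndon r w \<and> length w \<le> n}"

text \<open>
  The standard factorization of \<open>w\<close> cuts \<open>w\<close> after its first \<^term>\<open>std_cut r w\<close> letters: the
  smallest positive cut whose remainder is Lyndon gives the longest proper Lyndon suffix.
\<close>

definition std_cut :: "'x rel \<Rightarrow> 'x list \<Rightarrow> nat" where
  "std_cut r w = (LEAST k. 0 < k \<and> k < length w \<and> lyndon r (drop k w))"

lemma lyndon_singleton: "lyndon r [x]"
  by (auto simp: lyndon_def Cons_eq_append_conv)

lemma std_cut:
  assumes "1 < length w"
  shows "0 < std_cut r w \<and> std_cut r w < length w \<and> lyndon r (drop (std_cut r w) w)"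
proof -
  have "drop (length w - 1) w = [last w]"
    using assms by (metis One_nat_def Suc_lessD append_butlast_last_id append_eq_conv_conj
      length_butlast length_greater_0_conv)
  then have "0 < length w - 1 \<and> length w - 1 < length w \<and> lyndon r (drop (length w - 1) w)"
    using assms by (simp add: lyndon_singleton)
  then show ?thesis
    unfolding std_cut_def by (rule LeastI)
qed

lemma std_cut_pos: "Suc 0 < length w \<Longrightarrow> 0 < std_cut r w"
  and std_cut_less: "Suc 0 < length w \<Longrightarrow> std_cut r w < length w"
  using std_cut by auto

text \<open>The value on words that are not Lyndon is irrelevant.\<close>

function tau :: "'x monoid \<Rightarrow> 'x rel \<Rightarrow> 'x list \<Rightarrow> 'x" where
  "tau S r w =
     (if length w \<le> 1 then hd w
      else commutator S (tau S r (take (std_cut r w) w)) (tau S r (drop (std_cut r w) w)))"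
  by auto
termination
  by (relation "Wellfounded.measure (\<lambda>(S, r, w). length w)")
     (auto simp: not_le min_less_iff_disj std_cut_pos std_cut_less intro!: diff_less)

declare tau.simps [simp del]


section \<open>The Magnus homomorphism\<close>

text \<open>Formal power series in non-commuting variables \<open>X\<close> over \<open>R\<close>, as functions on words.\<close>

definition nc_power_series :: "'r ring \<Rightarrow> 'x set \<Rightarrow> ('x list \<Rightarrow> 'r) ring" where
  "nc_power_series R X =
     \<lparr>carrier = lists X \<rightarrow>\<^sub>E carrier R,
      monoid.mult = (\<lambda>f g. \<lambda>w\<in>lists X.
        \<Oplus>\<^bsub>R\<^esub>i\<in>{..length w}. f (take i w) \<otimes>\<^bsub>R\<^esub> g (drop i w)),
      one = (\<lambda>w\<in>lists X. if w = [] then \<one>\<^bsub>R\<^esub> else \<zero>\<^bsub>R\<^esub>),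
      zero = (\<lambda>w\<in>lists X. \<zero>\<^bsub>R\<^esub>),
      add = (\<lambda>f g. \<lambda>w\<in>lists X. f w \<oplus>\<^bsub>R\<^esub> g w)\<rparr>"

definition nc_var :: "'r ring \<Rightarrow> 'x set \<Rightarrow> 'x \<Rightarrow> 'x list \<Rightarrow> 'r" where
  "nc_var R X x = (\<lambda>w\<in>lists X. if w = [x] then \<one>\<^bsub>R\<^esub> else \<zero>\<^bsub>R\<^esub>)"

text \<open>
  \<open>TR\<close> is the topology of the profinite ring \<open>R\<close>; power series carry the topology of
  coefficientwise convergence.
\<close>

definition magnus ::
  "'a monoid \<Rightarrow> 'a topology \<Rightarrow> 'a set \<Rightarrow> 'r ring \<Rightarrow> 'r topology \<Rightarrow> 'a \<Rightarrow> 'a list \<Rightarrow> 'r" where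
  "magnus S T X R TR =
     (THE \<Lambda>. \<Lambda> \<in> extensional (carrier S) \<and>
        \<Lambda> \<in> hom S (units_of (nc_power_series R X)) \<and>
        continuous_map T
          (subtopology (product_topology (\<lambda>_. TR) (lists X)) (Units (nc_power_series R X))) \<Lambda> \<and>
        (\<forall>x\<in>X. \<Lambda> x = \<one>\<^bsub>nc_power_series R X\<^esub> \<oplus>\<^bsub>nc_power_series R X\<^esub> nc_var R X x))"

definition magnus_coeff ::
  "'a monoid \<Rightarrow> 'a topology \<Rightarrow> 'a set \<Rightarrow> 'r ring \<Rightarrow> 'r topology \<Rightarrow> 'a list \<Rightarrow> 'a \<Rightarrow> 'r" where
  "magnus_coeff S T X R TR w \<sigma> = magnus S T X R TR \<sigma> w"


section \<open>Continuous cohomology with trivial discrete coefficients\<close>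

text \<open>
  The coefficient module is the additive group of \<open>R\<close>. Cochains are extensional functions, so
  that equality of cochains is equality on the group.
\<close>

definition quotient_topology :: "'a topology \<Rightarrow> ('a \<Rightarrow> 'b) \<Rightarrow> 'b topology" where
  "quotient_topology T q =
     topology (\<lambda>V. V \<subseteq> q ` topspace T \<and> openin T {x \<in> topspace T. q x \<in> V})"

lemma openin_quotient_topology:
  "openin (quotient_topology T q) V \<longleftrightarrow>
     V \<subseteq> q ` topspace T \<and> openin T {x \<in> topspace T. q x \<in> V}"
proof -
  let ?P = "\<lambda>V. V \<subseteq> q ` topspace T \<and> openin T {x \<in> topspace T. q x \<in> V}"
  have "istopology ?P"
    unfolding istopology_def
  proof (intro conjI allI impI)
    fix U V assume U: "?P U" and V: "?P V"
    show "U \<inter> V \<subseteq> q ` topspace T" using U by blast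
    have "{x \<in> topspace T. q x \<in> U \<inter> V} =
          {x \<in> topspace T. q x \<in> U} \<inter> {x \<in> topspace T. q x \<in> V}" by blast
    with U V show "openin T {x \<in> topspace T. q x \<in> U \<inter> V}" by (simp add: openin_Int)
  next
    fix \<K> assume K: "\<forall>K\<in>\<K>. ?P K"
    then show "\<Union>\<K> \<subseteq> q ` topspace T" by blast
    have "{x \<in> topspace T. q x \<in> \<Union>\<K>} = \<Union>((\<lambda>K. {x \<in> topspace T. q x \<in> K}) ` \<K>)" by blast
    with K show "openin T {x \<in> topspace T. q x \<in> \<Union>\<K>}" by auto
  qed
  then show ?thesis by (simp add: quotient_topology_def)
qed

lemma quotient_map_quotient_topology: "quotient_map T (quotient_topology T q) q"
proof -
  have top: "topspace (quotient_topology T q) = q ` topspace T"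
  proof (rule antisym)
    show "topspace (quotient_topology T q) \<subseteq> q ` topspace T"
      using openin_quotient_topology openin_topspace by metis
    have "{x \<in> topspace T. q x \<in> q ` topspace T} = topspace T" by blast
    then have "openin (quotient_topology T q) (q ` topspace T)"
      by (simp add: openin_quotient_topology)
    then show "q ` topspace T \<subseteq> topspace (quotient_topology T q)" by (rule openin_subset)
  qed
  show ?thesis
    unfolding quotient_map_def top by (simp add: openin_quotient_topology)
qed

definition coset_topology :: "'a monoid \<Rightarrow> 'a topology \<Rightarrow> 'a set \<Rightarrow> 'a set topology" where
  "coset_topology G T N = quotient_topology T (\<lambda>g. N #>\<^bsub>G\<^esub> g)"

definition cochains1 :: "'a monoid \<Rightarrow> 'a topology \<Rightarrow> 'r ring \<Rightarrow> ('a \<Rightarrow> 'r) set" where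
  "cochains1 G T R =
     {y \<in> carrier G \<rightarrow>\<^sub>E carrier R. continuous_map T (discrete_topology (carrier R)) y}"

definition coboundary1 :: "'a monoid \<Rightarrow> 'r ring \<Rightarrow> ('a \<Rightarrow> 'r) \<Rightarrow> 'a \<times> 'a \<Rightarrow> 'r" where
  "coboundary1 G R y =
     (\<lambda>(g, h)\<in>carrier G \<times> carrier G. y g \<oplus>\<^bsub>R\<^esub> y h \<ominus>\<^bsub>R\<^esub> y (g \<otimes>\<^bsub>G\<^esub> h))"

definition cocycles2 :: "'a monoid \<Rightarrow> 'a topology \<Rightarrow> 'r ring \<Rightarrow> ('a \<times> 'a \<Rightarrow> 'r) monoid" where
  "cocycles2 G T R =
     \<lparr>carrier = {c \<in> carrier G \<times> carrier G \<rightarrow>\<^sub>E carrier R.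
        continuous_map (prod_topology T T) (discrete_topology (carrier R)) c \<and>
        (\<forall>g\<in>carrier G. \<forall>h\<in>carrier G. \<forall>k\<in>carrier G.
           c (h, k) \<oplus>\<^bsub>R\<^esub> c (g, h \<otimes>\<^bsub>G\<^esub> k) = c (g \<otimes>\<^bsub>G\<^esub> h, k) \<oplus>\<^bsub>R\<^esub> c (g, h))},
      monoid.mult = (\<lambda>c d. \<lambda>x\<in>carrier G \<times> carrier G. c x \<oplus>\<^bsub>R\<^esub> d x),
      one = (\<lambda>x\<in>carrier G \<times> carrier G. \<zero>\<^bsub>R\<^esub>)\<rparr>"

definition coboundaries2 :: "'a monoid \<Rightarrow> 'a topology \<Rightarrow> 'r ring \<Rightarrow> ('a \<times> 'a \<Rightarrow> 'r) set" where
  "coboundaries2 G T R = coboundary1 G R ` cochains1 G T R"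

definition H2 :: "'a monoid \<Rightarrow> 'a topology \<Rightarrow> 'r ring \<Rightarrow> ('a \<times> 'a \<Rightarrow> 'r) set monoid" where
  "H2 G T R = cocycles2 G T R Mod coboundaries2 G T R"

definition H2_class ::
  "'a monoid \<Rightarrow> 'a topology \<Rightarrow> 'r ring \<Rightarrow> ('a \<times> 'a \<Rightarrow> 'r) \<Rightarrow> ('a \<times> 'a \<Rightarrow> 'r) set" where
  "H2_class G T R c = coboundaries2 G T R #>\<^bsub>cocycles2 G T R\<^esub> c"

definition H2_pullback ::
  "'a monoid \<Rightarrow> 'a topology \<Rightarrow> 'r ring \<Rightarrow> ('a \<Rightarrow> 'b) \<Rightarrow> ('b \<times> 'b \<Rightarrow> 'r) set \<Rightarrow> ('a \<times> 'a \<Rightarrow> 'r) set"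
  where
  "H2_pullback G T R \<phi> \<gamma> =
     the_elem ((\<lambda>c. H2_class G T R (\<lambda>(g, h)\<in>carrier G \<times> carrier G. c (\<phi> g, \<phi> h))) ` \<gamma>)"

text \<open>
  As the action on the coefficients is trivial, the first cohomology of the closed normal
  subgroup \<open>N\<close> of \<open>G\<close> is the group of continuous homomorphisms on \<open>N\<close>; the \<open>G\<close>-invariants are
  taken with respect to conjugation.
\<close>

definition H1_invariants :: "'a monoid \<Rightarrow> 'a topology \<Rightarrow> 'a set \<Rightarrow> 'r ring \<Rightarrow> ('a \<Rightarrow> 'r) set" where
  "H1_invariants G T N R =
     {x \<in> extensional N.
        x \<in> hom (G\<lparr>carrier := N\<rparr>) (add_monoid R) \<and>
        continuous_map (subtopology T N) (discrete_topology (carrier R)) x \<and>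
        (\<forall>g\<in>carrier G. \<forall>h\<in>N. x (inv\<^bsub>G\<^esub> g \<otimes>\<^bsub>G\<^esub> h \<otimes>\<^bsub>G\<^esub> g) = x h)}"

text \<open>
  In the transgression, \<open>c\<close> is the 2-cochain on \<open>G/N\<close> through which the coboundary of \<open>y\<close>
  factors. The resulting class does not depend on the choice of \<open>y\<close>.
\<close>

definition trg ::
  "'a monoid \<Rightarrow> 'a topology \<Rightarrow> 'a set \<Rightarrow> 'r ring \<Rightarrow> ('a \<Rightarrow> 'r) \<Rightarrow> ('a set \<times> 'a set \<Rightarrow> 'r) set" where
  "trg G T N R x =
     (THE \<alpha>. \<exists>y\<in>cochains1 G T R. \<exists>c\<in>carrier (cocycles2 (G Mod N) (coset_topology G T N) R).
        (\<forall>h\<in>N. y h = x h) \<and>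
        (\<forall>g\<in>carrier G. \<forall>h\<in>carrier G. c (N #>\<^bsub>G\<^esub> g, N #>\<^bsub>G\<^esub> h) = coboundary1 G R y (g, h)) \<and>
        \<alpha> = H2_class (G Mod N) (coset_topology G T N) R c)"

definition trg_pairing ::
  "'a monoid \<Rightarrow> 'a topology \<Rightarrow> nat \<Rightarrow> nat \<Rightarrow> 'a \<Rightarrow> ('a set \<times> 'a set \<Rightarrow> int) set \<Rightarrow> int" where
  "trg_pairing S T p n \<sigma> \<alpha> =
     (let R = residue_ring (int p); N = lower_p_central S T p n
      in \<ominus>\<^bsub>R\<^esub> (the_inv_into (H1_invariants S T N R) (trg S T N R) \<alpha>) \<sigma>)"


section \<open>Unipotent matrices and the classes alpha\<close>

text \<open>Matrix indices start at 1.\<close>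

definition unipotent_group :: "'r ring \<Rightarrow> nat \<Rightarrow> (nat \<times> nat \<Rightarrow> 'r) monoid" where
  "unipotent_group R d =
     \<lparr>carrier = {A \<in> {1..d} \<times> {1..d} \<rightarrow>\<^sub>E carrier R.
        (\<forall>i\<in>{1..d}. A (i, i) = \<one>\<^bsub>R\<^esub>) \<and>
        (\<forall>i\<in>{1..d}. \<forall>j\<in>{1..d}. j < i \<longrightarrow> A (i, j) = \<zero>\<^bsub>R\<^esub>)},
      monoid.mult = (\<lambda>A B. \<lambda>(i, j)\<in>{1..d} \<times> {1..d}. \<Oplus>\<^bsub>R\<^esub>k\<in>{1..d}. A (i, k) \<otimes>\<^bsub>R\<^esub> B (k, j)),
      one = (\<lambda>(i, j)\<in>{1..d} \<times> {1..d}. if i = j then \<one>\<^bsub>R\<^esub> else \<zero>\<^bsub>R\<^esub>)\<rparr>"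

definition UU :: "nat \<Rightarrow> nat \<Rightarrow> nat \<Rightarrow> (nat \<times> nat \<Rightarrow> int) monoid" where
  "UU p n s = unipotent_group (residue_ring (int (p ^ (n - s + 1)))) (s + 1)"

definition UU_lower :: "nat \<Rightarrow> nat \<Rightarrow> nat \<Rightarrow> (nat \<times> nat \<Rightarrow> int) set" where
  "UU_lower p n s = lower_p_central (UU p n s) (discrete_topology (carrier (UU p n s))) p n"

abbreviation UU_quot :: "nat \<Rightarrow> nat \<Rightarrow> nat \<Rightarrow> (nat \<times> nat \<Rightarrow> int) set monoid" where
  "UU_quot p n s \<equiv> UU p n s Mod UU_lower p n s"

abbreviation UU_quot_top :: "nat \<Rightarrow> nat \<Rightarrow> nat \<Rightarrow> (nat \<times> nat \<Rightarrow> int) set topology" where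
  "UU_quot_top p n s \<equiv> discrete_topology (carrier (UU_quot p n s))"

text \<open>
  The matrix \<open>I + a p^(n-s) E_{1,s+1}\<close>. For \<open>a\<close> in \<open>{0..<p}\<close>, the carrier of
  \<^term>\<open>residue_ring (int p)\<close>, the corner entry is already reduced modulo \<open>p^(n-s+1)\<close>, and
  \<open>center_coord\<close> is the identification of the last term of the filtration with the integers
  modulo \<open>p\<close>.
\<close>

definition center_matrix :: "nat \<Rightarrow> nat \<Rightarrow> nat \<Rightarrow> int \<Rightarrow> nat \<times> nat \<Rightarrow> int" where
  "center_matrix p n s a =
     (\<lambda>(i, j)\<in>{1..s + 1} \<times> {1..s + 1}.
        if i = j then 1 else if i = 1 \<and> j = s + 1 then a * int p ^ (n - s) else 0)"

definition center_coord :: "nat \<Rightarrow> nat \<Rightarrow> nat \<Rightarrow> (nat \<times> nat \<Rightarrow> int) \<Rightarrow> int" where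
  "center_coord p n s = the_inv_into (carrier (residue_ring (int p))) (center_matrix p n s)"

text \<open>The class of the extension does not depend on the normalized section \<open>l\<close>.\<close>

definition gamma_class ::
  "nat \<Rightarrow> nat \<Rightarrow> nat \<Rightarrow> ((nat \<times> nat \<Rightarrow> int) set \<times> (nat \<times> nat \<Rightarrow> int) set \<Rightarrow> int) set" where
  "gamma_class p n s =
     (let U = UU p n s; Z = UU_lower p n s; Q = UU_quot p n s
      in THE \<gamma>. \<exists>l. (\<forall>C\<in>carrier Q. l C \<in> carrier U \<and> Z #>\<^bsub>U\<^esub> l C = C) \<and> l \<one>\<^bsub>Q\<^esub> = \<one>\<^bsub>U\<^esub> \<and>
           \<gamma> = H2_class Q (UU_quot_top p n s) (residue_ring (int p))
                 (\<lambda>(C, D)\<in>carrier Q \<times> carrier Q.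
                    center_coord p n s (l C \<otimes>\<^bsub>U\<^esub> l D \<otimes>\<^bsub>U\<^esub> inv\<^bsub>U\<^esub> l (C \<otimes>\<^bsub>Q\<^esub> D))))"

text \<open>With indices from 1, the factor \<open>x_i ... x_{j-1}\<close> of \<open>w\<close> is \<open>take (j - i) (drop (i - 1) w)\<close>.\<close>

definition rho ::
  "'a monoid \<Rightarrow> 'a topology \<Rightarrow> 'a set \<Rightarrow> nat \<Rightarrow> nat \<Rightarrow> 'a list \<Rightarrow> 'a \<Rightarrow> nat \<times> nat \<Rightarrow> int" where
  "rho S T X p n w \<sigma> =
     (let s = length w; R = residue_ring (int (p ^ (n - s + 1)))
      in (\<lambda>(i, j)\<in>{1..s + 1} \<times> {1..s + 1}.
            if i < j
            then magnus_coeff S T X R (discrete_topology (carrier R))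
                   (take (j - i) (drop (i - 1) w)) \<sigma>
            else if i = j then \<one>\<^bsub>R\<^esub> else \<zero>\<^bsub>R\<^esub>))"

definition rho_bar ::
  "'a monoid \<Rightarrow> 'a topology \<Rightarrow> 'a set \<Rightarrow> nat \<Rightarrow> nat \<Rightarrow> 'a list \<Rightarrow> 'a set \<Rightarrow> (nat \<times> nat \<Rightarrow> int) set" where
  "rho_bar S T X p n w C =
     the_elem
       ((\<lambda>\<sigma>. UU_lower p n (length w) #>\<^bsub>UU p n (length w)\<^esub> rho S T X p n w \<sigma>) ` C)"

definition alpha ::
  "'a monoid \<Rightarrow> 'a topology \<Rightarrow> 'a set \<Rightarrow> nat \<Rightarrow> nat \<Rightarrow> 'a list \<Rightarrow> ('a set \<times> 'a set \<Rightarrow> int) set" where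
  "alpha S T X p n w =
     (let N = lower_p_central S T p n
      in H2_pullback (S Mod N) (coset_topology S T N) (residue_ring (int p))
           (rho_bar S T X p n w) (gamma_class p n (length w)))"

end

theory Submission
  imports Defs
begin

text \<open>
  For a section \<open>l\<close> of the extension defining \<open>\<gamma>\<close>, let \<open>y \<sigma>\<close> be the corner coordinate of
  \<open>l [\<rho> \<sigma>] \<cdot> (\<rho> \<sigma>)\<inverse>\<close>, where \<open>[u]\<close> is the class of \<open>u\<close> in the quotient of the unipotent group. Its
  coboundary is the pulled back extension cocycle, so the restriction of \<open>y\<close> to the \<open>n\<close>-th term of
  the lower \<open>p\<close>-central filtration of \<open>S\<close>, which is minus the corner coordinate of \<open>\<rho>\<close>, transgresses to
  \<open>\<alpha>\<close>. No other character does: two differ by the restriction of a character of \<open>S\<close>, and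
  characters of \<open>S\<close> vanish on the second term. So the pairing of \<open>\<sigma>\<close> with the class of a word \<open>w\<close> is
  the Magnus coefficient of \<open>\<sigma>\<close> at \<open>w\<close> divided by \<open>p ^ (n - |w|)\<close>.

  The Magnus series of \<open>\<tau>\<close> at a Lyndon word \<open>v\<close> is \<open>1\<close> plus \<open>v\<close> plus larger words: the leading
  part of a commutator is \<open>a b - b a\<close> for the leading parts \<open>a\<close>, \<open>b\<close>, and
  \<open>v' v'' < v'' v'\<close> for the standard factorization of \<open>v\<close>. Taking the power \<open>p ^ (n - |v|)\<close> multiplies
  the part of lowest degree by this number.
\<close>



section \<open>Topological groups\<close>

text \<open>The pairing inverts \<open>trg\<close>, and \<open>trg\<close> is itself a
  \<open>THE\<close> over cochains. So two facts about all invariant characters come before any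
  computation: each extends to a cochain whose coboundary factors through the quotient, and the
  class obtained determines the character. The first rests on a base at 1 of open normal subgroups,
  which compactness and total disconnectedness provide.

  The \<open>n\<close>-th term of the unipotent group enters through divisibility of entries, which
  forces its elements to be trivial outside the corner; centrality and the corner coordinate follow
  from this. The minus sign in the pairing cancels the one in the restricted cochain, so matrix
  entries are Magnus coefficients with no sign.

  Freeness yields the Magnus map once the units of the series ring over Z/m are known to be
  profinite; they are the units of a compact monoid. The rows lie in the \<open>n\<close>-th term
  because commutators add the indices of the filtration. The least obvious input on words is that
  the second standard factor is the smallest proper suffix: this makes the first factor Lyndon, so
  the induction along standard factorizations can proceed.\<close>

locale topgroup =
  fixes G :: "'a monoid" (structure) and T :: "'a topology"
  assumes topological_group: "topological_group G T"

sublocale topgroup \<subseteq> group G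
  using topological_group by (simp add: topological_group_def)

section \<open>Commutator identities in abstract groups\<close>

lemma (in group) commutator_closed [simp]:
  "g \<in> carrier G \<Longrightarrow> h \<in> carrier G \<Longrightarrow> commutator G g h \<in> carrier G"
  by (simp add: commutator_def)

lemma (in group) cancel_inv_left [simp]:
  "x \<in> carrier G \<Longrightarrow> y \<in> carrier G \<Longrightarrow> inv x \<otimes> (x \<otimes> y) = y"
  "x \<in> carrier G \<Longrightarrow> y \<in> carrier G \<Longrightarrow> x \<otimes> (inv x \<otimes> y) = y"
  by (simp_all flip: m_assoc)

lemma (in group) commutator_swap:
  "g \<in> carrier G \<Longrightarrow> h \<in> carrier G \<Longrightarrow> commutator G h g = inv commutator G g h"
  by (simp add: commutator_def inv_mult_group m_assoc)

lemma (in group) commuting_subgroup: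
  assumes b: "b \<in> carrier G"
  shows "subgroup {a \<in> carrier G. a \<otimes> b = b \<otimes> a} G"
proof (rule subgroupI)
  fix x assume "x \<in> {a \<in> carrier G. a \<otimes> b = b \<otimes> a}"
  then have x: "x \<in> carrier G" and e: "x \<otimes> b = b \<otimes> x" by auto
  have "inv x \<otimes> b = inv x \<otimes> (b \<otimes> x) \<otimes> inv x"
    using x b by (simp add: m_assoc)
  also have "\<dots> = inv x \<otimes> (x \<otimes> b) \<otimes> inv x" by (simp only: e)
  also have "\<dots> = b \<otimes> inv x" using x b by simp
  finally show "inv x \<in> {a \<in> carrier G. a \<otimes> b = b \<otimes> a}" using x by simp
next
  fix x y assume "x \<in> {a \<in> carrier G. a \<otimes> b = b \<otimes> a}" "y \<in> {a \<in> carrier G. a \<otimes> b = b \<otimes> a}"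
  then have x: "x \<in> carrier G" "x \<otimes> b = b \<otimes> x" and y: "y \<in> carrier G" "y \<otimes> b = b \<otimes> y" by auto
  have "x \<otimes> y \<otimes> b = x \<otimes> b \<otimes> y" using x(1) y b by (simp add: m_assoc)
  also have "\<dots> = b \<otimes> (x \<otimes> y)" using x y(1) b by (simp add: m_assoc)
  finally show "x \<otimes> y \<in> {a \<in> carrier G. a \<otimes> b = b \<otimes> a}" using x y by simp
qed (use b in auto)

text \<open>Moving \<open>b\<close> past one factor \<open>h\<close> produces one factor
  \<open>c\<close>, and \<open>c\<close> can be carried past the remaining factors; so
  \<open>b\<close> passes \<open>h [^] q\<close> at the cost of \<open>c [^] q\<close>, which is 1.
  This handles the power generators of the lower p-central filtration.\<close>

lemma (in group) commutes_pow_if_commutator_pow_eq_one: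
  assumes b: "b \<in> carrier G" and h: "h \<in> carrier G"
    and c: "c = commutator G b h" "c \<otimes> h = h \<otimes> c" "c [^] (q::nat) = \<one>"
  shows "h [^] q \<otimes> b = b \<otimes> h [^] q"
proof -
  have [simp]: "c \<in> carrier G" using b h c by simp
  have bh: "b \<otimes> h = h \<otimes> (b \<otimes> c)" using b h by (simp add: c(1) commutator_def m_assoc)
  have ck: "c [^] k \<otimes> h = h \<otimes> c [^] k" for k :: nat
    using c(2) h by (simp add: group_commutes_pow)
  have "b \<otimes> h [^] k = h [^] k \<otimes> (b \<otimes> c [^] k)" for k :: nat
  proof (induction k)
    case (Suc k)
    have "b \<otimes> h [^] Suc k = h [^] k \<otimes> (b \<otimes> (c [^] k \<otimes> h))"
      using Suc b h by (simp flip: m_assoc)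
    also have "\<dots> = h [^] k \<otimes> ((b \<otimes> h) \<otimes> c [^] k)"
      using b h by (simp add: ck m_assoc)
    also have "\<dots> = h [^] Suc k \<otimes> (b \<otimes> (c \<otimes> c [^] k))"
      using b h by (simp add: bh m_assoc)
    also have "c \<otimes> c [^] k = c [^] Suc k"
      by (metis \<open>c \<in> carrier G\<close> nat_pow_Suc2)
    finally show ?case .
  qed (use b in simp)
  from this[of q] b h c(3) show ?thesis by simp
qed

text \<open>\<open>b\<close> passes \<open>h \<otimes> g\<close> and \<open>g \<otimes> h\<close> at
  the same cost \<open>d \<otimes> c\<close>, so it commutes with their quotient, which is the
  commutator of the inverses. This is a Hall-Witt type argument for the commutator generators of the
  filtration.\<close>

lemma (in group) commutes_commutator:
  assumes b: "b \<in> carrier G" and g: "g \<in> carrier G" and h: "h \<in> carrier G"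
    and c: "c = commutator G b h" and d: "d = commutator G b g"
    and comm: "c \<otimes> g = g \<otimes> c" "d \<otimes> h = h \<otimes> d" "c \<otimes> d = d \<otimes> c"
  shows "commutator G (inv g) (inv h) \<otimes> b = b \<otimes> commutator G (inv g) (inv h)"
proof -
  have [simp]: "c \<in> carrier G" "d \<in> carrier G" using b g h c d by simp_all
  have bh: "b \<otimes> h = h \<otimes> (b \<otimes> c)" using b h by (simp add: c commutator_def m_assoc)
  have bg: "b \<otimes> g = g \<otimes> (b \<otimes> d)" using b g by (simp add: d commutator_def m_assoc)
  define u v e where "u = h \<otimes> g" and "v = g \<otimes> h" and "e = b \<otimes> (d \<otimes> c)"
  have uve [simp]: "u \<in> carrier G" "v \<in> carrier G" "e \<in> carrier G"
    using b g h by (simp_all add: u_def v_def e_def)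
  have bu: "b \<otimes> u = u \<otimes> e"
  proof -
    have "b \<otimes> u = h \<otimes> (b \<otimes> (c \<otimes> g))"
      using b g h bh by (simp add: u_def m_assoc) (simp flip: m_assoc)
    also have "\<dots> = h \<otimes> ((b \<otimes> g) \<otimes> c)" using b g h by (simp add: comm m_assoc)
    finally show ?thesis using b g h by (simp add: bg m_assoc u_def e_def)
  qed
  have bv: "b \<otimes> v = v \<otimes> e"
  proof -
    have "b \<otimes> v = g \<otimes> (b \<otimes> (d \<otimes> h))"
      using b g h bg by (simp add: v_def m_assoc) (simp flip: m_assoc)
    also have "\<dots> = g \<otimes> ((b \<otimes> h) \<otimes> d)" using b g h by (simp add: comm m_assoc)
    also have "\<dots> = g \<otimes> h \<otimes> (b \<otimes> (c \<otimes> d))" using b g h by (simp add: bh m_assoc)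
    finally show ?thesis by (simp add: comm v_def e_def)
  qed
  have k: "commutator G (inv g) (inv h) = v \<otimes> inv u"
    using g h by (simp add: commutator_def u_def v_def inv_mult_group m_assoc)
  have "v \<otimes> inv u \<otimes> b = v \<otimes> (inv u \<otimes> (b \<otimes> u)) \<otimes> inv u"
    using b by (simp add: m_assoc)
  also have "\<dots> = b \<otimes> v \<otimes> inv u" using b by (simp add: bu bv)
  finally have "v \<otimes> inv u \<otimes> b = b \<otimes> (v \<otimes> inv u)" using b by (simp add: m_assoc)
  with k show ?thesis by simp
qed

lemma (in group) subgroup_nat_pow_closed:
  "subgroup H G \<Longrightarrow> h \<in> H \<Longrightarrow> h [^] (k::nat) \<in> H"
  by (induction k) (auto simp: subgroup.one_closed subgroup.m_closed)

lemma (in group_hom) subgroup_preimage: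
  assumes "subgroup K H"
  shows "subgroup {x \<in> carrier G. h x \<in> K} G"
proof (rule G.subgroupI)
  have "\<one>\<^bsub>G\<^esub> \<in> {x \<in> carrier G. h x \<in> K}"
    using subgroup.one_closed[OF assms] by simp
  then show "{x \<in> carrier G. h x \<in> K} \<noteq> {}" by blast
qed (use subgroup.m_closed[OF assms] subgroup.m_inv_closed[OF assms] in auto)

lemma (in normal) rcos_eq_iff:
  assumes "x \<in> carrier G" "y \<in> carrier G"
  shows "H #> x = H #> y \<longleftrightarrow> inv y \<otimes> x \<in> H"
proof -
  have "H #> x = H #> y \<longleftrightarrow> x \<in> H #> y"
    using assms is_subgroup by (metis rcos_self repr_independence)
  also have "\<dots> \<longleftrightarrow> x \<in> y <# H" using assms coset_eq by blast
  also have "\<dots> \<longleftrightarrow> inv y \<otimes> x \<in> H"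
  proof
    assume "inv y \<otimes> x \<in> H"
    then have "y \<otimes> (inv y \<otimes> x) \<in> y <# H" unfolding l_coset_def by blast
    with assms show "x \<in> y <# H" by simp
  qed (use assms mem_carrier in \<open>auto simp: l_coset_def\<close>)
  finally show ?thesis .
qed

text \<open>Moves the question to the quotient group, where the identities for commuting elements
  apply.\<close>

lemma (in normal) commutator_mem_iff:
  assumes "x \<in> carrier G" "y \<in> carrier G"
  shows "commutator G x y \<in> H \<longleftrightarrow>
    (H #> x) \<otimes>\<^bsub>G Mod H\<^esub> (H #> y) = (H #> y) \<otimes>\<^bsub>G Mod H\<^esub> (H #> x)"
proof -
  have "commutator G x y = inv (y \<otimes> x) \<otimes> (x \<otimes> y)"
    using assms by (simp add: commutator_def inv_mult_group m_assoc)
  with assms show ?thesis by (simp add: rcos_sum rcos_eq_iff del: inv_mult_group)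
qed

lemma (in normal) rcoset_commutator:
  assumes "x \<in> carrier G" "y \<in> carrier G"
  shows "H #> commutator G x y = commutator (G Mod H) (H #> x) (H #> y)"
proof -
  interpret Q: group "G Mod H" by (rule factorgroup_is_group)
  interpret group_hom G "G Mod H" "\<lambda>x. H #> x"
    by unfold_locales (rule r_coset_hom_Mod)
  show ?thesis
    using assms by (simp del: mult_FactGroup add: commutator_def flip: hom_inv)
qed

section \<open>Continuity of the operations and closed generation\<close>

context topgroup
begin

lemma topspace_eq [simp]: "topspace T = carrier G"
  using topological_group by (simp add: topological_group_def)

lemma continuous_map_mult:
  assumes "continuous_map Y T f" "continuous_map Y T g"
  shows "continuous_map Y T (\<lambda>y. f y \<otimes> g y)"
proof -
  have "continuous_map (prod_topology T T) T (\<lambda>(g, h). g \<otimes> h)"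
    using topological_group by (simp add: topological_group_def)
  with continuous_map_compose[OF continuous_map_pairedI[OF assms]] show ?thesis
    by (fastforce simp: o_def)
qed

lemma continuous_map_inv: "continuous_map Y T f \<Longrightarrow> continuous_map Y T (\<lambda>y. inv f y)"
  using topological_group continuous_map_compose[of Y T f T "\<lambda>g. inv g"]
  by (simp add: topological_group_def o_def)

lemma continuous_map_commutator:
  "continuous_map Y T f \<Longrightarrow> continuous_map Y T g \<Longrightarrow> continuous_map Y T (\<lambda>y. commutator G (f y) (g y))"
  unfolding commutator_def by (intro continuous_map_mult continuous_map_inv)

lemma closedin_carrier_preimage:
  "closedin T C \<Longrightarrow> continuous_map T T f \<Longrightarrow> closedin T {x \<in> carrier G. f x \<in> C}"
  using closedin_continuous_map_preimage[of T T f C] by simp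

lemma openin_carrier_preimage:
  "openin T C \<Longrightarrow> continuous_map T T f \<Longrightarrow> openin T {x \<in> carrier G. f x \<in> C}"
  using openin_continuous_map_preimage[of T T f C] by simp

lemma openin_rcoset:
  assumes "openin T V" "g \<in> carrier G"
  shows "openin T (V #> g)"
proof -
  have "V \<subseteq> carrier G" using assms(1) openin_subset by fastforce
  then have "V #> g = {x \<in> carrier G. x \<otimes> inv g \<in> V}"
    using assms(2)
    by (auto simp: r_coset_def m_assoc subset_iff intro!: bexI[where x = "_ \<otimes> inv g"])
  moreover have "continuous_map T T (\<lambda>x. x \<otimes> inv g)"
    using assms(2) by (intro continuous_map_mult) auto
  ultimately show ?thesis using assms(1) by (simp add: openin_carrier_preimage)
qed

lemma closed_generate_subset:
  "subgroup H G \<Longrightarrow> closedin T H \<Longrightarrow> A \<subseteq> H \<Longrightarrow> closed_generate G T A \<subseteq> H"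
  by (auto simp: closed_generate_def)

lemma subset_closed_generate: "A \<subseteq> closed_generate G T A"
  by (auto simp: closed_generate_def)

lemma
  assumes "A \<subseteq> carrier G"
  shows subgroup_closed_generate: "subgroup (closed_generate G T A) G"
    and closedin_closed_generate: "closedin T (closed_generate G T A)"
proof -
  let ?F = "{H. subgroup H G \<and> closedin T H \<and> A \<subseteq> H}"
  have "carrier G \<in> ?F" using assms subgroup_self closedin_topspace[of T] by simp
  then have "?F \<noteq> {}" by blast
  then show "subgroup (closed_generate G T A) G" "closedin T (closed_generate G T A)"
    unfolding closed_generate_def by (auto intro!: subgroups_Inter closedin_Inter)
qed

end


section \<open>The lower p-central filtration\<close>

context topgroup
begin

lemma lower_p_central_Suc:
  "0 < n \<Longrightarrow> lower_p_central G T p (Suc n) =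
     closed_generate G T ({h [^] p | h. h \<in> lower_p_central G T p n} \<union>
       {commutator G g h | g h. g \<in> carrier G \<and> h \<in> lower_p_central G T p n})"
  by (cases n) auto

lemma lower_p_central_subset_carrier: "lower_p_central G T p n \<subseteq> carrier G"
proof (induction n)
  case (Suc n)
  show ?case
  proof (cases "n = 0")
    case False
    then show ?thesis
      using Suc subgroup_self closedin_topspace[of T]
      by (simp add: lower_p_central_Suc) (rule closed_generate_subset, auto)
  qed simp
qed simp

lemma subgroup_lower_p_central: "subgroup (lower_p_central G T p n) G"
  and closedin_lower_p_central: "closedin T (lower_p_central G T p n)"
proof -
  have "subgroup (lower_p_central G T p n) G \<and> closedin T (lower_p_central G T p n)"
  proof (cases "n \<le> 1")
    case True
    then have "lower_p_central G T p n = carrier G" by (cases n) auto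
    then show ?thesis using subgroup_self closedin_topspace[of T] by simp
  next
    case False
    then obtain m where "n = Suc m" "0 < m" by (cases n) auto
    moreover have "{h [^] p | h. h \<in> lower_p_central G T p m} \<union>
      {commutator G g h | g h. g \<in> carrier G \<and> h \<in> lower_p_central G T p m} \<subseteq> carrier G"
      using lower_p_central_subset_carrier[of p m] by auto
    ultimately show ?thesis
      by (simp add: lower_p_central_Suc subgroup_closed_generate closedin_closed_generate)
  qed
  then show "subgroup (lower_p_central G T p n) G" "closedin T (lower_p_central G T p n)"
    by auto
qed

lemma pow_mem_lower_p_central:
  "h \<in> lower_p_central G T p n \<Longrightarrow> h [^] p \<in> lower_p_central G T p (Suc n)"
  using lower_p_central_subset_carrier[of p n]
  by (cases "n = 0")
    (auto simp: lower_p_central_Suc intro!: subset_closed_generate[THEN subsetD])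

lemma commutator_mem_lower_p_central:
  "g \<in> carrier G \<Longrightarrow> h \<in> lower_p_central G T p n \<Longrightarrow> commutator G g h \<in> lower_p_central G T p (Suc n)"
  using lower_p_central_subset_carrier[of p n]
  by (cases "n = 0")
    (auto simp: lower_p_central_Suc intro!: subset_closed_generate[THEN subsetD])

lemma conj_eq_commutator_mult:
  "x \<in> carrier G \<Longrightarrow> h \<in> carrier G \<Longrightarrow> x \<otimes> h \<otimes> inv x = commutator G (inv x) (inv h) \<otimes> h"
  by (simp add: commutator_def m_assoc)

text \<open>The two statements feed each other: a conjugate of \<open>h\<close> differs from
  \<open>h\<close> by a commutator, which lies in the right term by the inclusion one step earlier;
  normality of a term then puts the generators of the next term inside it.\<close>

lemma normal_lower_p_central: "lower_p_central G T p n \<lhd> G"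
  and lower_p_central_Suc_subset: "lower_p_central G T p (Suc n) \<subseteq> lower_p_central G T p n"
proof (induction n)
  case 0
  { case 1 show ?case using subgroup_lower_p_central[of p 0] by (intro normal_invI) auto }
  { case 2 show ?case by simp }
next
  case (Suc n)
  have sub: "subgroup (lower_p_central G T p k) G" for k by (rule subgroup_lower_p_central)
  { case 1
    show ?case
    proof (rule normal_invI[OF sub])
      fix x h assume x: "x \<in> carrier G" and h: "h \<in> lower_p_central G T p (Suc n)"
      have "inv h \<in> lower_p_central G T p n"
        by (rule subgroup.m_inv_closed[OF sub subsetD[OF Suc.IH(2) h]])
      then have "commutator G (inv x) (inv h) \<in> lower_p_central G T p (Suc n)"
        using x commutator_mem_lower_p_central by simp
      with x h sub show "x \<otimes> h \<otimes> inv x \<in> lower_p_central G T p (Suc n)"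
        by (metis conj_eq_commutator_mult subgroup.m_closed subgroup.mem_carrier)
    qed }
  note normal = this
  { case 2
    interpret N: normal "lower_p_central G T p (Suc n)" G by (rule normal)
    have "commutator G g h \<in> lower_p_central G T p (Suc n)"
      if "g \<in> carrier G" "h \<in> lower_p_central G T p (Suc n)" for g h
      using that N.inv_op_closed1[of g "inv h"] by (auto simp: commutator_def intro!: N.m_closed)
    moreover have "h [^] p \<in> lower_p_central G T p (Suc n)"
      if "h \<in> lower_p_central G T p (Suc n)" for h
      using that N.is_subgroup by (simp add: subgroup_nat_pow_closed)
    ultimately show ?case
      unfolding lower_p_central_Suc[OF zero_less_Suc]
      by (intro closed_generate_subset sub closedin_lower_p_central) auto }
qed

text \<open>
  With \<open>k = i + j\<close>, the set of all \<open>a\<close> commuting with a given \<open>b\<close> modulo the term of index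
  \<open>Suc k\<close> is a closed subgroup, so it is enough to consider the generators of the term of index
  \<open>Suc i\<close>.
\<close>

lemma commutator_mem_lower_p_central_add:
  assumes "0 < i" "a \<in> lower_p_central G T p i" "b \<in> lower_p_central G T p j"
  shows "commutator G a b \<in> lower_p_central G T p (i + j)"
  using assms
proof (induction i arbitrary: a b j)
  case (Suc i)
  note L = lower_p_central_subset_carrier[THEN subsetD, of _ p]
  note mult_FactGroup [simp del]
  have b: "b \<in> carrier G" using Suc.prems L by blast
  show ?case
  proof (cases "i = 0")
    case True
    then show ?thesis using Suc.prems commutator_mem_lower_p_central[of a b p j] by simp
  next
    case False
    let ?M = "lower_p_central G T p (Suc (i + j))"
    interpret M: normal ?M G by (rule normal_lower_p_central)
    interpret Q: group "G Mod ?M" by (rule M.factorgroup_is_group)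
    define \<pi> where "\<pi> = (\<lambda>x. ?M #> x)"
    interpret \<pi>: group_hom G "G Mod ?M" \<pi>
      by unfold_locales (simp add: \<pi>_def M.r_coset_hom_Mod)
    have comm: "commutator G x y \<in> ?M \<longleftrightarrow> \<pi> x \<otimes>\<^bsub>G Mod ?M\<^esub> \<pi> y = \<pi> y \<otimes>\<^bsub>G Mod ?M\<^esub> \<pi> x"
      if "x \<in> carrier G" "y \<in> carrier G" for x y
      using that by (simp only: \<pi>_def M.commutator_mem_iff)
    have \<pi>_comm: "\<pi> (commutator G x y) = commutator (G Mod ?M) (\<pi> x) (\<pi> y)"
      if "x \<in> carrier G" "y \<in> carrier G" for x y
      using that by (simp only: \<pi>_def M.rcoset_commutator)
    have swap: "commutator G x y \<in> lower_p_central G T p k \<longleftrightarrow> commutator G y x \<in> lower_p_central G T p k"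
      if "x \<in> carrier G" "y \<in> carrier G" for x y k
      using that subgroup.m_inv_closed[OF subgroup_lower_p_central[of p k]]
      by (metis commutator_swap)
    have \<pi>_central: "\<pi> x \<otimes>\<^bsub>G Mod ?M\<^esub> \<pi> y = \<pi> y \<otimes>\<^bsub>G Mod ?M\<^esub> \<pi> x"
      if "x \<in> lower_p_central G T p (i + j)" "y \<in> carrier G" for x y
      using that commutator_mem_lower_p_central[of y x p "i + j"] L
      by (subst eq_commute, subst comm[symmetric]) auto
    \<comment> \<open>\<open>swap\<close> brings the element that carries the induction index into
      second place. The index \<open>j'\<close> stays free because the commutator generators need
      the hypothesis at \<open>Suc j\<close>.\<close>
    have IH: "commutator G b' h \<in> lower_p_central G T p (i + j')"
      if "h \<in> lower_p_central G T p i" "b' \<in> lower_p_central G T p j'" for h b' j'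
      using Suc.IH[of h b' j'] that False swap L by blast
    let ?D = "{a \<in> carrier G. commutator G a b \<in> ?M}"
    have "lower_p_central G T p (Suc i) \<subseteq> ?D"
      unfolding lower_p_central_Suc[OF \<open>i \<noteq> 0\<close>[unfolded neq0_conv]]
    proof (rule closed_generate_subset)
      have "?D = {x \<in> carrier G. \<pi> x \<in> {a \<in> carrier (G Mod ?M). a \<otimes>\<^bsub>G Mod ?M\<^esub> \<pi> b = \<pi> b \<otimes>\<^bsub>G Mod ?M\<^esub> a}}"
        using b comm[OF _ b] \<pi>.hom_closed by blast
      then show "subgroup ?D G"
        using \<pi>.subgroup_preimage[OF Q.commuting_subgroup[OF \<pi>.hom_closed[OF b]]] by simp
      show "closedin T ?D"
        using b by (intro closedin_carrier_preimage closedin_lower_p_central continuous_map_commutator) auto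
      have "commutator G (h [^] p) b \<in> ?M" if h: "h \<in> lower_p_central G T p i" for h
      proof -
        have hc: "h \<in> carrier G" using h L by blast
        define c where "c = commutator G b h"
        have c: "c \<in> lower_p_central G T p (i + j)" using IH h Suc.prems by (simp add: c_def)
        then have cc: "c \<in> carrier G" using L by blast
        have "\<pi> c [^]\<^bsub>G Mod ?M\<^esub> p = \<pi> (c [^] p)" using cc by (simp add: \<pi>.hom_nat_pow)
        also have "\<dots> = \<one>\<^bsub>G Mod ?M\<^esub>"
          using pow_mem_lower_p_central[OF c] by (simp add: \<pi>_def M.rcos_const is_group)
        finally have cp: "\<pi> c [^]\<^bsub>G Mod ?M\<^esub> p = \<one>\<^bsub>G Mod ?M\<^esub>" .
        have "\<pi> c \<otimes>\<^bsub>G Mod ?M\<^esub> \<pi> h = \<pi> h \<otimes>\<^bsub>G Mod ?M\<^esub> \<pi> c"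
          using c hc by (rule \<pi>_central)
        moreover have "\<pi> c = commutator (G Mod ?M) (\<pi> b) (\<pi> h)"
          using b hc by (simp only: c_def \<pi>_comm)
        ultimately have "\<pi> h [^]\<^bsub>G Mod ?M\<^esub> p \<otimes>\<^bsub>G Mod ?M\<^esub> \<pi> b = \<pi> b \<otimes>\<^bsub>G Mod ?M\<^esub> \<pi> h [^]\<^bsub>G Mod ?M\<^esub> p"
          using b hc cp by (intro Q.commutes_pow_if_commutator_pow_eq_one) simp_all
        then show ?thesis using b hc by (simp add: comm \<pi>.hom_nat_pow)
      qed
      moreover have "commutator G (commutator G g h) b \<in> ?M"
        if g: "g \<in> carrier G" and h: "h \<in> lower_p_central G T p i" for g h
      proof -
        have hc: "h \<in> carrier G" using h L by blast
        \<comment> \<open>\<open>commutes_commutator\<close> concludes about the commutator of the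
          inverses, so its inputs are formed with \<open>inv h\<close> and \<open>inv g\<close>; the
          double inverses are removed at the end.\<close>
        define c d where "c = commutator G b (inv h)" and "d = commutator G b (inv g)"
        have h': "inv h \<in> lower_p_central G T p i"
          by (rule subgroup.m_inv_closed[OF subgroup_lower_p_central h])
        have c: "c \<in> lower_p_central G T p (i + j)" using IH h' Suc.prems by (simp add: c_def)
        have d: "d \<in> lower_p_central G T p (Suc j)"
          using g b Suc.prems commutator_mem_lower_p_central[of "inv g" b p j]
          by (subst d_def, subst swap) auto
        have "commutator G d (inv h) \<in> ?M"
          using IH[OF h' d] by simp
        moreover have cc: "c \<in> carrier G" "d \<in> carrier G" using c d L by blast+
        ultimately have dh: "\<pi> d \<otimes>\<^bsub>G Mod ?M\<^esub> \<pi> (inv h) = \<pi> (inv h) \<otimes>\<^bsub>G Mod ?M\<^esub> \<pi> d"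
          using hc by (simp add: comm)
        have "\<pi> c \<otimes>\<^bsub>G Mod ?M\<^esub> \<pi> (inv g) = \<pi> (inv g) \<otimes>\<^bsub>G Mod ?M\<^esub> \<pi> c"
          "\<pi> c \<otimes>\<^bsub>G Mod ?M\<^esub> \<pi> d = \<pi> d \<otimes>\<^bsub>G Mod ?M\<^esub> \<pi> c"
          using g cc by (rule_tac [!] \<pi>_central[OF c]) simp_all
        moreover have "\<pi> c = commutator (G Mod ?M) (\<pi> b) (\<pi> (inv h))"
          "\<pi> d = commutator (G Mod ?M) (\<pi> b) (\<pi> (inv g))"
          using b g hc by (simp_all only: c_def d_def \<pi>_comm inv_closed)
        ultimately have "commutator (G Mod ?M) (inv\<^bsub>G Mod ?M\<^esub> \<pi> (inv g)) (inv\<^bsub>G Mod ?M\<^esub> \<pi> (inv h)) \<otimes>\<^bsub>G Mod ?M\<^esub> \<pi> b =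
          \<pi> b \<otimes>\<^bsub>G Mod ?M\<^esub> commutator (G Mod ?M) (inv\<^bsub>G Mod ?M\<^esub> \<pi> (inv g)) (inv\<^bsub>G Mod ?M\<^esub> \<pi> (inv h))"
          using b g hc dh by (intro Q.commutes_commutator[where c = "\<pi> c" and d = "\<pi> d"]) simp_all
        moreover have "inv\<^bsub>G Mod ?M\<^esub> \<pi> (inv x) = \<pi> x" if "x \<in> carrier G" for x
          using that \<pi>.hom_inv[of "inv x"] by simp
        ultimately show ?thesis using b g hc by (simp add: comm \<pi>_comm)
      qed
      ultimately show "{h [^] p | h. h \<in> lower_p_central G T p i} \<union>
        {commutator G g h | g h. g \<in> carrier G \<and> h \<in> lower_p_central G T p i} \<subseteq> ?D"
        using L by auto
    qed
    with Suc.prems show ?thesis by auto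
  qed
qed simp

lemma pow_pow_mem_lower_p_central:
  assumes "h \<in> lower_p_central G T p s"
  shows "h [^] (p ^ m) \<in> lower_p_central G T p (s + m)"
proof (induction m)
  case (Suc m)
  have "h \<in> carrier G" using assms lower_p_central_subset_carrier by blast
  then have "h [^] (p ^ Suc m) = (h [^] (p ^ m)) [^] p"
    by (simp add: nat_pow_pow mult.commute)
  with pow_mem_lower_p_central[OF Suc] show ?case by simp
next
  case 0
  have "h \<in> carrier G" using assms lower_p_central_subset_carrier by blast
  with assms show ?case by simp
qed

end

text \<open>The preimage of the next term is a closed subgroup that contains all generators. This is
  what lets the unipotent representations pass to the quotients by the \<open>n\<close>-th
  terms.\<close>

lemma hom_lower_p_central:
  assumes "topgroup G T" "topgroup H U" and \<phi>: "\<phi> \<in> hom G H" "continuous_map T U \<phi>"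
    and "x \<in> lower_p_central G T p n"
  shows "\<phi> x \<in> lower_p_central H U p n"
  using assms(5)
proof (induction n arbitrary: x)
  case 0
  then show ?case using \<phi>(1) by (auto simp: hom_def)
next
  case (Suc n)
  interpret G: topgroup G T by fact
  interpret H: topgroup H U by fact
  interpret group_hom G H \<phi> using \<phi> by unfold_locales
  show ?case
  proof (cases "n = 0")
    case True
    with Suc.prems show ?thesis by auto
  next
    case False
    let ?D = "{x \<in> carrier G. \<phi> x \<in> lower_p_central H U p (Suc n)}"
    have comm_mem: "\<phi> (commutator G g h) \<in> lower_p_central H U p (Suc n)"
      if "g \<in> carrier G" "h \<in> lower_p_central G T p n" for g h
    proof -
      have "h \<in> carrier G" using that G.lower_p_central_subset_carrier by blast
      then have "\<phi> (commutator G g h) = commutator H (\<phi> g) (\<phi> h)"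
        using that by (simp add: commutator_def)
      with that Suc.IH show ?thesis using H.commutator_mem_lower_p_central by simp
    qed
    have pow_mem: "\<phi> (h [^]\<^bsub>G\<^esub> p) \<in> lower_p_central H U p (Suc n)"
      if "h \<in> lower_p_central G T p n" for h
    proof -
      have "h \<in> carrier G" using that G.lower_p_central_subset_carrier by blast
      then have "\<phi> (h [^]\<^bsub>G\<^esub> p) = \<phi> h [^]\<^bsub>H\<^esub> p" by (rule hom_nat_pow)
      with that Suc.IH show ?thesis using H.pow_mem_lower_p_central by simp
    qed
    have closed: "closedin T ?D"
      using closedin_continuous_map_preimage[OF \<phi>(2) H.closedin_lower_p_central[of p "Suc n"]] by simp
    have "lower_p_central G T p (Suc n) \<subseteq> ?D"
      unfolding G.lower_p_central_Suc[OF \<open>n \<noteq> 0\<close>[unfolded neq0_conv]]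
    proof (rule G.closed_generate_subset[OF _ closed])
      show "subgroup ?D G" by (rule subgroup_preimage[OF H.subgroup_lower_p_central])
      show "{h [^]\<^bsub>G\<^esub> p | h. h \<in> lower_p_central G T p n} \<union>
        {commutator G g h | g h. g \<in> carrier G \<and> h \<in> lower_p_central G T p n} \<subseteq> ?D"
        using comm_mem pow_mem G.lower_p_central_subset_carrier[of p n]
        by (auto simp del: lower_p_central.simps)
    qed
    with Suc.prems show ?thesis by auto
  qed
qed


section \<open>Open normal subgroups of profinite groups\<close>

text \<open>The Sura-Bura argument: normality separates two closed pieces of the quasi-component by
  disjoint open sets, compactness of the rest yields a clopen set inside their union, and cutting it
  down to one side would split the quasi-component by a clopen set.\<close>

lemma quasi_component_connected:
  assumes "compact_space X" "Hausdorff_space X"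
  shows "connectedin X (quasi_component_of_set X x)"
proof (cases "x \<in> topspace X")
  case False
  then show ?thesis by (metis connectedin_empty quasi_component_of_eq_empty)
next
  case True
  let ?Q = "quasi_component_of_set X x"
  have Q: "closedin X ?Q" by (rule closedin_quasi_component_of)
  have xQ: "x \<in> ?Q" using True by simp
  have *: "E2 \<inter> ?Q = {}"
    if E: "closedin X E1" "closedin X E2" "?Q \<subseteq> E1 \<union> E2" "E1 \<inter> E2 \<inter> ?Q = {}" "x \<in> E1" for E1 E2
  proof -
    have "normal_space X"
      using assms compact_Hausdorff_or_regular_imp_normal_space by blast
    moreover have "closedin X (?Q \<inter> E1)" "closedin X (?Q \<inter> E2)" "disjnt (?Q \<inter> E1) (?Q \<inter> E2)"
      using Q E by (auto simp: disjnt_def)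
    ultimately obtain U V where UV: "openin X U" "openin X V" "?Q \<inter> E1 \<subseteq> U" "?Q \<inter> E2 \<subseteq> V" "disjnt U V"
      unfolding normal_space_def by meson
    let ?K = "topspace X - (U \<union> V)"
    have "compactin X ?K"
      using UV assms(1) by (intro closedin_compact_space closedin_diff) auto
    moreover have "disjnt ?Q ?K" using UV E by (auto simp: disjnt_def)
    moreover have "?Q \<in> quasi_components_of X"
      using True by (auto simp: quasi_components_of_def)
    ultimately have "separated_between X ?Q ?K"
      by (simp add: separated_between_quasi_component_compact)
    then obtain D where D: "closedin X D" "openin X D" "?Q \<subseteq> D" "?K \<subseteq> topspace X - D"
      unfolding separated_between by blast
    have DUV: "D \<subseteq> U \<union> V" using D openin_subset[OF D(2)] by blast
    \<comment> \<open>Inside \<open>D\<close> the set \<open>U\<close> is the complement of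
      \<open>V\<close>; this makes \<open>D \<inter> U\<close> closed as well as open.\<close>
    have "D \<inter> U = D - V" using DUV UV(5) by (auto simp: disjnt_def)
    then have "closedin X (D \<inter> U)" using D UV by (simp add: closedin_diff)
    moreover have "openin X (D \<inter> U)" using D UV by blast
    moreover have "x \<in> D \<inter> U" using xQ D UV E by blast
    ultimately have "?Q \<subseteq> D \<inter> U" unfolding quasi_component_of by blast
    then show ?thesis using UV unfolding disjnt_def by blast
  qed
  have sep: "\<not> (\<exists>E1 E2. closedin X E1 \<and> closedin X E2 \<and> ?Q \<subseteq> E1 \<union> E2 \<and>
      E1 \<inter> E2 \<inter> ?Q = {} \<and> E1 \<inter> ?Q \<noteq> {} \<and> E2 \<inter> ?Q \<noteq> {})"
  proof (rule notI, elim exE conjE)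
    fix E1 E2
    assume E: "closedin X E1" "closedin X E2" "?Q \<subseteq> E1 \<union> E2"
      "E1 \<inter> E2 \<inter> ?Q = {}" "E1 \<inter> ?Q \<noteq> {}" "E2 \<inter> ?Q \<noteq> {}"
    from E(3) xQ consider "x \<in> E1" | "x \<in> E2" by blast
    then show False
    proof cases
      case 1
      then show False using *[OF E(1-4)] E(6) by simp
    next
      case 2
      then show False using *[OF E(2,1)] E(3-5) by (simp add: Un_commute Int_commute)
    qed
  qed
  show ?thesis
    by (rule connectedin_closedin[THEN iffD2, OF conjI[OF quasi_component_of_subset_topspace sep]])
qed

text \<open>Total disconnectedness shrinks the connected quasi-component of \<open>x\<close> to a
  point, and a quasi-component is separated by clopen sets from every compact set disjoint from
  it.\<close>

lemma clopen_neighbourhood: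
  assumes "compact_space X" "Hausdorff_space X"
    and "\<And>C x y. connectedin X C \<Longrightarrow> x \<in> C \<Longrightarrow> y \<in> C \<Longrightarrow> x = y"
    and "openin X W" "x \<in> W"
  obtains K where "openin X K" "closedin X K" "x \<in> K" "K \<subseteq> W"
proof -
  let ?Q = "quasi_component_of_set X x"
  have x: "x \<in> topspace X" using assms(4,5) openin_subset by blast
  have "?Q = {x}"
    using assms(3)[OF quasi_component_connected[OF assms(1,2)], where y = x] x by auto
  moreover have "?Q \<in> quasi_components_of X"
    using x by (auto simp: quasi_components_of_def)
  ultimately have "{x} \<in> quasi_components_of X" by simp
  moreover have "compactin X (topspace X - W)"
    using assms(1,4) by (intro closedin_compact_space) auto
  moreover have "disjnt {x} (topspace X - W)" using assms(5) by simp
  ultimately have "separated_between X {x} (topspace X - W)"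
    by (simp add: separated_between_quasi_component_compact)
  then obtain K where K: "closedin X K" "openin X K" "x \<in> K" "topspace X - W \<subseteq> topspace X - K"
    unfolding separated_between by blast
  moreover have "K \<subseteq> W" using K openin_subset[of X K] by blast
  ultimately show thesis using that by blast
qed

locale profinite = topgroup +
  assumes compact: "compact_space T" and Hausdorff: "Hausdorff_space T"
    and totally_disconnected: "connectedin T C \<Longrightarrow> x \<in> C \<Longrightarrow> y \<in> C \<Longrightarrow> x = y"

lemma profinite_group_iff: "profinite_group G T \<longleftrightarrow> profinite G T"
  unfolding profinite_group_def profinite_def topgroup_def profinite_axioms_def by blast

lemma (in profinite) open_normal_subgroup:
  assumes "openin T W" "\<one> \<in> W"
  obtains V where "V \<lhd> G" "openin T V" "V \<subseteq> W"
proof -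
  obtain K where K: "openin T K" "closedin T K" "\<one> \<in> K" "K \<subseteq> W"
    by (rule clopen_neighbourhood[OF compact Hausdorff _ assms]) (rule totally_disconnected)
  \<comment> \<open>\<open>M\<close> collects the elements that may be inserted between any two
    factors without changing whether the product lies in \<open>K\<close>. Being two-sided, the
    condition is stable under conjugation; with \<open>a = b = \<one>\<close> it gives
    \<open>M \<subseteq> K\<close>.\<close>
  define M where "M = {g \<in> carrier G. \<forall>a\<in>carrier G. \<forall>b\<in>carrier G. a \<otimes> b \<in> K \<longleftrightarrow> a \<otimes> g \<otimes> b \<in> K}"
  have M: "a \<otimes> g \<otimes> b \<in> K \<longleftrightarrow> a \<otimes> b \<in> K" if "g \<in> M" "a \<in> carrier G" "b \<in> carrier G" for g a b
    using that by (auto simp: M_def)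
  have Mc: "g \<in> carrier G" if "g \<in> M" for g using that by (simp add: M_def)
  have MI: "g \<in> M" if "g \<in> carrier G"
    "\<And>a b. a \<in> carrier G \<Longrightarrow> b \<in> carrier G \<Longrightarrow> a \<otimes> g \<otimes> b \<in> K \<longleftrightarrow> a \<otimes> b \<in> K" for g
    using that by (auto simp: M_def)
  have "subgroup M G"
  proof (rule subgroupI)
    show "M \<subseteq> carrier G" using Mc by blast
    have "\<one> \<in> M" by (rule MI) auto
    then show "M \<noteq> {}" by blast
  next
    fix g assume g: "g \<in> M"
    show "inv g \<in> M"
    proof (rule MI)
      fix a b assume ab: "a \<in> carrier G" "b \<in> carrier G"
      then show "a \<otimes> inv g \<otimes> b \<in> K \<longleftrightarrow> a \<otimes> b \<in> K"
        using M[OF g, of a "inv g \<otimes> b"] Mc[OF g] by (simp add: m_assoc)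
    qed (use Mc g in simp)
  next
    fix g h assume g: "g \<in> M" and h: "h \<in> M"
    show "g \<otimes> h \<in> M"
    proof (rule MI)
      fix a b assume ab: "a \<in> carrier G" "b \<in> carrier G"
      then show "a \<otimes> (g \<otimes> h) \<otimes> b \<in> K \<longleftrightarrow> a \<otimes> b \<in> K"
        using M[OF g, of a "h \<otimes> b"] M[OF h, of a b] Mc[OF g] Mc[OF h] by (simp add: m_assoc)
    qed (use Mc g h in simp)
  qed
  then have "M \<lhd> G"
  proof (rule normal_invI)
    fix x h assume x: "x \<in> carrier G" and h: "h \<in> M"
    show "x \<otimes> h \<otimes> inv x \<in> M"
    proof (rule MI)
      fix a b assume ab: "a \<in> carrier G" "b \<in> carrier G"
      then show "a \<otimes> (x \<otimes> h \<otimes> inv x) \<otimes> b \<in> K \<longleftrightarrow> a \<otimes> b \<in> K"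
        using M[OF h, of "a \<otimes> x" "inv x \<otimes> b"] Mc[OF h] x by (simp add: m_assoc)
    qed (use Mc h x in simp)
  qed
  moreover have "openin T M"
  proof -
    \<comment> \<open>The complement of \<open>M\<close> is the projection of the triples on which
      the two memberships disagree. That set is closed because \<open>K\<close> is clopen, and
      projecting along compact factors is a closed map.\<close>
    let ?X = "prod_topology T (prod_topology T T)"
    let ?A = "{z \<in> topspace ?X. fst (snd z) \<otimes> snd (snd z) \<in> K}"
    let ?B = "{z \<in> topspace ?X. fst (snd z) \<otimes> fst z \<otimes> snd (snd z) \<in> K}"
    have fs: "continuous_map ?X T (\<lambda>z. fst (snd z))" "continuous_map ?X T (\<lambda>z. snd (snd z))"
      by (simp_all add: continuous_map_of_fst continuous_map_of_snd continuous_map_snd_of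
        continuous_map_fst_of[unfolded o_def] continuous_map_compose[of _ "prod_topology T T" snd, unfolded o_def]
        continuous_map_fst continuous_map_snd)
    have cA: "continuous_map ?X T (\<lambda>z. fst (snd z) \<otimes> snd (snd z))"
      and cB: "continuous_map ?X T (\<lambda>z. fst (snd z) \<otimes> fst z \<otimes> snd (snd z))"
      using fs by (auto intro!: continuous_map_mult continuous_map_fst)
    have A: "openin ?X ?A" "closedin ?X ?A" and B: "openin ?X ?B" "closedin ?X ?B"
      by (fact openin_continuous_map_preimage[OF cA K(1)] closedin_continuous_map_preimage[OF cA K(2)]
        openin_continuous_map_preimage[OF cB K(1)] closedin_continuous_map_preimage[OF cB K(2)])+
    have "closedin ?X ((?A - ?B) \<union> (?B - ?A))"
      using A B by (intro closedin_Un closedin_diff)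
    moreover have "closed_map ?X T fst"
      by (rule Abstract_Topological_Spaces.closed_map_fst)
        (simp add: compact_space_prod_topology compact)
    ultimately have "closedin T (fst ` ((?A - ?B) \<union> (?B - ?A)))"
      by (simp add: closed_map_def)
    also have "fst ` ((?A - ?B) \<union> (?B - ?A)) = carrier G - M"
    proof (intro equalityI subsetI)
      fix g assume "g \<in> carrier G - M"
      then obtain a b where "g \<in> carrier G" "a \<in> carrier G" "b \<in> carrier G"
        "(a \<otimes> b \<in> K) \<noteq> (a \<otimes> g \<otimes> b \<in> K)" by (auto simp: M_def)
      then have "(g, a, b) \<in> (?A - ?B) \<union> (?B - ?A)" by auto
      then show "g \<in> fst ` ((?A - ?B) \<union> (?B - ?A))" by (rule rev_image_eqI) simp
    qed (auto simp: M_def)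
    finally show ?thesis
      using Mc openin_closedin[of M T] by (simp add: subsetI)
  qed
  moreover have "M \<subseteq> W"
  proof
    fix g assume "g \<in> M"
    with M[of g \<one> \<one>] K Mc[of g] show "g \<in> W" by auto
  qed
  ultimately show thesis by (rule that)
qed

section \<open>Cochains with values in Z/m\<close>

text \<open>Every function between discrete spaces is continuous, so arithmetic on cochain values
  carries no continuity argument of its own.\<close>

lemma continuous_map_discrete_comp2:
  assumes "continuous_map X (discrete_topology A) f" "continuous_map X (discrete_topology B) g"
    and "\<And>x. x \<in> topspace X \<Longrightarrow> F (f x) (g x) \<in> C"
  shows "continuous_map X (discrete_topology C) (\<lambda>x. F (f x) (g x))"
proof -
  have "continuous_map X (prod_topology (discrete_topology A) (discrete_topology B)) (\<lambda>x. (f x, g x))"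
    using assms by (simp add: continuous_map_pairwise o_def)
  then have "continuous_map X (discrete_topology (A \<times> B)) (\<lambda>x. (f x, g x))"
    by (simp add: prod_topology_discrete_topology)
  moreover have "continuous_map (discrete_topology (A \<times> B)) (discrete_topology UNIV) (\<lambda>(a, b). F a b)"
    by simp
  ultimately have "continuous_map X (discrete_topology UNIV) (\<lambda>x. F (f x) (g x))"
    using continuous_map_compose[of X "discrete_topology (A \<times> B)" "\<lambda>x. (f x, g x)" "discrete_topology UNIV" "\<lambda>(a, b). F a b"]
    by (simp add: o_def)
  then have "continuous_map X (subtopology (discrete_topology UNIV) C) (\<lambda>x. F (f x) (g x))"
    using assms(3) by (intro continuous_map_into_subtopology) auto
  then show ?thesis by simp
qed

lemma (in residues) res_minus_eq: "x \<ominus> y = (x - y) mod m"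
  by (simp add: a_minus_def res_neg_eq res_add_eq mod_simps)

lemma mod_add_add_eq: "(a mod m + (b mod m + c)) mod m = (a + (b + c)) mod (m :: int)"
  by (metis add.left_commute mod_add_left_eq)

lemma (in residues) mod_carrier_eq [simp]: "x \<in> carrier R \<Longrightarrow> x mod m = x"
  by (simp add: res_carrier_eq)

locale topgroup_residues = topgroup G T + res: residues m R
  for G :: "'a monoid" (structure) and T :: "'a topology" and m :: int and R :: "int ring"
begin

lemma coboundary1_eq:
  "g \<in> carrier G \<Longrightarrow> h \<in> carrier G \<Longrightarrow>
    coboundary1 G R y (g, h) = (y g + y h - y (g \<otimes> h)) mod m"
  by (simp add: coboundary1_def res.res_minus_eq res.res_add_eq mod_simps)

lemma coboundary1_cong:
  assumes "\<And>g. g \<in> carrier G \<Longrightarrow> y g mod m = f g mod m" "g \<in> carrier G" "h \<in> carrier G"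
  shows "coboundary1 G R y (g, h) = (f g + f h - f (g \<otimes> h)) mod m"
  unfolding coboundary1_eq[OF assms(2,3)]
  using assms by (intro mod_diff_cong mod_add_cong) auto

lemma cochains1_carrier: "y \<in> cochains1 G T R \<Longrightarrow> g \<in> carrier G \<Longrightarrow> y g \<in> carrier R"
  by (auto simp: cochains1_def)

lemma cochains1_cong2:
  assumes "a \<in> cochains1 G T R" "b \<in> cochains1 G T R"
  shows "(\<lambda>g\<in>carrier G. F (a g) (b g) mod m) \<in> cochains1 G T R"
proof -
  have "continuous_map T (discrete_topology (carrier R)) (\<lambda>g. F (a g) (b g) mod m)"
    using assms by (intro continuous_map_discrete_comp2[where F = "\<lambda>x y. F x y mod m"]) (auto simp: cochains1_def)
  then have "continuous_map T (discrete_topology (carrier R)) (\<lambda>g\<in>carrier G. F (a g) (b g) mod m)"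
    by (rule continuous_map_eq) simp
  then show ?thesis by (simp add: cochains1_def)
qed

lemma continuous_map_coboundary1:
  assumes "y \<in> cochains1 G T R"
  shows "continuous_map (prod_topology T T) (discrete_topology (carrier R)) (coboundary1 G R y)"
proof -
  have y: "continuous_map T (discrete_topology (carrier R)) y"
    using assms by (simp add: cochains1_def)
  have "continuous_map (prod_topology T T) (discrete_topology (carrier R)) (\<lambda>z. y (fst z))"
    "continuous_map (prod_topology T T) (discrete_topology (carrier R)) (\<lambda>z. y (snd z))"
    using continuous_map_compose[OF continuous_map_fst y] continuous_map_compose[OF continuous_map_snd y]
    by (simp_all add: o_def)
  then have "continuous_map (prod_topology T T) (discrete_topology UNIV) (\<lambda>z. y (fst z) + y (snd z))"
    by (rule continuous_map_discrete_comp2) simp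
  moreover have "continuous_map (prod_topology T T) (discrete_topology (carrier R)) (\<lambda>z. y (fst z \<otimes> snd z))"
    using continuous_map_compose[OF continuous_map_mult[OF continuous_map_fst continuous_map_snd] y]
    by (simp add: o_def)
  ultimately have "continuous_map (prod_topology T T) (discrete_topology (carrier R))
    (\<lambda>z. (y (fst z) + y (snd z) - y (fst z \<otimes> snd z)) mod m)"
    by (rule continuous_map_discrete_comp2[where F = "\<lambda>x y. (x - y) mod m"]) simp
  then show ?thesis
    by (rule continuous_map_eq) (auto simp: coboundary1_eq)
qed

lemma mem_H2_class_iff:
  "f \<in> H2_class G T R c \<longleftrightarrow>
    (\<exists>b\<in>cochains1 G T R. f = (\<lambda>x\<in>carrier G \<times> carrier G. (coboundary1 G R b x + c x) mod m))"
  by (auto simp: H2_class_def r_coset_def coboundaries2_def cocycles2_def res.res_add_eq)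

text \<open>A cochain that witnesses membership in the first class becomes a witness for the second
  when \<open>b\<close> is added to it. The comparison is a congruence because only residues of the
  integer values matter.\<close>

lemma H2_class_subset:
  assumes b: "b \<in> cochains1 G T R"
    and c: "\<And>g h. g \<in> carrier G \<Longrightarrow> h \<in> carrier G \<Longrightarrow> c (g, h) mod m = (coboundary1 G R b (g, h) + c' (g, h)) mod m"
  shows "H2_class G T R c \<subseteq> H2_class G T R c'"
proof
  fix f assume "f \<in> H2_class G T R c"
  then obtain a where a: "a \<in> cochains1 G T R"
    "f = (\<lambda>x\<in>carrier G \<times> carrier G. (coboundary1 G R a x + c x) mod m)"
    by (auto simp: mem_H2_class_iff)
  let ?b = "\<lambda>g\<in>carrier G. (a g + b g) mod m"
  have "f = (\<lambda>x\<in>carrier G \<times> carrier G. (coboundary1 G R ?b x + c' x) mod m)"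
  proof
    fix z
    show "f z = (\<lambda>x\<in>carrier G \<times> carrier G. (coboundary1 G R ?b x + c' x) mod m) z"
    proof (cases "z \<in> carrier G \<times> carrier G")
      case True
      then obtain g h where z: "z = (g, h)" and gh: "g \<in> carrier G" "h \<in> carrier G" by blast
      have "(coboundary1 G R a z + c z) mod m = (coboundary1 G R a z + (coboundary1 G R b z + c' z)) mod m"
        unfolding z by (rule mod_add_cong[OF refl c[OF gh]])
      also have "\<dots> = ((a g + a h - a (g \<otimes> h)) + ((b g + b h - b (g \<otimes> h)) + c' z)) mod m"
        by (simp only: z coboundary1_eq[OF gh] mod_add_add_eq)
      also have "\<dots> = ((a g + b g) + (a h + b h) - (a (g \<otimes> h) + b (g \<otimes> h)) + c' z) mod m"
        by (simp add: algebra_simps)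
      also have "\<dots> = (coboundary1 G R ?b z + c' z) mod m"
        unfolding z using gh
        by (subst coboundary1_cong[of ?b "\<lambda>g. a g + b g"]) (auto simp: mod_add_left_eq)
      finally show ?thesis using a(2) True by simp
    qed (use a(2) in simp)
  qed
  then show "f \<in> H2_class G T R c'"
    using cochains1_cong2[OF a(1) b, of "(+)"] by (auto simp: mem_H2_class_iff)
qed

lemma H2_class_eqI:
  assumes b: "b \<in> cochains1 G T R"
    and c: "\<And>g h. g \<in> carrier G \<Longrightarrow> h \<in> carrier G \<Longrightarrow> c (g, h) mod m = (coboundary1 G R b (g, h) + c' (g, h)) mod m"
  shows "H2_class G T R c = H2_class G T R c'"
proof
  let ?b = "\<lambda>g\<in>carrier G. (- b g) mod m"
  show "H2_class G T R c' \<subseteq> H2_class G T R c"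
  proof (rule H2_class_subset)
    show "?b \<in> cochains1 G T R" using cochains1_cong2[OF b b, of "\<lambda>x y. - x"] by simp
    fix g h assume gh: "g \<in> carrier G" "h \<in> carrier G"
    have "(coboundary1 G R ?b (g, h) + c (g, h)) mod m =
      (coboundary1 G R ?b (g, h) + (coboundary1 G R b (g, h) + c' (g, h))) mod m"
      by (rule mod_add_cong[OF refl c[OF gh]])
    also have "\<dots> = ((- b g + - b h - - b (g \<otimes> h)) mod m + (coboundary1 G R b (g, h) + c' (g, h))) mod m"
      using gh by (subst coboundary1_cong[of ?b "\<lambda>g. - b g"]) auto
    also have "\<dots> = c' (g, h) mod m"
      unfolding coboundary1_eq[OF gh] mod_add_add_eq by simp
    finally show "c' (g, h) mod m = (coboundary1 G R ?b (g, h) + c (g, h)) mod m" by (rule sym)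
  qed
qed (rule H2_class_subset[OF assms])

lemma zero_mem_cochains1: "(\<lambda>g\<in>carrier G. 0) \<in> cochains1 G T R"
proof -
  have "continuous_map T (discrete_topology (carrier R)) (\<lambda>g. 0 :: int)"
    using res.m_gt_one by (simp add: res.res_carrier_eq)
  then have "continuous_map T (discrete_topology (carrier R)) (\<lambda>g\<in>carrier G. 0)"
    by (rule continuous_map_eq) simp
  then show ?thesis using res.m_gt_one by (auto simp: cochains1_def res.res_carrier_eq)
qed

lemma H2_class_nonempty: "H2_class G T R c \<noteq> {}"
proof -
  have "(\<lambda>x\<in>carrier G \<times> carrier G. (coboundary1 G R (\<lambda>g\<in>carrier G. 0) x + c x) mod m) \<in> H2_class G T R c"
    using zero_mem_cochains1 unfolding mem_H2_class_iff by blast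
  then show ?thesis by blast
qed

lemma H2_class_eqD:
  assumes "H2_class G T R c = H2_class G T R c'"
  obtains b where "b \<in> cochains1 G T R"
    "\<And>g h. g \<in> carrier G \<Longrightarrow> h \<in> carrier G \<Longrightarrow> c (g, h) mod m = (coboundary1 G R b (g, h) + c' (g, h)) mod m"
proof -
  \<comment> \<open>The zero cochain exhibits \<open>c\<close>, reduced modulo \<open>m\<close>, as
    a member of its own class.\<close>
  have "(\<lambda>x\<in>carrier G \<times> carrier G. (coboundary1 G R (\<lambda>g\<in>carrier G. 0) x + c x) mod m) \<in> H2_class G T R c'"
    using zero_mem_cochains1 unfolding assms[symmetric] mem_H2_class_iff by blast
  then obtain b where b: "b \<in> cochains1 G T R" and
    *: "(\<lambda>x\<in>carrier G \<times> carrier G. (coboundary1 G R (\<lambda>g\<in>carrier G. 0) x + c x) mod m) =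
      (\<lambda>x\<in>carrier G \<times> carrier G. (coboundary1 G R b x + c' x) mod m)"
    by (auto simp: mem_H2_class_iff)
  show thesis
  proof (rule that[OF b])
    fix g h assume gh: "g \<in> carrier G" "h \<in> carrier G"
    then show "c (g, h) mod m = (coboundary1 G R b (g, h) + c' (g, h)) mod m"
      using fun_cong[OF *, of "(g, h)"] by (simp add: coboundary1_eq)
  qed
qed

end


section \<open>The transgression\<close>

locale topgroup_quotient = topgroup_residues G T m R + normal N G
  for G :: "'a monoid" (structure) and T :: "'a topology" and m :: int and R :: "int ring"
    and N :: "'a set"
begin

abbreviation Q :: "'a set monoid" where "Q \<equiv> G Mod N"
abbreviation TQ :: "'a set topology" where "TQ \<equiv> coset_topology G T N"

lemma quotient_map_rcoset: "quotient_map T TQ (\<lambda>g. N #> g)"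
  unfolding coset_topology_def by (rule quotient_map_quotient_topology)

lemma topspace_coset_topology: "topspace TQ = carrier Q"
  using quotient_imp_surjective_map[OF quotient_map_rcoset] by (simp add: carrier_FactGroup)

lemma continuous_map_rcoset: "continuous_map T TQ (\<lambda>g. N #> g)"
  using quotient_map_rcoset by (rule quotient_imp_continuous_map)

lemma mem_rcoset_iff: "g \<in> carrier G \<Longrightarrow> h \<in> N #> g \<longleftrightarrow> (\<exists>n\<in>N. h = n \<otimes> g)"
  by (auto simp: r_coset_def)

lemma rcoset_mult_left: "n \<in> N \<Longrightarrow> g \<in> carrier G \<Longrightarrow> N #> (n \<otimes> g) = N #> g"
  by (metis coset_mult_assoc mem_carrier rcos_const is_group subset)

text \<open>The saturation of an open set is a union of translates by elements of \<open>N\<close>,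
  each of them open.\<close>

lemma open_map_rcoset: "open_map T TQ (\<lambda>g. N #> g)"
  unfolding open_map_def
proof (intro allI impI)
  fix U assume U: "openin T U"
  then have Uc: "U \<subseteq> carrier G" using openin_subset by fastforce
  have "{x \<in> topspace T. N #> x \<in> (\<lambda>g. N #> g) ` U} = (\<Union>n\<in>N. {x \<in> carrier G. n \<otimes> x \<in> U})"
  proof (intro equalityI subsetI)
    fix x assume "x \<in> {x \<in> topspace T. N #> x \<in> (\<lambda>g. N #> g) ` U}"
    then obtain u where x: "x \<in> carrier G" and u: "u \<in> U" "N #> x = N #> u" by auto
    then have "u \<in> N #> x" using Uc is_subgroup rcos_self by auto
    then obtain n where "n \<in> N" "u = n \<otimes> x" using x by (simp only: mem_rcoset_iff) blast
    then show "x \<in> (\<Union>n\<in>N. {x \<in> carrier G. n \<otimes> x \<in> U})"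
      using u x by blast
  next
    fix x assume "x \<in> (\<Union>n\<in>N. {x \<in> carrier G. n \<otimes> x \<in> U})"
    then obtain n where n: "n \<in> N" "x \<in> carrier G" "n \<otimes> x \<in> U" by blast
    have "N #> x \<in> (\<lambda>g. N #> g) ` U"
      using rcoset_mult_left[OF n(1,2), symmetric] n(3) by (rule image_eqI)
    with n show "x \<in> {x \<in> topspace T. N #> x \<in> (\<lambda>g. N #> g) ` U}" by simp
  qed
  moreover have "openin T (\<Union>n\<in>N. {x \<in> carrier G. n \<otimes> x \<in> U})"
    using U by (intro openin_Union ballI)
      (auto intro!: openin_carrier_preimage continuous_map_mult)
  ultimately show "openin TQ ((\<lambda>g. N #> g) ` U)"
    unfolding coset_topology_def openin_quotient_topology using Uc by auto
qed

text \<open>A product of quotient maps can fail to be one; openness of the coset map saves it here.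
  Continuity of 2-cochains on the quotient can then be tested on pairs of group elements.\<close>

lemma quotient_map_rcoset_pair:
  "quotient_map (prod_topology T T) (prod_topology TQ TQ) (\<lambda>z. (N #> fst z, N #> snd z))"
proof (rule continuous_open_imp_quotient_map)
  let ?f = "\<lambda>z. (N #> fst z, N #> snd z)"
  show "continuous_map (prod_topology T T) (prod_topology TQ TQ) ?f"
    using continuous_map_compose[OF continuous_map_fst continuous_map_rcoset]
      continuous_map_compose[OF continuous_map_snd continuous_map_rcoset]
    by (intro continuous_map_pairedI) (simp_all add: o_def)
  show "open_map (prod_topology T T) (prod_topology TQ TQ) ?f"
    unfolding open_map_def
  proof (intro allI impI)
    fix W assume W: "openin (prod_topology T T) W"
    show "openin (prod_topology TQ TQ) (?f ` W)"
      unfolding openin_prod_topology_alt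
    proof (intro allI impI)
      fix C D assume "(C, D) \<in> ?f ` W"
      then obtain g h where gh: "(g, h) \<in> W" "C = N #> g" "D = N #> h" by auto
      then obtain U V where UV: "openin T U" "openin T V" "g \<in> U" "h \<in> V" "U \<times> V \<subseteq> W"
        using W unfolding openin_prod_topology_alt by meson
      let ?\<pi> = "\<lambda>g. N #> g"
      have "?\<pi> ` U \<times> ?\<pi> ` V \<subseteq> ?f ` W"
      proof
        fix z assume "z \<in> ?\<pi> ` U \<times> ?\<pi> ` V"
        then obtain u v where "u \<in> U" "v \<in> V" "z = ?f (u, v)" by auto
        with UV(5) show "z \<in> ?f ` W" by blast
      qed
      moreover have "openin TQ (?\<pi> ` U)" "openin TQ (?\<pi> ` V)"
        using open_map_rcoset UV by (auto simp: open_map_def)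
      ultimately show "\<exists>U V. openin TQ U \<and> openin TQ V \<and> C \<in> U \<and> D \<in> V \<and> U \<times> V \<subseteq> ?f ` W"
        using UV gh by (intro exI[of _ "?\<pi> ` U"] exI[of _ "?\<pi> ` V"]) auto
    qed
  qed
  show "?f ` topspace (prod_topology T T) = topspace (prod_topology TQ TQ)"
    using image_paired_Times[of "\<lambda>g. N #> g" "\<lambda>g. N #> g" "carrier G" "carrier G"]
    by (simp add: topspace_coset_topology carrier_FactGroup case_prod_unfold)
qed

lemma continuous_map_rcoset_pair_iff:
  "continuous_map (prod_topology TQ TQ) Y f \<longleftrightarrow>
    continuous_map (prod_topology T T) Y (\<lambda>z. f (N #> fst z, N #> snd z))"
  using continuous_compose_quotient_map_eq[OF quotient_map_rcoset_pair, of Y f] by (simp add: o_def)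

lemma topgroup_residues_quotient: "topgroup_residues Q TQ m"
proof -
  interpret Q: group Q by (rule factorgroup_is_group)
  have "continuous_map (prod_topology TQ TQ) TQ (\<lambda>(C, D). C \<otimes>\<^bsub>Q\<^esub> D)"
    unfolding continuous_map_rcoset_pair_iff
  proof (rule continuous_map_eq)
    show "continuous_map (prod_topology T T) TQ (\<lambda>z. N #> (fst z \<otimes> snd z))"
      using continuous_map_compose[OF continuous_map_mult[OF continuous_map_fst continuous_map_snd] continuous_map_rcoset]
      by (simp add: o_def)
  qed (auto simp: rcos_sum)
  moreover have "continuous_map TQ TQ (\<lambda>C. inv\<^bsub>Q\<^esub> C)"
    unfolding continuous_compose_quotient_map_eq[OF quotient_map_rcoset, symmetric]
  proof (rule continuous_map_eq)
    show "continuous_map T TQ (\<lambda>g. N #> inv g)"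
      using continuous_map_compose[OF continuous_map_inv[OF continuous_map_id[unfolded id_def]] continuous_map_rcoset]
      by (simp add: o_def)
    fix g assume "g \<in> topspace T"
    then show "N #> inv g = ((\<lambda>C. inv\<^bsub>Q\<^esub> C) \<circ> (\<lambda>g. N #> g)) g"
      by (simp add: inv_FactGroup carrier_FactGroup rcos_inv)
  qed
  ultimately have "topological_group Q TQ"
    unfolding topological_group_def by (simp add: topspace_coset_topology Q.is_group)
  then show ?thesis
    by (simp add: topgroup_residues_def topgroup_def residues_def res.m_gt_one)
qed

section \<open>Descent of cochains and cocycles to the quotient\<close>

lemma some_mem_rcoset:
  assumes "g \<in> carrier G"
  obtains n where "n \<in> N" "(SOME h. h \<in> N #> g) = n \<otimes> g"
proof -
  have "(SOME h. h \<in> N #> g) \<in> N #> g"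
    using rcos_self[OF assms is_subgroup] by (rule someI)
  then show thesis using that unfolding mem_rcoset_iff[OF assms] by blast
qed

lemma cochains1_descend:
  assumes y: "y \<in> cochains1 G T R"
    and inv: "\<And>n g. n \<in> N \<Longrightarrow> g \<in> carrier G \<Longrightarrow> y (n \<otimes> g) = y g"
  obtains b where "b \<in> cochains1 Q TQ R" "\<And>g. g \<in> carrier G \<Longrightarrow> b (N #> g) = y g"
proof -
  define b where "b = (\<lambda>C\<in>carrier Q. y (SOME g. g \<in> C))"
  have b: "b (N #> g) = y g" if g: "g \<in> carrier G" for g
  proof -
    obtain n where "n \<in> N" "(SOME h. h \<in> N #> g) = n \<otimes> g"
      by (rule some_mem_rcoset[OF g])
    moreover have "N #> g \<in> carrier Q" unfolding carrier_FactGroup using g by (rule imageI)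
    ultimately show ?thesis using inv[of n g] g unfolding b_def by simp
  qed
  have "continuous_map T (discrete_topology (carrier R)) (b \<circ> (\<lambda>g. N #> g))"
  proof (rule continuous_map_eq)
    show "continuous_map T (discrete_topology (carrier R)) y" using y by (simp add: cochains1_def)
  qed (simp add: b)
  then have "continuous_map TQ (discrete_topology (carrier R)) b"
    by (simp add: continuous_compose_quotient_map_eq[OF quotient_map_rcoset])
  moreover have "b \<in> carrier Q \<rightarrow>\<^sub>E carrier R"
  proof
    fix C assume "C \<in> carrier Q"
    then obtain g where "g \<in> carrier G" "C = N #> g" by (auto simp: carrier_FactGroup)
    then show "b C \<in> carrier R" by (simp add: b cochains1_carrier[OF y])
  qed (simp add: b_def)
  ultimately have "b \<in> cochains1 Q TQ R" unfolding cochains1_def by simp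
  then show thesis using b by (rule that)
qed

text \<open>The cocycle identity holds upstairs because the function is a coboundary there, and it
  passes to cosets. Downstairs it is in general no coboundary, since \<open>y\<close> itself may
  vary along \<open>N\<close>.\<close>

lemma cocycles2_descend:
  assumes y: "y \<in> cochains1 G T R"
    and invl: "\<And>n g h. n \<in> N \<Longrightarrow> g \<in> carrier G \<Longrightarrow> h \<in> carrier G \<Longrightarrow>
      coboundary1 G R y (n \<otimes> g, h) = coboundary1 G R y (g, h)"
    and invr: "\<And>n g h. n \<in> N \<Longrightarrow> g \<in> carrier G \<Longrightarrow> h \<in> carrier G \<Longrightarrow>
      coboundary1 G R y (g, n \<otimes> h) = coboundary1 G R y (g, h)"
  obtains c where "c \<in> carrier (cocycles2 Q TQ R)"
    "\<And>g h. g \<in> carrier G \<Longrightarrow> h \<in> carrier G \<Longrightarrow> c (N #> g, N #> h) = coboundary1 G R y (g, h)"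
proof -
  define c where "c = (\<lambda>(C, D)\<in>carrier Q \<times> carrier Q. coboundary1 G R y (SOME g. g \<in> C, SOME g. g \<in> D))"
  have c: "c (N #> g, N #> h) = coboundary1 G R y (g, h)"
    if gh: "g \<in> carrier G" "h \<in> carrier G" for g h
  proof -
    obtain n where "n \<in> N" "(SOME k. k \<in> N #> g) = n \<otimes> g"
      by (rule some_mem_rcoset[OF gh(1)])
    moreover obtain n' where "n' \<in> N" "(SOME k. k \<in> N #> h) = n' \<otimes> h"
      by (rule some_mem_rcoset[OF gh(2)])
    ultimately show ?thesis
      using gh invl[of n g "n' \<otimes> h"] invr[of n' g h] by (simp add: c_def carrier_FactGroup)
  qed
  have "continuous_map (prod_topology TQ TQ) (discrete_topology (carrier R)) c"
    unfolding continuous_map_rcoset_pair_iff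
  proof (rule continuous_map_eq[OF continuous_map_coboundary1[OF y]])
    fix z assume "z \<in> topspace (prod_topology T T)"
    then show "coboundary1 G R y z = c (N #> fst z, N #> snd z)"
      by (cases z) (simp add: c)
  qed
  moreover have "c \<in> carrier Q \<times> carrier Q \<rightarrow>\<^sub>E carrier R"
  proof
    fix z assume "z \<in> carrier Q \<times> carrier Q"
    then obtain g h where "g \<in> carrier G" "h \<in> carrier G" "z = (N #> g, N #> h)"
      by (auto simp: carrier_FactGroup)
    then show "c z \<in> carrier R" by (simp add: c coboundary1_eq)
  qed (auto simp: c_def)
  moreover have "c (D, E) \<oplus>\<^bsub>R\<^esub> c (C, D \<otimes>\<^bsub>Q\<^esub> E) = c (C \<otimes>\<^bsub>Q\<^esub> D, E) \<oplus>\<^bsub>R\<^esub> c (C, D)"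
    if CDE: "C \<in> carrier Q" "D \<in> carrier Q" "E \<in> carrier Q" for C D E
  proof -
    obtain g h k where ghk: "g \<in> carrier G" "h \<in> carrier G" "k \<in> carrier G"
      and "C = N #> g" "D = N #> h" "E = N #> k"
      using CDE by (auto simp: carrier_FactGroup)
    then show ?thesis
      by (simp add: rcos_sum c res.res_add_eq coboundary1_eq mod_add_eq m_assoc) (simp add: algebra_simps)
  qed
  ultimately have "c \<in> carrier (cocycles2 Q TQ R)"
    unfolding cocycles2_def by simp
  then show thesis using c by (rule that)
qed

text \<open>The description under the \<open>THE\<close> in \<open>trg\<close>, with its witnesses
  \<open>y\<close> and \<open>c\<close> as parameters, so that uniqueness and injectivity can be
  argued on them.\<close>

definition transgresses :: "('a \<Rightarrow> int) \<Rightarrow> ('a \<Rightarrow> int) \<Rightarrow> ('a set \<times> 'a set \<Rightarrow> int) \<Rightarrow> bool" where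
  "transgresses x y c \<longleftrightarrow> y \<in> cochains1 G T R \<and> c \<in> carrier (cocycles2 Q TQ R) \<and>
     (\<forall>h\<in>N. y h = x h) \<and>
     (\<forall>g\<in>carrier G. \<forall>h\<in>carrier G. c (N #> g, N #> h) = coboundary1 G R y (g, h))"

lemma transgresses_shift:
  assumes "transgresses x y c" "n \<in> N" "g \<in> carrier G"
  shows "y (n \<otimes> g) mod m = (x n + y g - x \<one>) mod m"
proof -
  \<comment> \<open>The cosets of \<open>n\<close> and of \<open>\<one>\<close> agree, so
    \<open>c\<close> cannot tell them apart; expanding the two coboundaries gives the shift law. The
    term \<open>x \<one>\<close> stays because \<open>x\<close> is an arbitrary function at this
    point.\<close>
  have "N #> n = N #> \<one>"
    using assms(2) by (simp add: rcos_const is_group)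
  moreover have "c (N #> n, N #> g) = coboundary1 G R y (n, g)"
    "c (N #> \<one>, N #> g) = coboundary1 G R y (\<one>, g)"
    using assms by (simp_all only: transgresses_def mem_carrier one_closed)
  ultimately have "coboundary1 G R y (n, g) = coboundary1 G R y (\<one>, g)" by simp
  then have "(y n + y g - y (n \<otimes> g)) mod m = y \<one> mod m"
    using assms by (simp add: coboundary1_eq)
  then have "(y n + y g - (y n + y g - y (n \<otimes> g))) mod m = (y n + y g - y \<one>) mod m"
    by (intro mod_diff_cong refl)
  then show ?thesis using assms one_closed by (simp add: transgresses_def)
qed

text \<open>By the shift law \<open>y\<close> and \<open>y'\<close> change in the same way along
  \<open>N\<close>, so their difference descends to a cochain on the quotient, whose coboundary is
  \<open>c - c'\<close>.\<close>

lemma transgresses_H2_class_unique: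
  assumes 1: "transgresses x y c" and 2: "transgresses x y' c'"
  shows "H2_class Q TQ R c = H2_class Q TQ R c'"
proof -
  interpret Q: topgroup_residues Q TQ m R by (rule topgroup_residues_quotient) (rule res.R_m_def)
  have y: "y \<in> cochains1 G T R" "y' \<in> cochains1 G T R"
    using assms by (auto simp: transgresses_def)
  define d where "d = (\<lambda>g\<in>carrier G. (y g - y' g) mod m)"
  have "d \<in> cochains1 G T R" unfolding d_def by (rule cochains1_cong2[OF y])
  moreover have "d (n \<otimes> g) = d g" if "n \<in> N" "g \<in> carrier G" for n g
  proof -
    have "d (n \<otimes> g) = (x n + y g - x \<one> - (x n + y' g - x \<one>)) mod m"
      using that mod_diff_cong[OF transgresses_shift[OF 1 that] transgresses_shift[OF 2 that]]
      by (simp add: d_def)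
    with that show ?thesis by (simp add: d_def)
  qed
  ultimately obtain b where b: "b \<in> cochains1 Q TQ R" "\<And>g. g \<in> carrier G \<Longrightarrow> b (N #> g) = d g"
    using cochains1_descend[of d] by blast
  show ?thesis
  proof (rule Q.H2_class_eqI[OF b(1)])
    fix C D assume "C \<in> carrier Q" "D \<in> carrier Q"
    then obtain g h where gh: "g \<in> carrier G" "h \<in> carrier G" "C = N #> g" "D = N #> h"
      by (auto simp: carrier_FactGroup)
    have "coboundary1 Q R b (C, D) = coboundary1 G R d (g, h)"
      using gh \<open>C \<in> carrier Q\<close> \<open>D \<in> carrier Q\<close> by (simp add: Q.coboundary1_eq coboundary1_eq b rcos_sum)
    also have "\<dots> = (y g - y' g + (y h - y' h) - (y (g \<otimes> h) - y' (g \<otimes> h))) mod m"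
      using gh by (intro coboundary1_cong) (simp_all add: d_def)
    finally show "c (C, D) mod m = (coboundary1 Q R b (C, D) + c' (C, D)) mod m"
      using gh assms by (simp add: transgresses_def coboundary1_eq mod_add_eq) (simp add: algebra_simps)
  qed
qed

lemma trg_eq:
  assumes "transgresses x y c"
  shows "trg G T N R x = H2_class Q TQ R c"
  unfolding trg_def
proof (rule the_equality)
  show "\<exists>y\<in>cochains1 G T R. \<exists>c'\<in>carrier (cocycles2 Q TQ R). (\<forall>h\<in>N. y h = x h) \<and>
    (\<forall>g\<in>carrier G. \<forall>h\<in>carrier G. c' (N #> g, N #> h) = coboundary1 G R y (g, h)) \<and>
    H2_class Q TQ R c = H2_class Q TQ R c'"
    using assms unfolding transgresses_def by blast
next
  fix \<alpha> assume "\<exists>y\<in>cochains1 G T R. \<exists>c\<in>carrier (cocycles2 Q TQ R). (\<forall>h\<in>N. y h = x h) \<and>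
    (\<forall>g\<in>carrier G. \<forall>h\<in>carrier G. c (N #> g, N #> h) = coboundary1 G R y (g, h)) \<and>
    \<alpha> = H2_class Q TQ R c"
  then obtain y' c' where "transgresses x y' c'" "\<alpha> = H2_class Q TQ R c'"
    unfolding transgresses_def by blast
  then show "\<alpha> = H2_class Q TQ R c" using transgresses_H2_class_unique[OF assms] by simp
qed

lemma H1_invariantsD:
  assumes "x \<in> H1_invariants G T N R"
  shows "n \<in> N \<Longrightarrow> x n \<in> carrier R"
    and "n \<in> N \<Longrightarrow> n' \<in> N \<Longrightarrow> x (n \<otimes> n') = (x n + x n') mod m"
    and "x \<one> = 0"
    and "g \<in> carrier G \<Longrightarrow> n \<in> N \<Longrightarrow> x (g \<otimes> n \<otimes> inv g) = x n"
proof -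
  have x: "x n \<in> carrier R" if "n \<in> N" for n
    using assms that by (auto simp: H1_invariants_def hom_def)
  have hom: "x (n \<otimes> n') = (x n + x n') mod m" if "n \<in> N" "n' \<in> N" for n n'
    using assms that by (auto simp: H1_invariants_def hom_def res.res_add_eq)
  have "x \<one> mod m = (x \<one> + x \<one>) mod m"
    using hom[of "\<one>" "\<one>"] x by simp
  then have "(x \<one> - x \<one>) mod m = (x \<one> + x \<one> - x \<one>) mod m"
    by (rule mod_diff_cong) simp
  then show "x \<one> = 0" using x[of "\<one>"] by simp
  show "n \<in> N \<Longrightarrow> x n \<in> carrier R"
    "n \<in> N \<Longrightarrow> n' \<in> N \<Longrightarrow> x (n \<otimes> n') = (x n + x n') mod m" by (fact x hom)+
  show "x (g \<otimes> n \<otimes> inv g) = x n" if "g \<in> carrier G" "n \<in> N"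
  proof -
    have "x (inv (inv g) \<otimes> n \<otimes> inv g) = x n"
      using assms that inv_closed unfolding H1_invariants_def by blast
    with that show ?thesis by simp
  qed
qed

text \<open>Subtracting from \<open>y - y'\<close> the pullback of a cochain \<open>b\<close> with
  coboundary \<open>c - c'\<close> leaves a homomorphism \<open>d\<close> from \<open>G\<close> to
  Z/p. It kills p-th powers and commutators, hence the second term of the filtration and with it
  \<open>N\<close>.\<close>

lemma transgresses_inj:
  assumes x: "x \<in> H1_invariants G T N R" "x' \<in> H1_invariants G T N R"
    and 1: "transgresses x y c" and 2: "transgresses x' y' c'"
    and eq: "H2_class Q TQ R c = H2_class Q TQ R c'"
    and m: "m = int p" and N: "N \<subseteq> lower_p_central G T p 2"
  shows "x = x'"
proof -
  interpret Q: topgroup_residues Q TQ m R by (rule topgroup_residues_quotient) (rule res.R_m_def)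
  have y: "y \<in> cochains1 G T R" "y' \<in> cochains1 G T R"
    using 1 2 by (auto simp: transgresses_def)
  obtain b where b: "b \<in> cochains1 Q TQ R" and bc: "\<And>C D. C \<in> carrier Q \<Longrightarrow> D \<in> carrier Q \<Longrightarrow>
      c (C, D) mod m = (coboundary1 Q R b (C, D) + c' (C, D)) mod m"
    using Q.H2_class_eqD[OF eq] by blast
  have rc: "N #> g \<in> carrier Q" if "g \<in> carrier G" for g
    unfolding carrier_FactGroup using that by (rule imageI)
  define e where "e = (\<lambda>g\<in>carrier G. b (N #> g) mod m)"
  have e: "e \<in> cochains1 G T R"
  proof -
    have "continuous_map T (discrete_topology (carrier R)) (\<lambda>g. b (N #> g))"
      using b continuous_map_compose[OF continuous_map_rcoset, of "discrete_topology (carrier R)" b]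
      by (simp add: cochains1_def o_def)
    then have "continuous_map T (discrete_topology (carrier R)) e"
    proof (rule continuous_map_eq)
      fix g assume "g \<in> topspace T"
      then show "b (N #> g) = e g"
        using Q.cochains1_carrier[OF b rc] by (simp add: e_def)
    qed
    then show ?thesis by (simp add: cochains1_def e_def)
  qed
  have "(\<lambda>g\<in>carrier G. (y g - y' g) mod m) \<in> cochains1 G T R"
    by (rule cochains1_cong2[OF y])
  note e' = cochains1_cong2[OF this e, of "(-)"]
  \<comment> \<open>The nested reductions follow the shape that two uses of
    \<open>cochains1_cong2\<close> produce; \<open>d_eq\<close> collapses them.\<close>
  define d where "d = (\<lambda>g\<in>carrier G. ((\<lambda>g\<in>carrier G. (y g - y' g) mod m) g - e g) mod m)"
  have d: "d \<in> cochains1 G T R" unfolding d_def by (rule e')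
  have d_eq: "d g = (y g - y' g - b (N #> g)) mod m" if "g \<in> carrier G" for g
    using that by (simp add: d_def e_def mod_diff_eq)
  have hom: "d (g \<otimes> h) = (d g + d h) mod m" if gh: "g \<in> carrier G" "h \<in> carrier G" for g h
  proof -
    let ?C = "N #> g" and ?D = "N #> h" and ?CD = "N #> (g \<otimes> h)"
    have CD: "?C \<otimes>\<^bsub>Q\<^esub> ?D = ?CD" using gh by (simp add: rcos_sum)
    have "c (?C, ?D) = coboundary1 G R y (g, h)" "c' (?C, ?D) = coboundary1 G R y' (g, h)"
      using 1 2 gh by (simp_all add: transgresses_def)
    with bc[OF rc[OF gh(1)] rc[OF gh(2)]]
    have "(y g + y h - y (g \<otimes> h)) mod m =
      (b ?C + b ?D - b ?CD + (y' g + y' h - y' (g \<otimes> h))) mod m"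
      by (simp only: CD coboundary1_eq[OF gh] Q.coboundary1_eq[OF rc[OF gh(1)] rc[OF gh(2)]] mod_add_eq mod_mod_trivial)
    from mod_diff_cong[OF refl this, of "(y g - y' g - b ?C) + (y h - y' h - b ?D) + (b ?C + b ?D - b ?CD + (y' g + y' h - y' (g \<otimes> h)))"]
    have "(y (g \<otimes> h) - y' (g \<otimes> h) - b ?CD) mod m = ((y g - y' g - b ?C) + (y h - y' h - b ?D)) mod m"
      by (simp add: algebra_simps)
    then show ?thesis using gh by (simp add: d_eq mod_add_eq)
  qed
  have d_one: "d \<one> = 0"
  proof -
    have "d \<one> = (d \<one> + d \<one>) mod m" using hom[of "\<one>" "\<one>"] by simp
    from mod_diff_cong[OF arg_cong[OF this, of "\<lambda>x. x mod m"] refl, of "d \<one>"]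
    have "d \<one> mod m = 0" by (simp add: mod_diff_left_eq)
    then show ?thesis using cochains1_carrier[OF d, of "\<one>"] by simp
  qed
  have d_inv: "(d (inv g) + d g) mod m = 0" if "g \<in> carrier G" for g
    using hom[of "inv g" g] that d_one by simp
  have d_pow: "d (g [^] k) = (int k * d g) mod m" if "g \<in> carrier G" for g and k :: nat
  proof (induction k)
    case (Suc k)
    have "d (g [^] Suc k) = ((int k * d g) mod m + d g) mod m" using hom Suc that by simp
    also have "\<dots> = (int k * d g + d g) mod m" by (rule mod_add_left_eq)
    also have "int k * d g + d g = int (Suc k) * d g" by (simp add: algebra_simps)
    finally show ?case .
  qed (simp add: d_one)
  let ?K = "{g \<in> carrier G. d g \<in> {0}}"
  have "lower_p_central G T p (Suc 1) \<subseteq> ?K"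
    unfolding lower_p_central_Suc[OF zero_less_one]
  proof (rule closed_generate_subset)
    show "subgroup ?K G"
    proof (rule subgroupI)
      show "?K \<noteq> {}" using d_one by blast
      fix g assume g: "g \<in> ?K"
      then have "d (inv g) mod m = 0" using d_inv[of g] by simp
      then show "inv g \<in> ?K" using g cochains1_carrier[OF d, of "inv g"] by simp
    next
      fix g h assume "g \<in> ?K" "h \<in> ?K"
      then show "g \<otimes> h \<in> ?K" using hom[of g h] by simp
    qed auto
    have "closedin (discrete_topology (carrier R)) ({0} \<inter> carrier R)" by simp
    moreover have "continuous_map T (discrete_topology (carrier R)) d"
      using d by (simp add: cochains1_def)
    ultimately have "closedin T {g \<in> topspace T. d g \<in> {0} \<inter> carrier R}"
      by (rule closedin_continuous_map_preimage[rotated])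
    also have "{g \<in> topspace T. d g \<in> {0} \<inter> carrier R} = ?K"
      using cochains1_carrier[OF d] by auto
    finally show "closedin T ?K" .
    have "d (h [^] p) = 0" if "h \<in> carrier G" for h
      using d_pow[OF that, of p] by (simp add: m)
    moreover have "d (commutator G g h) = 0" if gh: "g \<in> carrier G" "h \<in> carrier G" for g h
    proof -
      have "d (commutator G g h) = (d (inv g) + d (inv h) + d g + d h) mod m"
        using gh by (simp add: commutator_def hom mod_add_left_eq)
      also have "\<dots> = ((d (inv g) + d g) + (d (inv h) + d h)) mod m"
        by (simp only: add_ac)
      also have "\<dots> = ((d (inv g) + d g) mod m + (d (inv h) + d h) mod m) mod m"
        by (rule mod_add_eq[symmetric])
      finally show ?thesis using gh by (simp only: d_inv) simp
    qed
    ultimately show "{h [^] p | h. h \<in> lower_p_central G T p 1} \<union>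
        {commutator G g h | g h. g \<in> carrier G \<and> h \<in> lower_p_central G T p 1} \<subseteq> ?K"
      by auto
  qed
  then have dN: "d n = 0" if "n \<in> N" for n
    using that N by (auto simp: numeral_2_eq_2)
  \<comment> \<open>On \<open>N\<close> the pullback of \<open>b\<close> is the constant
    \<open>b N\<close>; evaluation at the identity shows that this constant is 0 modulo
    \<open>m\<close>.\<close>
  have bN: "b N mod m = 0"
  proof -
    have "y \<one> = 0" "y' \<one> = 0"
      using 1 2 H1_invariantsD(3)[OF x(1)] H1_invariantsD(3)[OF x(2)] one_closed by (simp_all add: transgresses_def)
    with d_eq[of "\<one>"] d_one have "(- b N) mod m = 0" using subset by simp
    then show ?thesis by (simp add: mod_eq_0_iff_dvd)
  qed
  show "x = x'"
  proof
    fix n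
    show "x n = x' n"
    proof (cases "n \<in> N")
      case True
      have "N #> n = N" using True by (simp add: rcos_const is_group)
      with dN[OF True] d_eq[of n] True have "(x n - x' n - b N) mod m = 0"
        using 1 2 by (simp add: transgresses_def)
      with bN have "(x n - x' n) mod m = 0" by (metis diff_zero mod_diff_right_eq)
      then have "x n mod m = x' n mod m" by (simp add: mod_eq_dvd_iff mod_0_imp_dvd)
      then show ?thesis using True x H1_invariantsD(1) by simp
    next
      case False
      then show ?thesis using x by (simp add: H1_invariants_def extensional_def)
    qed
  qed
qed

end

text \<open>
  A character of \<open>N\<close> is trivial on \<open>V \<inter> N\<close> for some open normal subgroup \<open>V\<close> of \<open>G\<close>. It then extends
  to \<open>N V\<close> trivially on \<open>V\<close>, and to \<open>G\<close> by choosing representatives of the cosets of \<open>N V\<close>.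
\<close>

lemma (in topgroup_quotient) transgresses_exists:
  assumes "profinite G T" and closed: "closedin T N" and x: "x \<in> H1_invariants G T N R"
  obtains y c where "transgresses x y c"
proof -
  interpret profinite G T by fact
  note xD = H1_invariantsD[OF x]
  have sub: "N \<subseteq> carrier G" by (rule subset)
  have "openin (subtopology T N) {n \<in> topspace (subtopology T N). x n \<in> {0} \<inter> carrier R}"
    using x by (intro openin_continuous_map_preimage[where Y = "discrete_topology (carrier R)"])
      (auto simp: H1_invariants_def)
  then obtain W where W: "openin T W" "{n \<in> topspace (subtopology T N). x n \<in> {0} \<inter> carrier R} = W \<inter> N"
    unfolding openin_subtopology by blast
  have WN: "x n = 0" if "n \<in> W" "n \<in> N" for n
  proof -
    have "n \<in> {n \<in> topspace (subtopology T N). x n \<in> {0} \<inter> carrier R}" unfolding W(2) using that by blast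
    then show ?thesis by simp
  qed
  have "\<one> \<in> W \<inter> N"
    unfolding W(2)[symmetric] using xD(1)[of "\<one>"] xD(3) one_closed sub by auto
  then obtain V where V: "V \<lhd> G" "openin T V" "V \<subseteq> W"
    using open_normal_subgroup[OF W(1)] by blast
  interpret V: normal V G by (rule V(1))
  define P where "P = {n \<otimes> v | n v. n \<in> N \<and> v \<in> V}"
  have PI: "n \<otimes> v \<in> P" if "n \<in> N" "v \<in> V" for n v using that by (auto simp: P_def)
  have P: "subgroup P G"
  proof (rule subgroupI)
    show "P \<subseteq> carrier G" by (auto simp: P_def)
    show "P \<noteq> {}" using PI[OF one_closed V.one_closed] by blast
    fix a assume "a \<in> P"
    then obtain n v where nv: "n \<in> N" "v \<in> V" "a = n \<otimes> v" by (auto simp: P_def)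
    then have "inv a = inv n \<otimes> (n \<otimes> inv v \<otimes> inv n)"
      by (simp add: inv_mult_group m_assoc)
    then show "inv a \<in> P"
      using nv PI[OF m_inv_closed V.inv_op_closed2, of n n "inv v"] by simp
    fix a' assume "a' \<in> P"
    then obtain n' v' where nv': "n' \<in> N" "v' \<in> V" "a' = n' \<otimes> v'" by (auto simp: P_def)
    then have "a \<otimes> a' = (n \<otimes> n') \<otimes> ((inv n' \<otimes> v \<otimes> n') \<otimes> v')"
      using nv by (simp add: m_assoc)
    then show "a \<otimes> a' \<in> P"
      using nv nv' PI[OF m_closed V.m_closed[OF V.inv_op_closed1], of n n' n' v v'] by simp
  qed
  have NP: "n \<in> P" if "n \<in> N" for n using PI[OF that V.one_closed] that by simp
  have VP: "v \<in> P" if "v \<in> V" for v using PI[OF one_closed that] that by simp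
  \<comment> \<open>Representatives of the cosets of \<open>P\<close>. The coset \<open>P\<close>
    itself gets \<open>\<one>\<close>, so that the cochain built from them restricts to
    \<open>x\<close> on \<open>N\<close>.\<close>
  define t where "t = (\<lambda>C. if C = P then \<one> else SOME t. t \<in> C)"
  have t: "t (P #> g) \<in> P #> g" if "g \<in> carrier G" for g
  proof (cases "P #> g = P")
    case True
    then show ?thesis using subgroup.one_closed[OF P] by (simp add: t_def)
  next
    case False
    have "(SOME t. t \<in> P #> g) \<in> P #> g" using rcos_self[OF that P] by (rule someI)
    with False show ?thesis by (simp add: t_def)
  qed
  have tc: "t (P #> g) \<in> carrier G" if "g \<in> carrier G" for g
    using t[OF that] subgroup.elemrcos_carrier[OF P is_group that] by blast
  have t_cong: "P #> (q \<otimes> g) = P #> g" if "q \<in> P" "g \<in> carrier G" for q g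
  proof -
    have "q \<otimes> g \<in> P #> g" using that subgroup.subset[OF P] by (intro rcosI)
    then show ?thesis using repr_independence[OF _ that(2) P] by simp
  qed
  \<comment> \<open>\<open>n\<close> is a possible \<open>N\<close>-part of \<open>g\<close> in a
    decomposition \<open>n \<otimes> v \<otimes> t (P #> g)\<close> with \<open>v\<close> in
    \<open>V\<close>. Two such parts differ by an element of \<open>N \<inter> V\<close>, on which
    \<open>x\<close> vanishes.\<close>
  define good where "good n g \<longleftrightarrow> n \<in> N \<and> inv n \<otimes> g \<otimes> inv t (P #> g) \<in> V" for n g
  have good_ex: "\<exists>n. good n g" if g: "g \<in> carrier G" for g
  proof -
    have "P #> t (P #> g) = P #> g"
      using repr_independence[OF t[OF g] g P] by simp
    then have "g \<in> P #> t (P #> g)" using rcos_self[OF g P] by simp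
    then obtain n v where nv: "n \<in> N" "v \<in> V" "g = n \<otimes> v \<otimes> t (P #> g)"
      by (auto simp: r_coset_def P_def)
    define s where "s = t (P #> g)"
    have "g = n \<otimes> v \<otimes> s" "s \<in> carrier G" using nv(3) tc[OF g] by (simp_all only: s_def)
    then have "inv n \<otimes> g \<otimes> inv s = v"
      using nv(1,2) by (simp add: m_assoc)
    with nv(1,2) have "good n g" by (simp add: good_def s_def)
    then show ?thesis ..
  qed
  have good_unique: "x n = x n'" if g: "g \<in> carrier G" and "good n g" "good n' g" for n n' g
  proof -
    let ?a = "inv n \<otimes> g \<otimes> inv t (P #> g)" and ?a' = "inv n' \<otimes> g \<otimes> inv t (P #> g)"
    have n: "n \<in> N" "n' \<in> N" "?a \<in> V" "?a' \<in> V" using that by (auto simp: good_def)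
    have "?a' \<otimes> inv ?a = inv n' \<otimes> n"
      using n(1,2) g tc[OF g] by (simp add: m_assoc inv_mult_group)
    then have "inv n' \<otimes> n \<in> V" using V.m_closed[OF n(4) V.m_inv_closed[OF n(3)]] by simp
    moreover have nn: "inv n' \<otimes> n \<in> N" using n by simp
    ultimately have "x (inv n' \<otimes> n) = 0" using V(3) WN by blast
    then have "x (n' \<otimes> (inv n' \<otimes> n)) = x n'"
      using xD(2)[OF n(2) nn] xD(1)[OF n(2)] by simp
    then show ?thesis using n(1,2) by simp
  qed
  define y where "y = (\<lambda>g\<in>carrier G. x (SOME n. good n g))"
  have y: "y g = x n" if "g \<in> carrier G" "good n g" for n g
    using good_unique[OF that(1) someI_ex[OF good_ex[OF that(1)]] that(2)] that(1) by (simp add: y_def)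
  have yN: "y n = x n" if "n \<in> N" for n
  proof (rule y)
    have "P #> n = P" using NP[OF that] P by (simp add: subgroup.rcos_const is_group)
    then show "good n n" using that V.one_closed by (simp add: good_def t_def)
  qed (use that in simp)
  have yNg: "y (n \<otimes> g) = (x n + y g) mod m" if n: "n \<in> N" and g: "g \<in> carrier G" for n g
  proof -
    obtain n' where n': "good n' g" using good_ex[OF g] by blast
    then have n'N: "n' \<in> N" by (simp add: good_def)
    have "inv (n \<otimes> n') \<otimes> (n \<otimes> g) = inv n' \<otimes> g"
      using n n'N g by (simp add: inv_mult_group m_assoc)
    then have "good (n \<otimes> n') (n \<otimes> g)"
      using n n' g by (simp add: good_def t_cong[OF NP])
    then show ?thesis using n n' g xD(2)[OF n n'N] y by simp
  qed
  \<comment> \<open>Constancy on the open cosets of \<open>V\<close> is the source of the continuity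
    of \<open>y\<close>.\<close>
  have yVg: "y (v \<otimes> g) = y g" if v: "v \<in> V" and g: "g \<in> carrier G" for v g
  proof -
    obtain n' where n': "good n' g" using good_ex[OF g] by blast
    then have n'N: "n' \<in> N" by (simp add: good_def)
    let ?s = "inv t (P #> g)"
    have "inv n' \<otimes> (v \<otimes> g) \<otimes> ?s = (inv n' \<otimes> v \<otimes> n') \<otimes> (inv n' \<otimes> g \<otimes> ?s)"
      using v n'N g tc[OF g] by (simp add: m_assoc)
    also have "\<dots> \<in> V"
      using n' n'N v by (intro V.m_closed[OF V.inv_op_closed1]) (auto simp: good_def)
    finally have "good n' (v \<otimes> g)"
      using v g n'N by (simp add: good_def t_cong[OF VP])
    then show ?thesis using v g n' y by simp
  qed
  have yc: "y g \<in> carrier R" if g: "g \<in> carrier G" for g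
  proof -
    obtain n' where n': "good n' g" using good_ex[OF g] by blast
    then show ?thesis using y[OF g n'] xD(1) by (simp add: good_def)
  qed
  have cont: "continuous_map T (discrete_topology (carrier R)) y"
    unfolding continuous_map_def
  proof (intro conjI allI impI)
    show "y \<in> topspace T \<rightarrow> topspace (discrete_topology (carrier R))" using yc by simp
    fix U
    show "openin T {g \<in> topspace T. y g \<in> U}"
    proof (subst openin_subopen, intro ballI)
      fix g assume "g \<in> {g \<in> topspace T. y g \<in> U}"
      then have g: "g \<in> carrier G" "y g \<in> U" by auto
      have "V #> g \<subseteq> {g \<in> topspace T. y g \<in> U}"
        using g yVg V.subset by (auto simp: r_coset_def)
      then show "\<exists>O'. openin T O' \<and> g \<in> O' \<and> O' \<subseteq> {g \<in> topspace T. y g \<in> U}"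
        using openin_rcoset[OF V(2) g(1)] rcos_self[OF g(1) V.is_subgroup] by blast
    qed
  qed
  then have y1: "y \<in> cochains1 G T R"
    using yc by (auto simp: cochains1_def y_def)
  have "coboundary1 G R y (n \<otimes> g, h) = coboundary1 G R y (g, h)"
    if n: "n \<in> N" and g: "g \<in> carrier G" and h: "h \<in> carrier G" for n g h
  proof -
    have "coboundary1 G R y (n \<otimes> g, h) = ((x n + y g) mod m + y h - (x n + y (g \<otimes> h)) mod m) mod m"
      using n g h by (simp add: coboundary1_eq yNg m_assoc)
    also have "\<dots> = (x n + y g + y h - (x n + y (g \<otimes> h))) mod m"
      by (intro mod_diff_cong mod_add_cong) simp_all
    finally show ?thesis using g h by (simp add: coboundary1_eq algebra_simps)
  qed
  moreover have "coboundary1 G R y (g, n \<otimes> h) = coboundary1 G R y (g, h)"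
    if n: "n \<in> N" and g: "g \<in> carrier G" and h: "h \<in> carrier G" for n g h
  proof -
    \<comment> \<open>Conjugation moves \<open>n\<close> to the left of \<open>g\<close>, where
      \<open>yNg\<close> applies; invariance of \<open>x\<close> makes the conjugation
      invisible.\<close>
    have gn: "g \<otimes> n \<otimes> inv g \<in> N" using g n by (rule inv_op_closed2)
    have "g \<otimes> (n \<otimes> h) = (g \<otimes> n \<otimes> inv g) \<otimes> (g \<otimes> h)"
      using n g h by (simp add: m_assoc)
    then have "y (g \<otimes> (n \<otimes> h)) = (x n + y (g \<otimes> h)) mod m"
      using yNg[OF gn, of "g \<otimes> h"] xD(4)[OF g n] g h by simp
    then have "coboundary1 G R y (g, n \<otimes> h) = (y g + (x n + y h) mod m - (x n + y (g \<otimes> h)) mod m) mod m"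
      using n g h by (simp add: coboundary1_eq yNg)
    also have "\<dots> = (y g + (x n + y h) - (x n + y (g \<otimes> h))) mod m"
      by (intro mod_diff_cong mod_add_cong) simp_all
    finally show ?thesis using g h by (simp add: coboundary1_eq algebra_simps)
  qed
  ultimately obtain c where "c \<in> carrier (cocycles2 Q TQ R)"
    "\<And>g h. g \<in> carrier G \<Longrightarrow> h \<in> carrier G \<Longrightarrow> c (N #> g, N #> h) = coboundary1 G R y (g, h)"
    using cocycles2_descend[OF y1] by blast
  then have "transgresses x y c" using y1 yN by (simp add: transgresses_def)
  then show thesis by (rule that)
qed

text \<open>\<open>the_inv_into\<close> returns \<open>x\<close> once \<open>trg\<close> is
  injective on all invariants. As \<open>trg\<close> is a \<open>THE\<close>, comparing two of its
  values takes witnesses for every invariant character, which \<open>transgresses_exists\<close>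
  supplies.\<close>

theorem (in profinite) trg_pairing_eq:
  assumes "prime p" "2 \<le> n"
    and tr: "topgroup_quotient.transgresses G T (int p) (lower_p_central G T p n) x y c"
    and x: "x \<in> H1_invariants G T (lower_p_central G T p n) (residue_ring (int p))"
    and \<sigma>: "\<sigma> \<in> lower_p_central G T p n"
  shows "trg_pairing G T p n \<sigma>
    (H2_class (G Mod lower_p_central G T p n) (coset_topology G T (lower_p_central G T p n)) (residue_ring (int p)) c) =
    (- x \<sigma>) mod int p"
proof -
  let ?N = "lower_p_central G T p n"
  have p1: "1 < int p" using prime_gt_1_nat[OF assms(1)] by simp
  interpret tq: topgroup_quotient G T "int p" "residue_ring (int p)" ?N
    using p1 by (intro topgroup_quotient.intro topgroup_residues.intro topgroup_axioms residues.intro normal_lower_p_central)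
  have N2: "?N \<subseteq> lower_p_central G T p 2"
    using assms(2)
  proof (induction n rule: dec_induct)
    case (step k)
    then show ?case using lower_p_central_Suc_subset[of p k] by blast
  qed simp
  have "inj_on (trg G T ?N (residue_ring (int p))) (H1_invariants G T ?N (residue_ring (int p)))"
  proof (rule inj_onI)
    fix u v assume uv: "u \<in> H1_invariants G T ?N (residue_ring (int p))"
      "v \<in> H1_invariants G T ?N (residue_ring (int p))"
      and eq: "trg G T ?N (residue_ring (int p)) u = trg G T ?N (residue_ring (int p)) v"
    obtain yu cu where u: "tq.transgresses u yu cu"
      by (rule tq.transgresses_exists[OF profinite_axioms closedin_lower_p_central uv(1)])
    obtain yv cv where v: "tq.transgresses v yv cv"
      by (rule tq.transgresses_exists[OF profinite_axioms closedin_lower_p_central uv(2)])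
    show "u = v"
      using eq by (intro tq.transgresses_inj[OF uv u v _ refl N2]) (simp only: tq.trg_eq[OF u] tq.trg_eq[OF v])
  qed
  from the_inv_into_f_f[OF this x] show ?thesis
    by (simp add: trg_pairing_def Let_def tq.trg_eq[OF tr] tq.res.res_neg_eq)
qed


section \<open>Unipotent matrices\<close>

lemma topgroup_discrete:
  fixes G :: "'a monoid"
  assumes "group G"
  shows "topgroup G (discrete_topology (carrier G))"
proof -
  interpret group G by fact
  show ?thesis
    unfolding topgroup_def topological_group_def
    by (simp add: is_group prod_topology_discrete_topology[symmetric] Pi_iff)
qed

locale unipotent = res: residues m R for m :: int and R :: "int ring" +
  fixes d :: nat
begin

abbreviation U :: "(nat \<times> nat \<Rightarrow> int) monoid" where "U \<equiv> unipotent_group R d"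

lemma mem_carrier_iff:
  "A \<in> carrier U \<longleftrightarrow> A \<in> {1..d} \<times> {1..d} \<rightarrow>\<^sub>E {0..m - 1} \<and>
    (\<forall>i\<in>{1..d}. A (i, i) = 1) \<and> (\<forall>i\<in>{1..d}. \<forall>j\<in>{1..d}. j < i \<longrightarrow> A (i, j) = 0)"
  by (simp add: unipotent_group_def res.res_carrier_eq res.res_one_eq res.res_zero_eq)

lemma entry_mod [simp]:
  "A \<in> carrier U \<Longrightarrow> i \<in> {1..d} \<Longrightarrow> j \<in> {1..d} \<Longrightarrow> A (i, j) mod m = A (i, j)"
  using res.m_gt_one by (auto simp: mem_carrier_iff PiE_iff)

lemma carrierD:
  assumes "A \<in> carrier U"
  shows "i \<in> {1..d} \<Longrightarrow> A (i, i) = 1"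
    and "i \<in> {1..d} \<Longrightarrow> j \<in> {1..d} \<Longrightarrow> j < i \<Longrightarrow> A (i, j) = 0"
  using assms by (auto simp: mem_carrier_iff)

lemma eqI:
  assumes "A \<in> carrier U" "B \<in> carrier U"
    and "\<And>i j. i \<in> {1..d} \<Longrightarrow> j \<in> {1..d} \<Longrightarrow> i < j \<Longrightarrow> A (i, j) mod m = B (i, j) mod m"
  shows "A = B"
proof (rule PiE_ext)
  show "A \<in> {1..d} \<times> {1..d} \<rightarrow>\<^sub>E {0..m - 1}" "B \<in> {1..d} \<times> {1..d} \<rightarrow>\<^sub>E {0..m - 1}"
    using assms by (simp_all add: mem_carrier_iff)
  fix z assume "z \<in> {1..d} \<times> {1..d}"
  then obtain i j where z: "z = (i, j)" "i \<in> {1..d}" "j \<in> {1..d}" by blast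
  consider "i < j" | "i = j" | "j < i" by linarith
  then show "A z = B z"
  proof cases
    case 1
    then show ?thesis using assms(3)[OF z(2,3)] entry_mod[OF assms(1) z(2,3)] entry_mod[OF assms(2) z(2,3)] z by simp
  next
    case 2
    then show ?thesis using carrierD(1)[OF assms(1) z(2)] carrierD(1)[OF assms(2) z(2)] z by simp
  next
    case 3
    then show ?thesis using carrierD(2)[OF assms(1) z(2,3)] carrierD(2)[OF assms(2) z(2,3)] z by simp
  qed
qed

lemma mult_entry:
  assumes "i \<in> {1..d}" "j \<in> {1..d}"
  shows "(A \<otimes>\<^bsub>U\<^esub> B) (i, j) = (\<Sum>k\<in>{1..d}. A (i, k) * B (k, j)) mod m"
proof -
  have "(A \<otimes>\<^bsub>U\<^esub> B) (i, j) = (\<Oplus>\<^bsub>R\<^esub>k\<in>{1..d}. (A (i, k) * B (k, j)) mod m)"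
    using assms by (simp add: unipotent_group_def res.res_mult_eq)
  then show ?thesis by (simp add: res.sum_cong)
qed

lemma mult_entry_upper:
  assumes A: "A \<in> carrier U" and B: "B \<in> carrier U" and ij: "i \<in> {1..d}" "j \<in> {1..d}" "i < j"
  shows "(A \<otimes>\<^bsub>U\<^esub> B) (i, j) = (A (i, j) + B (i, j) + (\<Sum>k\<in>{i<..<j}. A (i, k) * B (k, j))) mod m"
proof -
  have "(\<Sum>k\<in>{1..d}. A (i, k) * B (k, j)) = (\<Sum>k\<in>{i..j}. A (i, k) * B (k, j))"
  proof (rule sum.mono_neutral_right)
    show "\<forall>k\<in>{1..d} - {i..j}. A (i, k) * B (k, j) = 0"
    proof
      fix k assume "k \<in> {1..d} - {i..j}"
      then have "k \<in> {1..d}" "k < i \<or> j < k" by auto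
      then show "A (i, k) * B (k, j) = 0" using carrierD[OF A] carrierD[OF B] ij by auto
    qed
  qed (use ij in auto)
  also have "{i..j} = insert i (insert j {i<..<j})" using ij by auto
  also have "(\<Sum>k\<in>\<dots>. A (i, k) * B (k, j)) = A (i, j) + B (i, j) + (\<Sum>k\<in>{i<..<j}. A (i, k) * B (k, j))"
    using ij carrierD(1)[OF A ij(1)] carrierD(1)[OF B ij(2)] by simp
  finally show ?thesis using mult_entry[OF ij(1,2)] by simp
qed

lemma mult_entry_lower:
  assumes A: "A \<in> carrier U" and B: "B \<in> carrier U" and ij: "i \<in> {1..d}" "j \<in> {1..d}" "j \<le> i"
  shows "(A \<otimes>\<^bsub>U\<^esub> B) (i, j) = (if i = j then 1 else 0)"
proof -
  have "(\<Sum>k\<in>{1..d}. A (i, k) * B (k, j)) = (\<Sum>k\<in>{1..d}. if k = i then B (i, j) else 0)"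
  proof (rule sum.cong)
    fix k assume k: "k \<in> {1..d}"
    consider "k < i" | "k = i" | "i < k" by linarith
    then show "A (i, k) * B (k, j) = (if k = i then B (i, j) else 0)"
      using carrierD[OF A] carrierD[OF B] ij k by cases auto
  qed simp
  also have "\<dots> = B (i, j)" using ij by simp
  finally show ?thesis using mult_entry[OF ij(1,2)] carrierD[OF B] ij res.m_gt_one by auto
qed

lemma one_entry: "i \<in> {1..d} \<Longrightarrow> j \<in> {1..d} \<Longrightarrow> \<one>\<^bsub>U\<^esub> (i, j) = (if i = j then 1 else 0)"
  by (simp add: unipotent_group_def res.res_one_eq res.res_zero_eq)

lemma one_mem: "\<one>\<^bsub>U\<^esub> \<in> carrier U"
  using res.m_gt_one
  by (auto simp: unipotent_group_def res.res_one_eq res.res_zero_eq res.res_carrier_eq)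

lemma mult_mem:
  assumes "A \<in> carrier U" "B \<in> carrier U"
  shows "A \<otimes>\<^bsub>U\<^esub> B \<in> carrier U"
  unfolding mem_carrier_iff
proof (intro conjI ballI impI)
  show "A \<otimes>\<^bsub>U\<^esub> B \<in> {1..d} \<times> {1..d} \<rightarrow>\<^sub>E {0..m - 1}"
  proof
    fix z assume "z \<in> {1..d} \<times> {1..d}"
    then obtain i j where "z = (i, j)" "i \<in> {1..d}" "j \<in> {1..d}" by blast
    then show "(A \<otimes>\<^bsub>U\<^esub> B) z \<in> {0..m - 1}"
      using mult_entry[of i j A B] res.m_gt_one by simp
  qed (auto simp: unipotent_group_def)
qed (use assms mult_entry_lower in auto)

text \<open>Left multiplication is injective, by induction on the distance from the diagonal, and
  the carrier is finite; so it is onto, which yields inverses.\<close>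

lemma group: "group U"
proof -
  have assoc: "A \<otimes>\<^bsub>U\<^esub> B \<otimes>\<^bsub>U\<^esub> C = A \<otimes>\<^bsub>U\<^esub> (B \<otimes>\<^bsub>U\<^esub> C)"
    if ABC: "A \<in> carrier U" "B \<in> carrier U" "C \<in> carrier U" for A B C
  proof (rule eqI)
    fix i j assume ij: "i \<in> {1..d}" "j \<in> {1..d}" "i < j"
    have "(A \<otimes>\<^bsub>U\<^esub> B \<otimes>\<^bsub>U\<^esub> C) (i, j) = (\<Sum>k\<in>{1..d}. ((\<Sum>l\<in>{1..d}. A (i, l) * B (l, k)) mod m * C (k, j)) mod m) mod m"
      using ij by (simp add: mult_entry mod_sum_eq)
    also have "\<dots> = (\<Sum>k\<in>{1..d}. \<Sum>l\<in>{1..d}. A (i, l) * B (l, k) * C (k, j)) mod m"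
      by (simp add: mod_mult_left_eq mod_sum_eq sum_distrib_right)
    also have "(\<Sum>k\<in>{1..d}. \<Sum>l\<in>{1..d}. A (i, l) * B (l, k) * C (k, j)) =
        (\<Sum>l\<in>{1..d}. A (i, l) * (\<Sum>k\<in>{1..d}. B (l, k) * C (k, j)))"
      by (subst sum.swap) (simp add: sum_distrib_left mult.assoc)
    also have "\<dots> mod m = (\<Sum>l\<in>{1..d}. (A (i, l) * ((\<Sum>k\<in>{1..d}. B (l, k) * C (k, j)) mod m)) mod m) mod m"
      by (simp add: mod_mult_right_eq mod_sum_eq)
    also have "\<dots> = (A \<otimes>\<^bsub>U\<^esub> (B \<otimes>\<^bsub>U\<^esub> C)) (i, j)"
      using ij by (simp add: mult_entry mod_sum_eq)
    finally show "(A \<otimes>\<^bsub>U\<^esub> B \<otimes>\<^bsub>U\<^esub> C) (i, j) mod m = (A \<otimes>\<^bsub>U\<^esub> (B \<otimes>\<^bsub>U\<^esub> C)) (i, j) mod m"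
      by simp
  qed (use ABC mult_mem in simp_all)
  have one_l: "\<one>\<^bsub>U\<^esub> \<otimes>\<^bsub>U\<^esub> A = A" and one_r: "A \<otimes>\<^bsub>U\<^esub> \<one>\<^bsub>U\<^esub> = A" if "A \<in> carrier U" for A
  proof -
    show "\<one>\<^bsub>U\<^esub> \<otimes>\<^bsub>U\<^esub> A = A"
      by (rule eqI[OF mult_mem[OF one_mem that] that])
        (simp add: mult_entry_upper[OF one_mem that] one_entry that)
    show "A \<otimes>\<^bsub>U\<^esub> \<one>\<^bsub>U\<^esub> = A"
      by (rule eqI[OF mult_mem[OF that one_mem] that])
        (simp add: mult_entry_upper[OF that one_mem] one_entry that)
  qed
  have cancel: "B = C"
    if A: "A \<in> carrier U" and B: "B \<in> carrier U" and C: "C \<in> carrier U" and eq: "A \<otimes>\<^bsub>U\<^esub> B = A \<otimes>\<^bsub>U\<^esub> C" for A B C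
  proof (rule eqI[OF B C])
    fix i j assume "i \<in> {1..d}" "j \<in> {1..d}" "i < j"
    then show "B (i, j) mod m = C (i, j) mod m"
    proof (induction "j - i" arbitrary: i rule: less_induct)
      case less
      let ?s = "\<lambda>B. \<Sum>k\<in>{i<..<j}. A (i, k) * B (k, j)"
      have "?s B = ?s C"
      proof (rule sum.cong)
        fix k assume "k \<in> {i<..<j}"
        then have "B (k, j) mod m = C (k, j) mod m" "k \<in> {1..d}"
          using less.prems by (auto intro: less.hyps)
        then show "A (i, k) * B (k, j) = A (i, k) * C (k, j)"
          using B C less.prems by simp
      qed simp
      moreover have "(A (i, j) + B (i, j) + ?s B) mod m = (A (i, j) + C (i, j) + ?s C) mod m"
        using mult_entry_upper[OF A B less.prems] mult_entry_upper[OF A C less.prems] eq by simp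
      ultimately have "(A (i, j) + B (i, j) + ?s B - (A (i, j) + ?s B)) mod m =
          (A (i, j) + C (i, j) + ?s B - (A (i, j) + ?s B)) mod m"
        by (intro mod_diff_cong) simp_all
      then show ?case by simp
    qed
  qed
  have "finite (carrier U)"
  proof (rule finite_subset)
    show "carrier U \<subseteq> {1..d} \<times> {1..d} \<rightarrow>\<^sub>E {0..m - 1}" using mem_carrier_iff by blast
  qed (intro finite_PiE; simp)
  then have ex: "\<exists>B\<in>carrier U. A \<otimes>\<^bsub>U\<^esub> B = \<one>\<^bsub>U\<^esub>" if "A \<in> carrier U" for A
  proof -
    have "inj_on (\<lambda>B. A \<otimes>\<^bsub>U\<^esub> B) (carrier U)"
      using cancel[OF that] by (rule inj_onI)
    moreover have "(\<lambda>B. A \<otimes>\<^bsub>U\<^esub> B) ` carrier U \<subseteq> carrier U" using mult_mem that by blast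
    ultimately have "(\<lambda>B. A \<otimes>\<^bsub>U\<^esub> B) ` carrier U = carrier U"
      using \<open>finite (carrier U)\<close> by (simp add: endo_inj_surj)
    then have "\<one>\<^bsub>U\<^esub> \<in> (\<lambda>B. A \<otimes>\<^bsub>U\<^esub> B) ` carrier U" using one_mem by simp
    then show ?thesis by (metis imageE)
  qed
  show ?thesis
  proof (rule groupI)
    fix A assume A: "A \<in> carrier U"
    obtain B where B: "B \<in> carrier U" "A \<otimes>\<^bsub>U\<^esub> B = \<one>\<^bsub>U\<^esub>" using ex[OF A] by blast
    obtain C where C: "C \<in> carrier U" "B \<otimes>\<^bsub>U\<^esub> C = \<one>\<^bsub>U\<^esub>" using ex[OF B(1)] by blast
    \<comment> \<open>A right inverse of the right inverse \<open>B\<close> equals \<open>A\<close>,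
      so \<open>B\<close> is also a left inverse.\<close>
    have "A = A \<otimes>\<^bsub>U\<^esub> (B \<otimes>\<^bsub>U\<^esub> C)" using C one_r[OF A] by simp
    also have "\<dots> = C" using assoc[OF A B(1) C(1)] B(2) one_l[OF C(1)] by simp
    finally show "\<exists>B\<in>carrier U. B \<otimes>\<^bsub>U\<^esub> A = \<one>\<^bsub>U\<^esub>" using B C by blast
  qed (use one_mem mult_mem assoc one_l in auto)
qed

lemma topgroup: "topgroup U (discrete_topology (carrier U))"
  using group by (rule topgroup_discrete)

end

text \<open>
  The lower \<open>p\<close>-central filtration is bounded by divisibility conditions on the entries: an entry
  at distance \<open>e\<close> from the diagonal of a matrix in the \<open>k\<close>-th term is divisible by
  \<open>p ^ (k - e)\<close>, up to the modulus.
\<close>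

locale filtered_unipotent = unipotent m R d for m :: int and R :: "int ring" and d :: nat +
  fixes p N :: nat
  assumes m_eq: "m = int p ^ N"
begin

sublocale U: topgroup U "discrete_topology (carrier U)"
  by (rule topgroup)

text \<open>Truncated subtraction leaves no condition for \<open>e \<ge> k\<close>. The cap
  \<open>N\<close> makes \<open>D k e\<close> a divisor of the modulus, so that divisibility
  survives reduction.\<close>

definition D :: "nat \<Rightarrow> nat \<Rightarrow> int" where
  "D k e = int p ^ min (k - e) N"

definition W :: "nat \<Rightarrow> (nat \<times> nat \<Rightarrow> int) set" where
  "W k = {A \<in> carrier U. \<forall>i\<in>{1..d}. \<forall>j\<in>{1..d}. i < j \<longrightarrow> D k (j - i) dvd A (i, j)}"

lemma D_dvd_m: "D k e dvd m"
  by (simp add: D_def m_eq le_imp_power_dvd)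

lemma D_mono: "e' \<le> e \<Longrightarrow> D k e dvd D k e'"
  by (auto simp: D_def intro!: le_imp_power_dvd)

text \<open>An entry strictly nearer to the diagonal already meets the condition of the next term;
  hence products through intermediate indices are negligible there.\<close>

lemma D_Suc_less: "e' < e \<Longrightarrow> D (Suc k) e dvd D k e'"
  by (auto simp: D_def intro!: le_imp_power_dvd)

lemma D_Suc_mult: "D (Suc k) e dvd int p * D k e"
proof -
  have "D (Suc k) e dvd int p ^ Suc (min (k - e) N)"
    unfolding D_def by (rule le_imp_power_dvd) auto
  then show ?thesis by (simp add: D_def)
qed

lemma D_dvd_mod_iff: "D k e dvd a mod m \<longleftrightarrow> D k e dvd a"
  by (rule dvd_mod_iff[OF D_dvd_m])

lemma WD: "A \<in> W k \<Longrightarrow> i \<in> {1..d} \<Longrightarrow> j \<in> {1..d} \<Longrightarrow> i < j \<Longrightarrow> D k (j - i) dvd A (i, j)"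
  by (auto simp: W_def)

lemma W_carrier: "A \<in> W k \<Longrightarrow> A \<in> carrier U"
  by (simp add: W_def)

text \<open>Closure under inverses is read off the entries of the product of \<open>A\<close> with
  its inverse: each intermediate product contains an entry of \<open>A\<close> nearer to the
  diagonal, whose condition is at least as strong.\<close>

lemma subgroup_W: "subgroup (W k) U"
proof (rule U.subgroupI)
  show "W k \<subseteq> carrier U" by (auto simp: W_def)
  have "\<one>\<^bsub>U\<^esub> \<in> W k" by (simp add: W_def one_entry)
  then show "W k \<noteq> {}" by blast
next
  fix A assume A: "A \<in> W k"
  then have Ac: "A \<in> carrier U" by (rule W_carrier)
  let ?B = "inv\<^bsub>U\<^esub> A"
  have B: "?B \<in> carrier U" using Ac by simp
  show "?B \<in> W k"
    unfolding W_def
  proof (intro CollectI conjI B ballI impI)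
    fix i j assume ij: "i \<in> {1..d}" "j \<in> {1..d}" "i < j"
    let ?s = "\<Sum>k\<in>{i<..<j}. A (i, k) * ?B (k, j)"
    have "(A (i, j) + ?B (i, j) + ?s) mod m = 0"
      using mult_entry_upper[OF Ac B ij] Ac ij by (simp add: one_entry)
    then have sum: "D k (j - i) dvd A (i, j) + ?B (i, j) + ?s"
      by (rule dvd_trans[OF D_dvd_m mod_0_imp_dvd])
    have s: "D k (j - i) dvd ?s"
    proof (intro dvd_sum dvd_mult2)
      fix l assume "l \<in> {i<..<j}"
      then show "D k (j - i) dvd A (i, l)"
        using ij by (auto intro!: dvd_trans[OF D_mono WD[OF A]])
    qed
    show "D k (j - i) dvd ?B (i, j)"
      using dvd_diff[OF dvd_diff[OF sum s] WD[OF A ij]] by simp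
  qed
next
  fix A B assume A: "A \<in> W k" and B: "B \<in> W k"
  then have AB: "A \<in> carrier U" "B \<in> carrier U" by (simp_all add: W_carrier)
  show "A \<otimes>\<^bsub>U\<^esub> B \<in> W k"
    unfolding W_def
  proof (intro CollectI conjI mult_mem AB ballI impI)
    fix i j assume ij: "i \<in> {1..d}" "j \<in> {1..d}" "i < j"
    have "D k (j - i) dvd A (i, l)" if "l \<in> {i<..<j}" for l
      using that ij by (auto intro!: dvd_trans[OF D_mono WD[OF A]])
    then have "D k (j - i) dvd A (i, j) + B (i, j) + (\<Sum>l\<in>{i<..<j}. A (i, l) * B (l, j))"
      using WD[OF A ij] WD[OF B ij] by (intro dvd_add dvd_sum dvd_mult2)
    then show "D k (j - i) dvd (A \<otimes>\<^bsub>U\<^esub> B) (i, j)"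
      by (simp add: mult_entry_upper[OF AB ij] D_dvd_mod_iff)
  qed
qed

text \<open>Up to the divisibility of the next term the power map is linear on entries, since every
  cross product contains an entry of \<open>A\<close> nearer to the diagonal. For
  \<open>q = p\<close> the factor \<open>p\<close> supplies the divisibility still missing.\<close>

lemma W_pow_entry:
  assumes A: "A \<in> W k" and ij: "i \<in> {1..d}" "j \<in> {1..d}" "i < j"
  shows "D (Suc k) (j - i) dvd (A [^]\<^bsub>U\<^esub> (q::nat)) (i, j) - int q * A (i, j)"
proof (induction q)
  case 0
  then show ?case using ij by (simp add: one_entry)
next
  case (Suc q)
  have Ac: "A \<in> carrier U" using A by (rule W_carrier)
  let ?s = "\<Sum>l\<in>{i<..<j}. (A [^]\<^bsub>U\<^esub> q) (i, l) * A (l, j)"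
  have "D (Suc k) (j - i) dvd ?s"
  proof (intro dvd_sum dvd_mult)
    fix l assume "l \<in> {i<..<j}"
    then show "D (Suc k) (j - i) dvd A (l, j)"
      using ij by (auto intro!: dvd_trans[OF D_Suc_less WD[OF A]])
  qed
  with Suc have "D (Suc k) (j - i) dvd ((A [^]\<^bsub>U\<^esub> q) (i, j) - int q * A (i, j)) + ?s"
    by (rule dvd_add)
  also have "((A [^]\<^bsub>U\<^esub> q) (i, j) - int q * A (i, j)) + ?s =
      ((A [^]\<^bsub>U\<^esub> q) (i, j) + A (i, j) + ?s) - int (Suc q) * A (i, j)"
    by (simp add: algebra_simps)
  finally have "D (Suc k) (j - i) dvd (((A [^]\<^bsub>U\<^esub> q) (i, j) + A (i, j) + ?s) - int (Suc q) * A (i, j)) mod m"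
    by (simp only: D_dvd_mod_iff)
  then have "D (Suc k) (j - i) dvd (((A [^]\<^bsub>U\<^esub> q) (i, j) + A (i, j) + ?s) mod m - int (Suc q) * A (i, j)) mod m"
    by (simp only: mod_diff_left_eq)
  then show ?case
    using mult_entry_upper[OF _ Ac ij, of "A [^]\<^bsub>U\<^esub> q"] Ac by (simp add: D_dvd_mod_iff)
qed

lemma W_pow:
  assumes "A \<in> W k"
  shows "A [^]\<^bsub>U\<^esub> p \<in> W (Suc k)"
  unfolding W_def
proof (intro CollectI conjI ballI impI)
  fix i j assume ij: "i \<in> {1..d}" "j \<in> {1..d}" "i < j"
  have *: "D (Suc k) (j - i) dvd int p * A (i, j)"
    by (rule dvd_trans[OF D_Suc_mult mult_dvd_mono[OF dvd_refl WD[OF assms ij]]])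
  show "D (Suc k) (j - i) dvd (A [^]\<^bsub>U\<^esub> p) (i, j)"
    using dvd_add[OF W_pow_entry[OF assms ij, of p] *] by simp
qed (use W_carrier[OF assms] in simp)

text \<open>In \<open>B A [A, B] = A B\<close> the linear terms of \<open>A\<close> and
  \<open>B\<close> cancel, and every remaining product passes through an entry of \<open>B\<close>
  or of the commutator nearer to the diagonal; hence the induction on \<open>j - i\<close>.\<close>

lemma W_commutator:
  assumes A: "A \<in> carrier U" and B: "B \<in> W k"
  shows "commutator U A B \<in> W (Suc k)"
proof -
  have Bc: "B \<in> carrier U" using B by (rule W_carrier)
  define C F where "C = commutator U A B" and "F = B \<otimes>\<^bsub>U\<^esub> A"
  have C: "C \<in> carrier U" and F: "F \<in> carrier U" using A Bc by (simp_all add: C_def F_def)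
  have FC: "F \<otimes>\<^bsub>U\<^esub> C = A \<otimes>\<^bsub>U\<^esub> B"
    using A Bc by (simp add: C_def F_def commutator_def U.m_assoc)
  have "D (Suc k) (j - i) dvd C (i, j)" if "i \<in> {1..d}" "j \<in> {1..d}" "i < j" for i j
    using that
  proof (induction "j - i" arbitrary: i rule: less_induct)
    case less
    note ij = less.prems
    let ?D = "D (Suc k) (j - i)"
    let ?s = "\<lambda>A B. \<Sum>l\<in>{i<..<j}. A (i, l) * B (l, j)"
    have B_dvd: "?D dvd B (i, l)" "?D dvd B (l, j)" if "l \<in> {i<..<j}" for l
      using that ij by (auto intro!: dvd_trans[OF D_Suc_less WD[OF B]])
    have s: "?D dvd ?s A B" "?D dvd ?s B A"
      by (intro dvd_sum dvd_mult dvd_mult2 B_dvd; assumption)+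
    have sF: "?D dvd ?s F C"
    proof (intro dvd_sum dvd_mult)
      fix l assume l: "l \<in> {i<..<j}"
      then have "D (Suc k) (j - l) dvd C (l, j)" using ij by (intro less.hyps) auto
      moreover have "?D dvd D (Suc k) (j - l)" using l by (intro D_mono) auto
      ultimately show "?D dvd C (l, j)" by (rule dvd_trans[rotated])
    qed
    have "(F (i, j) + C (i, j) + ?s F C) mod m = (A (i, j) + B (i, j) + ?s A B) mod m"
      using mult_entry_upper[OF F C ij] mult_entry_upper[OF A Bc ij] FC by simp
    moreover have "F (i, j) mod m = (B (i, j) + A (i, j) + ?s B A) mod m"
      using mult_entry_upper[OF Bc A ij] by (simp add: F_def)
    ultimately have "(F (i, j) + C (i, j) + ?s F C - F (i, j)) mod m =
        (A (i, j) + B (i, j) + ?s A B - (B (i, j) + A (i, j) + ?s B A)) mod m"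
      by (rule mod_diff_cong)
    then have "(C (i, j) + ?s F C) mod m = (?s A B - ?s B A) mod m"
      by (simp add: algebra_simps)
    moreover have "?D dvd (?s A B - ?s B A) mod m"
      unfolding D_dvd_mod_iff using s by (rule dvd_diff)
    ultimately have "?D dvd (C (i, j) + ?s F C) mod m" by simp
    then have "?D dvd C (i, j) + ?s F C" by (simp only: D_dvd_mod_iff)
    from dvd_diff[OF this sF] show ?case by simp
  qed
  then show ?thesis using C by (simp add: W_def C_def)
qed

lemma lower_p_central_subset_W:
  "0 < k \<Longrightarrow> lower_p_central U (discrete_topology (carrier U)) p k \<subseteq> W k"
proof (induction k)
  case (Suc k)
  show ?case
  proof (cases "k = 0")
    case True
    have "D 1 (j - i) = 1" if "i < j" for i j using that by (simp add: D_def)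
    then show ?thesis using True by (auto simp: W_def)
  next
    case False
    then have k: "0 < k" by simp
    show ?thesis
      unfolding U.lower_p_central_Suc[OF k]
    proof (rule U.closed_generate_subset)
      show "closedin (discrete_topology (carrier U)) (W (Suc k))" using W_carrier by auto
      show "{h [^]\<^bsub>U\<^esub> p | h. h \<in> lower_p_central U (discrete_topology (carrier U)) p k} \<union>
        {commutator U g h | g h. g \<in> carrier U \<and> h \<in> lower_p_central U (discrete_topology (carrier U)) p k} \<subseteq> W (Suc k)"
        using Suc.IH[OF k] W_pow W_commutator by blast
    qed (rule subgroup_W)
  qed
qed simp

end


section \<open>The extension classes\<close>

locale unipotent_extension =
  fixes p n s :: nat
  assumes p: "prime p" and s: "0 < s" "s \<le> n"
begin

lemma p_gt_one: "1 < int p"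
  using prime_gt_1_nat[OF p] by simp

definition modulus :: int where "modulus = int (p ^ (n - s + 1))"
definition dim :: nat where "dim = s + 1"
definition expo :: nat where "expo = n - s + 1"

lemma modulus_eq: "modulus = int p * int p ^ (n - s)"
  by (simp add: modulus_def)

sublocale filtered_unipotent modulus "residue_ring modulus" dim p expo
proof unfold_locales
  have "int p * 1 \<le> int p * int p ^ (n - s)"
    using p_gt_one by (intro mult_left_mono) auto
  then show "1 < modulus" unfolding modulus_eq using p_gt_one by linarith
qed (simp_all add: modulus_def expo_def)

lemma dim_range: "1 \<in> {1..dim}" "dim \<in> {1..dim}" "1 < dim"
  using s by (auto simp: dim_def)

abbreviation Z :: "(nat \<times> nat \<Rightarrow> int) set" where
  "Z \<equiv> lower_p_central U (discrete_topology (carrier U)) p n"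

lemma UU_eq: "UU p n s = U" and UU_lower_eq: "UU_lower p n s = Z"
  by (simp_all add: UU_def UU_lower_def modulus_def dim_def)

text \<open>Division makes this a function on all matrices; on \<open>W n\<close> it agrees with
  \<open>center_coord\<close>, which is given only as an inverse map.\<close>

definition coord :: "(nat \<times> nat \<Rightarrow> int) \<Rightarrow> int" where
  "coord A = A (1, dim) div int p ^ (n - s)"

lemma Z_normal: "Z \<lhd> U"
  by (rule U.normal_lower_p_central)

lemma Z_W: "A \<in> Z \<Longrightarrow> A \<in> W n"
  using lower_p_central_subset_W[of n] s by auto

lemma Z_carrier: "A \<in> Z \<Longrightarrow> A \<in> carrier U"
  using Z_W W_carrier by blast

lemma W_entry_zero:
  assumes A: "A \<in> W n" and ij: "i \<in> {1..dim}" "j \<in> {1..dim}" "i < j" "i \<noteq> 1 \<or> j \<noteq> dim"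
  shows "A (i, j) = 0"
proof -
  \<comment> \<open>Away from the corner the distance is less than \<open>s\<close>, so the required
    power of \<open>p\<close> reaches the modulus and the entry is 0. At the corner the distance is
    \<open>s\<close> and only \<open>n - s\<close> factors are required.\<close>
  have "j - i < s" using ij by (auto simp: dim_def)
  then have "min (n - (j - i)) expo = expo" using s by (auto simp: expo_def)
  then have "D n (j - i) = modulus" by (simp add: D_def m_eq)
  then have "A (i, j) mod modulus = 0" using WD[OF A ij(1-3)] by simp
  then show ?thesis using entry_mod[OF W_carrier[OF A] ij(1,2)] by simp
qed

lemma W_corner:
  assumes "A \<in> W n"
  shows "A (1, dim) = coord A * int p ^ (n - s)"
proof -
  have "D n (dim - 1) dvd A (1, dim)" using dim_range by (intro WD[OF assms])
  moreover have "min (n - (dim - 1)) expo = n - s" by (simp add: dim_def expo_def)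
  then have "D n (dim - 1) = int p ^ (n - s)" by (simp only: D_def)
  ultimately have "int p ^ (n - s) dvd A (1, dim)" by simp
  then show ?thesis by (simp add: coord_def)
qed

lemma coord_mem: "A \<in> carrier U \<Longrightarrow> coord A \<in> carrier (residue_ring (int p))"
proof -
  assume "A \<in> carrier U"
  then have "A (1, dim) \<in> {0..modulus - 1}"
    using dim_range unfolding mem_carrier_iff by (auto dest!: PiE_mem[of _ _ _ "(1, dim)"])
  then have "0 \<le> A (1, dim)" "A (1, dim) < int p ^ (n - s) * int p" by (simp_all add: modulus_eq mult.commute)
  moreover have "0 < int p ^ (n - s)" using p_gt_one by simp
  ultimately have "0 \<le> coord A" "coord A < int p"
  proof -
    let ?q = "int p ^ (n - s)"
    assume A: "0 \<le> A (1, dim)" "A (1, dim) < ?q * int p" and q: "0 < ?q"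
    show "0 \<le> coord A" using A(1) q by (simp only: coord_def pos_imp_zdiv_nonneg_iff)
    have "?q * coord A + A (1, dim) mod ?q = A (1, dim)" unfolding coord_def by simp
    moreover have "0 \<le> A (1, dim) mod ?q" using q by (rule pos_mod_sign)
    ultimately have "?q * coord A < ?q * int p" using A(2) by linarith
    then show "coord A < int p" using q by (simp only: mult_less_cancel_left_pos)
  qed
  then show ?thesis by (simp add: residue_ring_def)
qed

text \<open>A matrix of \<open>W n\<close> differs from the identity only in the corner, so no
  intermediate index contributes to a product with it on either side.\<close>

lemma W_mult_entry:
  assumes A: "A \<in> W n" and B: "B \<in> carrier U" and ij: "i \<in> {1..dim}" "j \<in> {1..dim}" "i < j"
  shows "(A \<otimes>\<^bsub>U\<^esub> B) (i, j) = (A (i, j) + B (i, j)) mod modulus"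
    and "(B \<otimes>\<^bsub>U\<^esub> A) (i, j) = (A (i, j) + B (i, j)) mod modulus"
proof -
  have "A (i, k) = 0" "A (k, j) = 0" if "k \<in> {i<..<j}" for k
    using that ij by (auto intro!: W_entry_zero[OF A])
  then show "(A \<otimes>\<^bsub>U\<^esub> B) (i, j) = (A (i, j) + B (i, j)) mod modulus"
    "(B \<otimes>\<^bsub>U\<^esub> A) (i, j) = (A (i, j) + B (i, j)) mod modulus"
    using mult_entry_upper[OF W_carrier[OF A] B ij] mult_entry_upper[OF B W_carrier[OF A] ij]
    by (simp_all add: add.commute)
qed

lemma W_central:
  assumes A: "A \<in> W n" and B: "B \<in> carrier U"
  shows "A \<otimes>\<^bsub>U\<^esub> B = B \<otimes>\<^bsub>U\<^esub> A"
  using W_mult_entry[OF A B] W_carrier[OF A] B by (intro eqI mult_mem) simp_all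

lemma coord_mult:
  assumes A: "A \<in> W n" and B: "B \<in> W n"
  shows "coord (A \<otimes>\<^bsub>U\<^esub> B) = (coord A + coord B) mod int p"
proof -
  have "(A \<otimes>\<^bsub>U\<^esub> B) (1, dim) = (A (1, dim) + B (1, dim)) mod (int p * int p ^ (n - s))"
    using W_mult_entry(1)[OF A W_carrier[OF B] dim_range] by (simp add: modulus_eq)
  also have "\<dots> = ((coord A + coord B) * int p ^ (n - s)) mod (int p * int p ^ (n - s))"
    by (simp only: W_corner[OF A] W_corner[OF B] distrib_right)
  also have "\<dots> = ((coord A + coord B) mod int p) * int p ^ (n - s)"
    by (rule mod_mult_mult2)
  finally show ?thesis using p_gt_one by (simp add: coord_def)
qed

interpretation Qres: residues "int p" "residue_ring (int p)"
  by (rule residues.intro[OF p_gt_one]) (rule reflexive)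

lemma coord_one: "coord \<one>\<^bsub>U\<^esub> = 0"
  using one_entry[OF dim_range(1,2)] dim_range(3) by (simp add: coord_def)

lemma coord_inv:
  assumes "A \<in> W n"
  shows "coord (inv\<^bsub>U\<^esub> A) = (- coord A) mod int p"
proof -
  have Ac: "A \<in> carrier U" using assms by (rule W_carrier)
  have iA: "inv\<^bsub>U\<^esub> A \<in> W n" by (rule subgroup.m_inv_closed[OF subgroup_W assms])
  have "(coord A + coord (inv\<^bsub>U\<^esub> A)) mod int p = 0 mod int p"
    using coord_mult[OF assms iA] by (simp only: U.r_inv[OF Ac] coord_one mod_0)
  then have "(coord A + coord (inv\<^bsub>U\<^esub> A) - coord A) mod int p = (0 - coord A) mod int p"
    by (rule mod_diff_cong) (rule refl)
  moreover have "coord A + coord (inv\<^bsub>U\<^esub> A) - coord A = coord (inv\<^bsub>U\<^esub> A)" "0 - coord A = - coord A"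
    by linarith+
  moreover have "coord (inv\<^bsub>U\<^esub> A) mod int p = coord (inv\<^bsub>U\<^esub> A)"
    by (rule Qres.mod_carrier_eq[OF coord_mem[OF U.inv_closed[OF Ac]]])
  ultimately show ?thesis by (simp only:)
qed

text \<open>The corner of such a matrix is the only free entry, so the matrix is the value of
  \<open>center_matrix\<close> at its coordinate.\<close>

lemma center_coord_eq:
  assumes A: "A \<in> W n"
  shows "center_coord p n s A = coord A"
  unfolding center_coord_def
proof (rule the_inv_into_f_eq)
  show "inj_on (center_matrix p n s) (carrier (residue_ring (int p)))"
  proof (rule inj_onI)
    fix a b assume "center_matrix p n s a = center_matrix p n s b"
    from fun_cong[OF this, of "(1, dim)"] show "a = b"
      using s p_gt_one by (simp add: center_matrix_def dim_def)
  qed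
  show "coord A \<in> carrier (residue_ring (int p))" by (rule coord_mem[OF W_carrier[OF A]])
  have Ac: "A \<in> carrier U" by (rule W_carrier[OF A])
  show "center_matrix p n s (coord A) = A"
  proof
    fix z
    show "center_matrix p n s (coord A) z = A z"
    proof (cases "z \<in> {1..dim} \<times> {1..dim}")
      case True
      then obtain i j where z: "z = (i, j)" and ij: "i \<in> {1..dim}" "j \<in> {1..dim}" by blast
      have cm: "center_matrix p n s (coord A) (i, j) =
        (if i = j then 1 else if i = 1 \<and> j = dim then coord A * int p ^ (n - s) else 0)"
        using ij by (simp add: center_matrix_def dim_def)
      consider "i = j" | "i = 1 \<and> j = dim" "i < j" | "i < j" "i \<noteq> 1 \<or> j \<noteq> dim" | "j < i" by linarith
      then show ?thesis
      proof cases
        case 1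
        then show ?thesis unfolding z cm using carrierD(1)[OF Ac ij(1)] by simp
      next
        case 2
        then show ?thesis unfolding z cm using W_corner[OF A] by simp
      next
        case 3
        then show ?thesis unfolding z cm using W_entry_zero[OF A ij 3] by auto
      next
        case 4
        then show ?thesis unfolding z cm using carrierD(2)[OF Ac ij 4] ij by auto
      qed
    next
      case False
      have "A z = undefined"
        using Ac False unfolding mem_carrier_iff by (meson PiE_arb)
      with False show ?thesis by (auto simp: center_matrix_def dim_def)
    qed
  qed
qed

section \<open>Sections of the extension and their cocycles\<close>

sublocale Z: normal Z U
  by (rule Z_normal)

abbreviation Q :: "(nat \<times> nat \<Rightarrow> int) set monoid" where "Q \<equiv> U Mod Z"

sublocale Q: topgroup_residues Q "discrete_topology (carrier Q)" "int p" "residue_ring (int p)"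
  by (intro topgroup_residues.intro topgroup_discrete Z.factorgroup_is_group residues.intro p_gt_one)

definition is_section :: "((nat \<times> nat \<Rightarrow> int) set \<Rightarrow> nat \<times> nat \<Rightarrow> int) \<Rightarrow> bool" where
  "is_section l \<longleftrightarrow> (\<forall>C\<in>carrier Q. l C \<in> carrier U \<and> Z #>\<^bsub>U\<^esub> l C = C) \<and> l \<one>\<^bsub>Q\<^esub> = \<one>\<^bsub>U\<^esub>"

definition ext_cocycle ::
  "((nat \<times> nat \<Rightarrow> int) set \<Rightarrow> nat \<times> nat \<Rightarrow> int) \<Rightarrow> (nat \<times> nat \<Rightarrow> int) set \<times> (nat \<times> nat \<Rightarrow> int) set \<Rightarrow> int"
  where
  "ext_cocycle l = (\<lambda>(C, D)\<in>carrier Q \<times> carrier Q.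
     center_coord p n s (l C \<otimes>\<^bsub>U\<^esub> l D \<otimes>\<^bsub>U\<^esub> inv\<^bsub>U\<^esub> l (C \<otimes>\<^bsub>Q\<^esub> D)))"

lemma mult_inv_mem_Z:
  assumes "A \<in> carrier U" "B \<in> carrier U" "Z #>\<^bsub>U\<^esub> A = Z #>\<^bsub>U\<^esub> B"
  shows "A \<otimes>\<^bsub>U\<^esub> inv\<^bsub>U\<^esub> B \<in> Z"
proof -
  have "A \<in> Z #>\<^bsub>U\<^esub> B" using U.rcos_self[OF assms(1) Z.is_subgroup] assms(3) by simp
  then show ?thesis using Z.rcos_module_imp[OF U.is_group assms(2)] by blast
qed

lemma sectionD:
  assumes "is_section l" "C \<in> carrier Q" "C' \<in> carrier Q"
  shows "l C \<in> carrier U" "Z #>\<^bsub>U\<^esub> l C = C"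
    and "l C \<otimes>\<^bsub>U\<^esub> l C' \<otimes>\<^bsub>U\<^esub> inv\<^bsub>U\<^esub> l (C \<otimes>\<^bsub>Q\<^esub> C') \<in> Z"
    and "ext_cocycle l (C, C') = coord (l C \<otimes>\<^bsub>U\<^esub> l C' \<otimes>\<^bsub>U\<^esub> inv\<^bsub>U\<^esub> l (C \<otimes>\<^bsub>Q\<^esub> C'))"
proof -
  have l: "l C \<in> carrier U \<and> Z #>\<^bsub>U\<^esub> l C = C" if "C \<in> carrier Q" for C
    using assms(1) that by (auto simp: is_section_def)
  have CD: "C \<otimes>\<^bsub>Q\<^esub> C' \<in> carrier Q" using assms by (simp del: mult_FactGroup)
  have "Z #>\<^bsub>U\<^esub> (l C \<otimes>\<^bsub>U\<^esub> l C') = (Z #>\<^bsub>U\<^esub> l C) <#>\<^bsub>U\<^esub> (Z #>\<^bsub>U\<^esub> l C')"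
    using l assms by (intro Z.rcos_sum[symmetric]) auto
  also have "\<dots> = Z #>\<^bsub>U\<^esub> l (C \<otimes>\<^bsub>Q\<^esub> C')" using l[OF CD] l assms by simp
  finally show *: "l C \<otimes>\<^bsub>U\<^esub> l C' \<otimes>\<^bsub>U\<^esub> inv\<^bsub>U\<^esub> l (C \<otimes>\<^bsub>Q\<^esub> C') \<in> Z"
    using l assms CD by (intro mult_inv_mem_Z) auto
  then show "ext_cocycle l (C, C') = coord (l C \<otimes>\<^bsub>U\<^esub> l C' \<otimes>\<^bsub>U\<^esub> inv\<^bsub>U\<^esub> l (C \<otimes>\<^bsub>Q\<^esub> C'))"
    using assms by (simp add: ext_cocycle_def center_coord_eq Z_W del: mult_FactGroup)
  show "l C \<in> carrier U" "Z #>\<^bsub>U\<^esub> l C = C" using l assms by auto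
qed

lemma section_exists: "\<exists>l. is_section l"
proof -
  define l where "l = (\<lambda>C. if C = \<one>\<^bsub>Q\<^esub> then \<one>\<^bsub>U\<^esub> else SOME A. A \<in> carrier U \<and> Z #>\<^bsub>U\<^esub> A = C)"
  have "l C \<in> carrier U \<and> Z #>\<^bsub>U\<^esub> l C = C" if "C \<in> carrier Q" for C
  proof (cases "C = \<one>\<^bsub>Q\<^esub>")
    case True
    then show ?thesis using Z.subset by (simp add: l_def)
  next
    case False
    have "\<exists>A. A \<in> carrier U \<and> Z #>\<^bsub>U\<^esub> A = C" using that unfolding carrier_FactGroup by blast
    from someI_ex[OF this] False show ?thesis by (simp add: l_def)
  qed
  then have "is_section l" by (simp add: is_section_def l_def)
  then show ?thesis by blast
qed

text \<open>Two sections differ by a map \<open>\<zeta>\<close> with central values; by centrality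
  the two cocycles then differ by the coboundary of the coordinate of \<open>\<zeta>\<close>. This
  is what gives the \<open>THE\<close> in \<open>gamma_class\<close> its value.\<close>

lemma ext_cocycle_class_unique:
  assumes l: "is_section l" and l': "is_section l'"
  shows "H2_class Q (discrete_topology (carrier Q)) (residue_ring (int p)) (ext_cocycle l) =
    H2_class Q (discrete_topology (carrier Q)) (residue_ring (int p)) (ext_cocycle l')"
proof -
  define \<zeta> where "\<zeta> = (\<lambda>C. l C \<otimes>\<^bsub>U\<^esub> inv\<^bsub>U\<^esub> l' C)"
  have \<zeta>Z: "\<zeta> C \<in> Z" if "C \<in> carrier Q" for C
    unfolding \<zeta>_def
    by (rule mult_inv_mem_Z[OF sectionD(1)[OF l that that] sectionD(1)[OF l' that that]])
      (simp only: sectionD(2)[OF l that that] sectionD(2)[OF l' that that])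
  define z where "z = (\<lambda>C\<in>carrier Q. coord (\<zeta> C))"
  show ?thesis
  proof (rule Q.H2_class_eqI)
    show "z \<in> cochains1 Q (discrete_topology (carrier Q)) (residue_ring (int p))"
      using coord_mem[OF Z_carrier[OF \<zeta>Z]] by (auto simp: cochains1_def z_def)
    fix C D assume C: "C \<in> carrier Q" and D: "D \<in> carrier Q"
    have CD: "C \<otimes>\<^bsub>Q\<^esub> D \<in> carrier Q" using C D by (simp del: mult_FactGroup)
    let ?E = "C \<otimes>\<^bsub>Q\<^esub> D"
    let ?k = "l C \<otimes>\<^bsub>U\<^esub> l D \<otimes>\<^bsub>U\<^esub> inv\<^bsub>U\<^esub> l ?E" and ?k' = "l' C \<otimes>\<^bsub>U\<^esub> l' D \<otimes>\<^bsub>U\<^esub> inv\<^bsub>U\<^esub> l' ?E"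
    have lc: "l C \<in> carrier U" "l D \<in> carrier U" "l ?E \<in> carrier U"
      "l' C \<in> carrier U" "l' D \<in> carrier U" "l' ?E \<in> carrier U"
      using sectionD(1)[OF l] sectionD(1)[OF l'] C D CD by (auto simp del: mult_FactGroup)
    have k: "?k \<in> Z" "?k' \<in> Z" using sectionD(3)[OF l C D] sectionD(3)[OF l' C D] .
    have c1: "inv\<^bsub>U\<^esub> l' C \<otimes>\<^bsub>U\<^esub> \<zeta> D = \<zeta> D \<otimes>\<^bsub>U\<^esub> inv\<^bsub>U\<^esub> l' C"
      using W_central[OF Z_W[OF \<zeta>Z[OF D]]] lc by simp
    have "\<zeta> C \<otimes>\<^bsub>U\<^esub> \<zeta> D = l C \<otimes>\<^bsub>U\<^esub> (inv\<^bsub>U\<^esub> l' C \<otimes>\<^bsub>U\<^esub> \<zeta> D)"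
      using lc by (simp add: \<zeta>_def U.m_assoc)
    also have "\<dots> = l C \<otimes>\<^bsub>U\<^esub> l D \<otimes>\<^bsub>U\<^esub> (inv\<^bsub>U\<^esub> l' D \<otimes>\<^bsub>U\<^esub> inv\<^bsub>U\<^esub> l' C)"
      unfolding c1 using lc by (simp add: \<zeta>_def U.m_assoc)
    also have "\<dots> = ?k \<otimes>\<^bsub>U\<^esub> (l ?E \<otimes>\<^bsub>U\<^esub> inv\<^bsub>U\<^esub> l' ?E) \<otimes>\<^bsub>U\<^esub> inv\<^bsub>U\<^esub> ?k'"
      using lc by (simp add: U.m_assoc U.inv_mult_group)
    also have "\<dots> = ?k \<otimes>\<^bsub>U\<^esub> \<zeta> ?E \<otimes>\<^bsub>U\<^esub> inv\<^bsub>U\<^esub> ?k'"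
      by (simp only: \<zeta>_def)
    finally have "coord (\<zeta> C \<otimes>\<^bsub>U\<^esub> \<zeta> D) = coord (?k \<otimes>\<^bsub>U\<^esub> \<zeta> ?E \<otimes>\<^bsub>U\<^esub> inv\<^bsub>U\<^esub> ?k')" by simp
    also have "\<dots> = ((coord ?k + coord (\<zeta> ?E)) mod int p + (- coord ?k') mod int p) mod int p"
      by (simp only: coord_mult[OF Z_W[OF Z.m_closed[OF k(1) \<zeta>Z[OF CD]]] Z_W[OF Z.m_inv_closed[OF k(2)]]]
        coord_mult[OF Z_W[OF k(1)] Z_W[OF \<zeta>Z[OF CD]]] coord_inv[OF Z_W[OF k(2)]])
    also have "\<dots> = (coord ?k + coord (\<zeta> ?E) + - coord ?k') mod int p" by (rule mod_add_eq)
    also have "coord (\<zeta> C \<otimes>\<^bsub>U\<^esub> \<zeta> D) = (coord (\<zeta> C) + coord (\<zeta> D)) mod int p"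
      by (rule coord_mult[OF Z_W[OF \<zeta>Z[OF C]] Z_W[OF \<zeta>Z[OF D]]])
    finally have "(coord (\<zeta> C) + coord (\<zeta> D) - (coord (\<zeta> ?E) - coord ?k')) mod int p =
      (coord ?k + coord (\<zeta> ?E) + - coord ?k' - (coord (\<zeta> ?E) - coord ?k')) mod int p"
      by (rule mod_diff_cong) (rule refl)
    then have "(coord ?k) mod int p = (coord (\<zeta> C) + coord (\<zeta> D) - coord (\<zeta> ?E) + coord ?k') mod int p"
      by (simp add: algebra_simps)
    moreover have "coboundary1 Q (residue_ring (int p)) z (C, D) = (coord (\<zeta> C) + coord (\<zeta> D) - coord (\<zeta> ?E)) mod int p"
      using C D CD by (simp add: Q.coboundary1_eq z_def del: mult_FactGroup)
    ultimately show "ext_cocycle l (C, D) mod int p =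
        (coboundary1 Q (residue_ring (int p)) z (C, D) + ext_cocycle l' (C, D)) mod int p"
      by (simp only: sectionD(4)[OF l C D] sectionD(4)[OF l' C D] mod_add_left_eq)
  qed
qed

lemma gamma_class_eq:
  assumes l: "is_section l"
  shows "gamma_class p n s = H2_class Q (discrete_topology (carrier Q)) (residue_ring (int p)) (ext_cocycle l)"
  unfolding gamma_class_def Let_def UU_eq UU_lower_eq
proof (rule the_equality)
  show "\<exists>l'. (\<forall>C\<in>carrier Q. l' C \<in> carrier U \<and> Z #>\<^bsub>U\<^esub> l' C = C) \<and> l' \<one>\<^bsub>Q\<^esub> = \<one>\<^bsub>U\<^esub> \<and>
    H2_class Q (discrete_topology (carrier Q)) (residue_ring (int p)) (ext_cocycle l) =
    H2_class Q (discrete_topology (carrier Q)) (residue_ring (int p))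
      (\<lambda>(C, D)\<in>carrier Q \<times> carrier Q. center_coord p n s (l' C \<otimes>\<^bsub>U\<^esub> l' D \<otimes>\<^bsub>U\<^esub> inv\<^bsub>U\<^esub> l' (C \<otimes>\<^bsub>Q\<^esub> D)))"
    using l unfolding is_section_def ext_cocycle_def by blast
next
  fix \<gamma>
  assume "\<exists>l'. (\<forall>C\<in>carrier Q. l' C \<in> carrier U \<and> Z #>\<^bsub>U\<^esub> l' C = C) \<and> l' \<one>\<^bsub>Q\<^esub> = \<one>\<^bsub>U\<^esub> \<and>
    \<gamma> = H2_class Q (discrete_topology (carrier Q)) (residue_ring (int p))
      (\<lambda>(C, D)\<in>carrier Q \<times> carrier Q. center_coord p n s (l' C \<otimes>\<^bsub>U\<^esub> l' D \<otimes>\<^bsub>U\<^esub> inv\<^bsub>U\<^esub> l' (C \<otimes>\<^bsub>Q\<^esub> D)))"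
  then obtain l' where l': "is_section l'"
    "\<gamma> = H2_class Q (discrete_topology (carrier Q)) (residue_ring (int p)) (ext_cocycle l')"
    unfolding is_section_def ext_cocycle_def by blast
  then show "\<gamma> = H2_class Q (discrete_topology (carrier Q)) (residue_ring (int p)) (ext_cocycle l)"
    using ext_cocycle_class_unique[OF l l'(1)] by simp
qed

end

section \<open>Pairing with the classes alpha\<close>

text \<open>The pairing is computed for an arbitrary continuous representation
  \<open>\<phi>\<close>; the matrices of Magnus coefficients are a later instance.\<close>

locale unipotent_representation = profinite G T + E: unipotent_extension p n s
  for G :: "'a monoid" (structure) and T :: "'a topology" and p n s :: nat +
  fixes \<phi> :: "'a \<Rightarrow> nat \<times> nat \<Rightarrow> int"
  assumes n: "2 \<le> n" and \<phi>_hom: "\<phi> \<in> hom G E.U"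
    and \<phi>_cont: "continuous_map T (discrete_topology (carrier E.U)) \<phi>"
begin

abbreviation N :: "'a set" where "N \<equiv> lower_p_central G T p n"
abbreviation \<psi> :: "'a \<Rightarrow> (nat \<times> nat \<Rightarrow> int) set" where "\<psi> g \<equiv> E.Z #>\<^bsub>E.U\<^esub> \<phi> g"
abbreviation R :: "int ring" where "R \<equiv> residue_ring (int p)"

sublocale tq: topgroup_quotient G T "int p" R N
  by (intro topgroup_quotient.intro topgroup_residues.intro topgroup_axioms residues.intro
    normal_lower_p_central E.p_gt_one)

lemma \<phi>_closed: "g \<in> carrier G \<Longrightarrow> \<phi> g \<in> carrier E.U"
  using \<phi>_hom by (auto simp: hom_def)

lemma \<phi>_mult: "g \<in> carrier G \<Longrightarrow> h \<in> carrier G \<Longrightarrow> \<phi> (g \<otimes> h) = \<phi> g \<otimes>\<^bsub>E.U\<^esub> \<phi> h"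
  using \<phi>_hom by (auto simp: hom_def)

lemma \<phi>_N: "g \<in> N \<Longrightarrow> \<phi> g \<in> E.Z"
  by (rule hom_lower_p_central[OF topgroup_axioms E.topgroup \<phi>_hom \<phi>_cont])

lemma N_carrier: "g \<in> N \<Longrightarrow> g \<in> carrier G"
  using lower_p_central_subset_carrier by blast

lemma \<psi>_closed: "g \<in> carrier G \<Longrightarrow> \<psi> g \<in> carrier E.Q"
  unfolding carrier_FactGroup by (intro imageI \<phi>_closed)

lemma \<psi>_mult: "g \<in> carrier G \<Longrightarrow> h \<in> carrier G \<Longrightarrow> \<psi> (g \<otimes> h) = \<psi> g \<otimes>\<^bsub>E.Q\<^esub> \<psi> h"
  by (simp add: \<phi>_mult E.Z.rcos_sum \<phi>_closed)

lemma \<psi>_N: "g \<in> N \<Longrightarrow> \<psi> g = E.Z"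
  using E.Z.rcos_const[OF E.U.is_group \<phi>_N] .

lemma \<psi>_N_mult: 
  assumes "g \<in> N" "h \<in> carrier G"
  shows "\<psi> (g \<otimes> h) = \<psi> h"
proof -
  have "\<psi> (g \<otimes> h) = \<one>\<^bsub>E.Q\<^esub> \<otimes>\<^bsub>E.Q\<^esub> \<psi> h"
    using assms by (simp only: \<psi>_mult N_carrier \<psi>_N one_FactGroup)
  then show ?thesis using \<psi>_closed[OF assms(2)] by (simp only: E.Q.l_one)
qed

definition lift_cochain ::
  "((nat \<times> nat \<Rightarrow> int) set \<Rightarrow> nat \<times> nat \<Rightarrow> int) \<Rightarrow> 'a \<Rightarrow> int" where
  "lift_cochain l = (\<lambda>g\<in>carrier G. E.coord (l (\<psi> g) \<otimes>\<^bsub>E.U\<^esub> inv\<^bsub>E.U\<^esub> \<phi> g))"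

lemma lift_cochain_mem_Z:
  assumes "E.is_section l" "g \<in> carrier G"
  shows "l (\<psi> g) \<otimes>\<^bsub>E.U\<^esub> inv\<^bsub>E.U\<^esub> \<phi> g \<in> E.Z"
  by (rule E.mult_inv_mem_Z[OF E.sectionD(1)[OF assms(1) \<psi>_closed \<psi>_closed] \<phi>_closed
    E.sectionD(2)[OF assms(1) \<psi>_closed \<psi>_closed]]) (rule assms(2))+

lemma lift_cochain_cochain:
  assumes "E.is_section l"
  shows "lift_cochain l \<in> cochains1 G T R"
proof -
  have Rc: "E.coord (l (\<psi> g) \<otimes>\<^bsub>E.U\<^esub> inv\<^bsub>E.U\<^esub> \<phi> g) \<in> carrier R" if "g \<in> carrier G" for g
    by (rule E.coord_mem[OF E.Z_carrier[OF lift_cochain_mem_Z[OF assms that]]])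
  have "continuous_map (discrete_topology (carrier E.U)) (discrete_topology UNIV)
    (\<lambda>A. E.coord (l (E.Z #>\<^bsub>E.U\<^esub> A) \<otimes>\<^bsub>E.U\<^esub> inv\<^bsub>E.U\<^esub> A))" by simp
  from continuous_map_compose[OF \<phi>_cont this]
  have "continuous_map T (subtopology (discrete_topology UNIV) (carrier R))
    (\<lambda>g. E.coord (l (\<psi> g) \<otimes>\<^bsub>E.U\<^esub> inv\<^bsub>E.U\<^esub> \<phi> g))"
    unfolding o_def by (rule continuous_map_into_subtopology) (simp add: Pi_iff Rc)
  then have "continuous_map T (discrete_topology (carrier R)) (lift_cochain l)"
    by (simp only: subtopology_discrete_topology Int_UNIV_left)
      (rule continuous_map_eq, assumption, simp add: lift_cochain_def)
  moreover have "lift_cochain l \<in> carrier G \<rightarrow>\<^sub>E carrier R"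
    by (rule PiE_I) (simp_all add: lift_cochain_def Rc)
  ultimately show ?thesis unfolding cochains1_def by simp
qed

lemma coboundary1_lift_cochain:
  assumes l: "E.is_section l" and g: "g \<in> carrier G" and h: "h \<in> carrier G"
  shows "coboundary1 G R (lift_cochain l) (g, h) = E.ext_cocycle l (\<psi> g, \<psi> h)"
proof -
  let ?gh = "g \<otimes> h"
  let ?a = "l (\<psi> g)" and ?b = "l (\<psi> h)" and ?e = "l (\<psi> ?gh)"
  let ?K = "\<lambda>g. l (\<psi> g) \<otimes>\<^bsub>E.U\<^esub> inv\<^bsub>E.U\<^esub> \<phi> g"
  have gh: "?gh \<in> carrier G" using g h by simp
  have c: "?a \<in> carrier E.U" "?b \<in> carrier E.U" "?e \<in> carrier E.U" "\<phi> g \<in> carrier E.U" "\<phi> h \<in> carrier E.U"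
    using E.sectionD(1)[OF l \<psi>_closed \<psi>_closed] \<phi>_closed g h gh by auto
  have K: "?K g \<in> E.W n" "?K h \<in> E.W n" "?K ?gh \<in> E.W n"
    using E.Z_W[OF lift_cochain_mem_Z[OF l]] g h gh by auto
  let ?k = "?a \<otimes>\<^bsub>E.U\<^esub> ?b \<otimes>\<^bsub>E.U\<^esub> inv\<^bsub>E.U\<^esub> ?e"
  have k: "?k \<in> E.W n" "E.ext_cocycle l (\<psi> g, \<psi> h) = E.coord ?k"
    using E.Z_W[OF E.sectionD(3)[OF l \<psi>_closed[OF g] \<psi>_closed[OF h]]]
      E.sectionD(4)[OF l \<psi>_closed[OF g] \<psi>_closed[OF h]] by (simp_all only: \<psi>_mult[OF g h])
  \<comment> \<open>The section value at the product cancels. Afterwards centrality moves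
    \<open>?K h\<close> past the inverse of \<open>\<phi> g\<close>, which completes
    \<open>?K g\<close>.\<close>
  have "?k \<otimes>\<^bsub>E.U\<^esub> ?K ?gh = ?a \<otimes>\<^bsub>E.U\<^esub> (?K h \<otimes>\<^bsub>E.U\<^esub> inv\<^bsub>E.U\<^esub> \<phi> g)"
    using c by (simp add: \<phi>_mult[OF g h] E.U.m_assoc E.U.inv_mult_group)
  also have "?K h \<otimes>\<^bsub>E.U\<^esub> inv\<^bsub>E.U\<^esub> \<phi> g = inv\<^bsub>E.U\<^esub> \<phi> g \<otimes>\<^bsub>E.U\<^esub> ?K h"
    using E.W_central[OF K(2)] c by simp
  also have "?a \<otimes>\<^bsub>E.U\<^esub> (inv\<^bsub>E.U\<^esub> \<phi> g \<otimes>\<^bsub>E.U\<^esub> ?K h) = ?K g \<otimes>\<^bsub>E.U\<^esub> ?K h"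
    using c by (simp add: E.U.m_assoc)
  finally have eq: "?k \<otimes>\<^bsub>E.U\<^esub> ?K ?gh = ?K g \<otimes>\<^bsub>E.U\<^esub> ?K h" .
  have "(E.coord ?k + E.coord (?K ?gh)) mod int p = (E.coord (?K g) + E.coord (?K h)) mod int p"
    using arg_cong[OF eq, of E.coord] by (simp only: E.coord_mult[OF k(1) K(3)] E.coord_mult[OF K(1,2)])
  from mod_diff_cong[OF this[symmetric] refl, of "E.coord (?K ?gh)"]
  have "(E.coord (?K g) + E.coord (?K h) - E.coord (?K ?gh)) mod int p = E.coord ?k mod int p" by simp
  moreover have "E.coord ?k mod int p = E.coord ?k"
    using E.coord_mem[OF E.W_carrier[OF k(1)]] by simp
  ultimately show ?thesis
    using g h gh by (simp add: tq.coboundary1_eq lift_cochain_def k(2))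
qed

lemma lift_cochain_N:
  assumes "E.is_section l" "g \<in> N"
  shows "lift_cochain l g = (- E.coord (\<phi> g)) mod int p"
proof -
  \<comment> \<open>Normalization of the section: on \<open>N\<close> only the inverse of
    \<open>\<phi> g\<close> is left, which is the origin of the sign.\<close>
  have "l (\<psi> g) = \<one>\<^bsub>E.U\<^esub>" using assms by (simp add: \<psi>_N E.is_section_def)
  then have "lift_cochain l g = E.coord (inv\<^bsub>E.U\<^esub> \<phi> g)"
    using assms(2) E.Z_carrier[OF \<phi>_N] by (simp add: lift_cochain_def N_carrier)
  then show ?thesis using E.coord_inv[OF E.Z_W[OF \<phi>_N[OF assms(2)]]] by simp
qed

text \<open>\<open>coord\<close> is additive on \<open>W n\<close>, and \<open>\<phi>\<close> maps
  \<open>N\<close> to central matrices, so conjugation leaves the value unchanged.\<close>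

lemma lift_cochain_H1_invariants:
  assumes l: "E.is_section l"
  shows "restrict (lift_cochain l) N \<in> H1_invariants G T N R"
proof -
  have N: "subgroup N G" by (rule subgroup_lower_p_central)
  have "lift_cochain l (g \<otimes> h) = (lift_cochain l g + lift_cochain l h) mod int p"
    if g: "g \<in> N" and h: "h \<in> N" for g h
  proof -
    have "E.coord (\<phi> (g \<otimes> h)) = (E.coord (\<phi> g) + E.coord (\<phi> h)) mod int p"
      using E.coord_mult[OF E.Z_W[OF \<phi>_N[OF g]] E.Z_W[OF \<phi>_N[OF h]]] g h by (simp add: \<phi>_mult N_carrier)
    then have "lift_cochain l (g \<otimes> h) = (- ((E.coord (\<phi> g) + E.coord (\<phi> h)) mod int p)) mod int p"
      using lift_cochain_N[OF l subgroup.m_closed[OF N g h]] by simp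
    also have "\<dots> = (- (E.coord (\<phi> g) + E.coord (\<phi> h))) mod int p" by (rule mod_minus_eq)
    also have "\<dots> = (- E.coord (\<phi> g) + - E.coord (\<phi> h)) mod int p" by simp
    finally show ?thesis by (simp only: lift_cochain_N[OF l g] lift_cochain_N[OF l h] mod_add_eq)
  qed
  moreover have "lift_cochain l (inv g \<otimes> h \<otimes> g) = lift_cochain l h" "inv g \<otimes> h \<otimes> g \<in> N"
    if g: "g \<in> carrier G" and h: "h \<in> N" for g h
  proof -
    have hc: "h \<in> carrier G" using h by (rule N_carrier)
    show ghg: "inv g \<otimes> h \<otimes> g \<in> N" using tq.inv_op_closed1 g h by blast
    have "\<phi> (inv g \<otimes> h \<otimes> g) = \<phi> (inv g) \<otimes>\<^bsub>E.U\<^esub> (\<phi> h \<otimes>\<^bsub>E.U\<^esub> \<phi> g)"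
      using g hc by (simp add: \<phi>_mult E.U.m_assoc \<phi>_closed)
    also have "\<phi> h \<otimes>\<^bsub>E.U\<^esub> \<phi> g = \<phi> g \<otimes>\<^bsub>E.U\<^esub> \<phi> h"
      by (rule E.W_central[OF E.Z_W[OF \<phi>_N[OF h]] \<phi>_closed[OF g]])
    also have "\<phi> (inv g) \<otimes>\<^bsub>E.U\<^esub> (\<phi> g \<otimes>\<^bsub>E.U\<^esub> \<phi> h) = \<phi> (inv g \<otimes> (g \<otimes> h))"
      using g hc by (simp only: \<phi>_mult inv_closed monoid.m_closed[OF is_monoid])
    also have "inv g \<otimes> (g \<otimes> h) = h" using g hc by simp
    finally show "lift_cochain l (inv g \<otimes> h \<otimes> g) = lift_cochain l h"
      using lift_cochain_N[OF l ghg] lift_cochain_N[OF l h] by simp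
  qed
  moreover have "continuous_map (subtopology T N) (discrete_topology (carrier R)) (restrict (lift_cochain l) N)"
  proof (rule continuous_map_eq)
    show "continuous_map (subtopology T N) (discrete_topology (carrier R)) (lift_cochain l)"
      using lift_cochain_cochain[OF l] by (simp add: cochains1_def continuous_map_from_subtopology)
  qed simp
  moreover have "lift_cochain l g \<in> carrier R" if "g \<in> N" for g
    using tq.cochains1_carrier[OF lift_cochain_cochain[OF l] N_carrier[OF that]] .
  moreover have "g \<otimes> h \<in> N" if "g \<in> N" "h \<in> N" for g h
    using subgroup.m_closed[OF N] that .
  ultimately show ?thesis
    unfolding H1_invariants_def hom_def by (simp add: E.Q.res.res_add_eq Pi_iff)
qed

text \<open>\<open>H2_pullback\<close> is a \<open>the_elem\<close> over all representatives, so
  every one of them must pull back into the same class: a coboundary of \<open>b\<close> pulls back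
  to the coboundary of \<open>b\<close> composed with \<open>\<beta>\<close>.\<close>

lemma H2_pullback_gamma:
  assumes l: "E.is_section l"
    and \<beta>: "\<And>g. g \<in> carrier G \<Longrightarrow> \<beta> (N #> g) = \<psi> g"
    and c: "\<And>g h. g \<in> carrier G \<Longrightarrow> h \<in> carrier G \<Longrightarrow> c (N #> g, N #> h) = E.ext_cocycle l (\<psi> g, \<psi> h)"
  shows "H2_pullback tq.Q tq.TQ R \<beta> (gamma_class p n s) = H2_class tq.Q tq.TQ R c"
proof -
  interpret TQ: topgroup_residues tq.Q tq.TQ "int p" R
    by (rule tq.topgroup_residues_quotient) (rule reflexive)
  let ?pull = "\<lambda>c. \<lambda>(g, h)\<in>carrier tq.Q \<times> carrier tq.Q. c (\<beta> g, \<beta> h)"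
  have *: "H2_class tq.Q tq.TQ R (?pull f) = H2_class tq.Q tq.TQ R c" if f: "f \<in> gamma_class p n s" for f
  proof -
    obtain b where b: "b \<in> cochains1 E.Q (discrete_topology (carrier E.Q)) R"
      and fb: "f = (\<lambda>x\<in>carrier E.Q \<times> carrier E.Q. (coboundary1 E.Q R b x + E.ext_cocycle l x) mod int p)"
      using f unfolding E.gamma_class_eq[OF l] E.Q.mem_H2_class_iff by blast
    define b' where "b' = (\<lambda>C\<in>carrier tq.Q. b (\<beta> C))"
    have b'_eq: "b' (N #> x) = b (\<psi> x)" if "x \<in> carrier G" for x
      using that by (simp add: b'_def \<beta> carrier_FactGroup)
    show ?thesis
    proof (rule TQ.H2_class_eqI)
      show "b' \<in> cochains1 tq.Q tq.TQ R"
      proof -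
        have "continuous_map (discrete_topology (carrier E.U)) (discrete_topology (carrier E.Q)) (\<lambda>A. E.Z #>\<^bsub>E.U\<^esub> A)"
          by (auto simp: carrier_FactGroup)
        moreover have "continuous_map (discrete_topology (carrier E.Q)) (discrete_topology (carrier R)) b"
          using b by (simp add: cochains1_def)
        ultimately have "continuous_map T (discrete_topology (carrier R)) (b \<circ> ((\<lambda>A. E.Z #>\<^bsub>E.U\<^esub> A) \<circ> \<phi>))"
          by (intro continuous_map_compose[OF continuous_map_compose[OF \<phi>_cont]])
        then have "continuous_map T (discrete_topology (carrier R)) (b' \<circ> (\<lambda>g. N #> g))"
          by (rule continuous_map_eq) (simp add: b'_eq)
        then have "continuous_map tq.TQ (discrete_topology (carrier R)) b'"
          by (simp only: continuous_compose_quotient_map_eq[OF tq.quotient_map_rcoset])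
        moreover have "b' \<in> carrier tq.Q \<rightarrow>\<^sub>E carrier R"
        proof
          fix C assume C: "C \<in> carrier tq.Q"
          then obtain g where "g \<in> carrier G" "C = N #> g" by (auto simp: carrier_FactGroup)
          then show "b' C \<in> carrier R"
            using E.Q.cochains1_carrier[OF b \<psi>_closed] C by (simp add: b'_def \<beta>)
        qed (simp add: b'_def)
        ultimately show ?thesis unfolding cochains1_def by simp
      qed
      fix C D assume C: "C \<in> carrier tq.Q" and D: "D \<in> carrier tq.Q"
      then obtain g h where g: "g \<in> carrier G" "C = N #> g" and h: "h \<in> carrier G" "D = N #> h"
        by (auto simp: carrier_FactGroup)
      have CD: "C \<otimes>\<^bsub>tq.Q\<^esub> D \<in> carrier tq.Q" "C \<otimes>\<^bsub>tq.Q\<^esub> D = N #> (g \<otimes> h)"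
        using TQ.m_closed[OF C D] g h by (simp_all add: tq.rcos_sum)
      have gh: "g \<otimes> h \<in> carrier G" using g h by simp
      have "coboundary1 tq.Q R b' (C, D) = (b' C + b' D - b' (C \<otimes>\<^bsub>tq.Q\<^esub> D)) mod int p"
        by (rule TQ.coboundary1_eq[OF C D])
      also have "\<dots> = (b (\<psi> g) + b (\<psi> h) - b (\<psi> (g \<otimes> h))) mod int p"
        unfolding CD(2) unfolding g(2) h(2) by (simp only: b'_eq g(1) h(1) gh)
      also have "\<dots> = coboundary1 E.Q R b (\<psi> g, \<psi> h)"
        by (simp only: E.Q.coboundary1_eq \<psi>_closed g h \<psi>_mult)
      finally have "?pull f (C, D) mod int p = (coboundary1 tq.Q R b' (C, D) + E.ext_cocycle l (\<psi> g, \<psi> h)) mod int p"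
        using C D g h \<psi>_closed by (simp add: fb \<beta>)
      then show "?pull f (C, D) mod int p = (coboundary1 tq.Q R b' (C, D) + c (C, D)) mod int p"
        using g h by (simp only: c)
    qed
  qed
  have "gamma_class p n s \<noteq> {}"
    unfolding E.gamma_class_eq[OF l] by (rule E.Q.H2_class_nonempty)
  then obtain f0 where f0: "f0 \<in> gamma_class p n s" by blast
  define F where "F = (\<lambda>f. H2_class tq.Q tq.TQ R (?pull f))"
  have F: "F f = H2_class tq.Q tq.TQ R c" if "f \<in> gamma_class p n s" for f
    unfolding F_def by (rule *[OF that])
  have "F ` gamma_class p n s = {H2_class tq.Q tq.TQ R c}"
  proof (intro equalityI image_subsetI)
    fix f assume "f \<in> gamma_class p n s"
    then show "F f \<in> {H2_class tq.Q tq.TQ R c}" by (simp only: F insertI1)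
  next
    show "{H2_class tq.Q tq.TQ R c} \<subseteq> F ` gamma_class p n s"
      using imageI[OF f0, of F] unfolding F[OF f0] by (simp only: insert_subset empty_subsetI simp_thms)
  qed
  then show ?thesis unfolding H2_pullback_def F_def by (simp only: the_elem_eq)
qed

text \<open>Two signs cancel: the one in the definition of the pairing and the one from
  \<open>lift_cochain_N\<close>.\<close>

theorem trg_pairing_H2_pullback:
  assumes \<beta>: "\<And>g. g \<in> carrier G \<Longrightarrow> \<beta> (N #> g) = \<psi> g" and \<sigma>: "\<sigma> \<in> N"
  shows "trg_pairing G T p n \<sigma> (H2_pullback tq.Q tq.TQ R \<beta> (gamma_class p n s)) = E.coord (\<phi> \<sigma>)"
proof -
  obtain l where l: "E.is_section l" using E.section_exists by blast
  let ?y = "lift_cochain l"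
  have y: "?y \<in> cochains1 G T R" by (rule lift_cochain_cochain[OF l])
  have "coboundary1 G R ?y (k \<otimes> g, h) = coboundary1 G R ?y (g, h)"
    "coboundary1 G R ?y (g, k \<otimes> h) = coboundary1 G R ?y (g, h)"
    if "k \<in> N" "g \<in> carrier G" "h \<in> carrier G" for k g h
  proof -
    have kg: "k \<otimes> g \<in> carrier G" "k \<otimes> h \<in> carrier G" using that N_carrier by simp_all
    show "coboundary1 G R ?y (k \<otimes> g, h) = coboundary1 G R ?y (g, h)"
      "coboundary1 G R ?y (g, k \<otimes> h) = coboundary1 G R ?y (g, h)"
      using that kg by (simp_all only: coboundary1_lift_cochain[OF l] \<psi>_N_mult)
  qed
  then obtain c where c: "c \<in> carrier (cocycles2 tq.Q tq.TQ R)"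
    "\<And>g h. g \<in> carrier G \<Longrightarrow> h \<in> carrier G \<Longrightarrow> c (N #> g, N #> h) = coboundary1 G R ?y (g, h)"
    using tq.cocycles2_descend[OF y] by blast
  have tr: "tq.transgresses (restrict ?y N) ?y c"
    using y c by (simp add: tq.transgresses_def)
  have "H2_pullback tq.Q tq.TQ R \<beta> (gamma_class p n s) = H2_class tq.Q tq.TQ R c"
    by (rule H2_pullback_gamma[OF l \<beta>]) (simp_all add: c(2) coboundary1_lift_cochain[OF l])
  then have "trg_pairing G T p n \<sigma> (H2_pullback tq.Q tq.TQ R \<beta> (gamma_class p n s)) = (- ?y \<sigma>) mod int p"
    using trg_pairing_eq[OF E.p n tr lift_cochain_H1_invariants[OF l] \<sigma>] \<sigma> by simp
  also have "\<dots> = E.coord (\<phi> \<sigma>) mod int p"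
    by (simp add: lift_cochain_N[OF l \<sigma>] mod_minus_eq)
  also have "\<dots> = E.coord (\<phi> \<sigma>)"
    using E.coord_mem[OF E.Z_carrier[OF \<phi>_N[OF \<sigma>]]] by simp
  finally show ?thesis .
qed

end


section \<open>Units of compact monoids\<close>

text \<open>The graph \<open>K\<close> of inversion is closed in the square, and projection along a
  compact factor is a closed map. So the units, which are the image of the graph, form a closed set;
  the same projection shows that inversion pulls closed sets back to closed sets.\<close>

lemma
  fixes M :: "('a, 'b) monoid_scheme"
  assumes "monoid M" and top: "topspace C = carrier M" and comp: "compact_space C" and haus: "Hausdorff_space C"
    and mult: "continuous_map (prod_topology C C) C (\<lambda>z. fst z \<otimes>\<^bsub>M\<^esub> snd z)"
  shows compact_monoid_closedin_Units: "closedin C (Units M)"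
    and compact_monoid_topgroup_units: "topgroup (units_of M) (subtopology C (Units M))"
proof -
  interpret monoid M by fact
  let ?P = "prod_topology C C"
  define K where "K = {z \<in> topspace ?P. fst z \<otimes>\<^bsub>M\<^esub> snd z = \<one>\<^bsub>M\<^esub> \<and> snd z \<otimes>\<^bsub>M\<^esub> fst z = \<one>\<^bsub>M\<^esub>}"
  have one: "closedin C {\<one>\<^bsub>M\<^esub>}"
    by (rule closedin_Hausdorff_singleton[OF haus]) (simp add: top)
  have swap: "continuous_map ?P ?P (\<lambda>z. (snd z, fst z))"
    by (intro continuous_map_pairedI continuous_map_fst continuous_map_snd)
  have "continuous_map ?P C (\<lambda>z. snd z \<otimes>\<^bsub>M\<^esub> fst z)"
    using continuous_map_compose[OF swap mult] by (simp add: o_def)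
  then have cl2: "closedin ?P ({z \<in> topspace ?P. fst z \<otimes>\<^bsub>M\<^esub> snd z \<in> {\<one>\<^bsub>M\<^esub>}} \<inter> {z \<in> topspace ?P. snd z \<otimes>\<^bsub>M\<^esub> fst z \<in> {\<one>\<^bsub>M\<^esub>}})"
    using mult one by (intro closedin_Int closedin_continuous_map_preimage)
  have "K = {z \<in> topspace ?P. fst z \<otimes>\<^bsub>M\<^esub> snd z \<in> {\<one>\<^bsub>M\<^esub>}} \<inter> {z \<in> topspace ?P. snd z \<otimes>\<^bsub>M\<^esub> fst z \<in> {\<one>\<^bsub>M\<^esub>}}"
    unfolding K_def by blast
  with cl2 have K: "closedin ?P K" by (simp only:)
  have cl: "closed_map ?P C fst"
    using comp by (intro Abstract_Topological_Spaces.closed_map_fst)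
  have mem: "u \<in> Units M \<and> inv\<^bsub>M\<^esub> u = v" if "(u, v) \<in> K" for u v
    using that inv_char[of u v] unfolding K_def by (auto simp: top Units_def)
  have mem': "(u, inv\<^bsub>M\<^esub> u) \<in> K" if "u \<in> Units M" for u
    using that unfolding K_def by (simp add: top Units_closed)
  have eq: "fst ` K = Units M"
  proof (intro equalityI subsetI)
    fix u assume "u \<in> Units M"
    then show "u \<in> fst ` K" using mem' by (intro image_eqI[of _ _ "(u, inv\<^bsub>M\<^esub> u)"]) simp_all
  next
    fix u assume "u \<in> fst ` K"
    then obtain v where "(u, v) \<in> K" by auto
    then show "u \<in> Units M" using mem by blast
  qed
  have "closedin C (fst ` K)" using cl K unfolding closed_map_def by blast
  then show closed: "closedin C (Units M)" by (simp only: eq)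
  let ?T = "subtopology C (Units M)"
  have topT: "topspace ?T = Units M" by (auto simp: top)
  interpret U: group "units_of M" by (rule units_group)
  have inv: "inv\<^bsub>units_of M\<^esub> u = inv\<^bsub>M\<^esub> u" if "u \<in> Units M" for u
    by (rule units_of_inv[OF that])
  have "continuous_map ?T C (\<lambda>u. inv\<^bsub>units_of M\<^esub> u)"
    unfolding continuous_map_closedin
  proof (intro conjI allI impI)
    show "(\<lambda>u. inv\<^bsub>units_of M\<^esub> u) \<in> topspace ?T \<rightarrow> topspace C"
      unfolding topT by (simp add: inv top)
    fix D assume D: "closedin C D"
    have "closedin ?P (K \<inter> {z \<in> topspace ?P. snd z \<in> D})"
      by (intro closedin_Int K closedin_continuous_map_preimage[OF continuous_map_snd D])
    then have "closedin C (fst ` (K \<inter> {z \<in> topspace ?P. snd z \<in> D}))"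
      using cl unfolding closed_map_def by blast
    also have "fst ` (K \<inter> {z \<in> topspace ?P. snd z \<in> D}) = {u \<in> Units M. inv\<^bsub>units_of M\<^esub> u \<in> D}"
    proof (intro equalityI subsetI)
      fix u assume "u \<in> {u \<in> Units M. inv\<^bsub>units_of M\<^esub> u \<in> D}"
      then have "u \<in> Units M" "inv\<^bsub>M\<^esub> u \<in> D" using inv by auto
      then show "u \<in> fst ` (K \<inter> {z \<in> topspace ?P. snd z \<in> D})"
        using mem'[of u] by (intro image_eqI[of _ _ "(u, inv\<^bsub>M\<^esub> u)"]) (simp_all add: inv top Units_closed)
    next
      fix u assume "u \<in> fst ` (K \<inter> {z \<in> topspace ?P. snd z \<in> D})"
      then obtain v where "(u, v) \<in> K" "v \<in> D" by auto
      then show "u \<in> {u \<in> Units M. inv\<^bsub>units_of M\<^esub> u \<in> D}" using mem[of u v] inv[of u] by auto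
    qed
    finally show "closedin ?T {u \<in> topspace ?T. inv\<^bsub>units_of M\<^esub> u \<in> D}"
      unfolding topT by (rule closedin_subset_topspace) auto
  qed
  then have i: "continuous_map ?T ?T (\<lambda>u. inv\<^bsub>units_of M\<^esub> u)"
    by (rule continuous_map_into_subtopology) (simp add: topT inv)
  have "continuous_map (subtopology ?P (Units M \<times> Units M)) C (\<lambda>z. fst z \<otimes>\<^bsub>M\<^esub> snd z)"
    using mult by (rule continuous_map_from_subtopology)
  then have "continuous_map (prod_topology ?T ?T) ?T (\<lambda>z. fst z \<otimes>\<^bsub>M\<^esub> snd z)"
    unfolding subtopology_Times[symmetric]
    by (rule continuous_map_into_subtopology) (auto simp: topT top)
  then have "continuous_map (prod_topology ?T ?T) ?T (\<lambda>(g, h). g \<otimes>\<^bsub>units_of M\<^esub> h)"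
    by (simp add: case_prod_unfold units_of_mult)
  with i show "topgroup (units_of M) ?T"
    unfolding topgroup_def topological_group_def topT by (simp add: U.is_group units_of_carrier)
qed


section \<open>Non-commuting power series\<close>

text \<open>The product of series with integer coefficients; reduction modulo \<open>m\<close> is
  postponed, so that the algebraic identities are proved over the integers.\<close>

definition conv :: "('x list \<Rightarrow> int) \<Rightarrow> ('x list \<Rightarrow> int) \<Rightarrow> 'x list \<Rightarrow> int" where
  "conv f g w = (\<Sum>i\<le>length w. f (take i w) * g (drop i w))"

lemma conv_Nil [simp]: "conv f g [] = f [] * g []"
  by (simp add: conv_def)

lemma conv_Cons [simp]: "conv f g (x # w) = f [] * g (x # w) + conv (\<lambda>u. f (x # u)) g w"
  by (simp add: conv_def sum.atMost_Suc_shift del: sum.atMost_Suc)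

lemma conv_linear: "conv (\<lambda>u. a * f u + g u) h w = a * conv f h w + conv g h w"
  by (simp add: conv_def sum.distrib sum_distrib_left algebra_simps)

text \<open>Peeling off the first letter replaces \<open>f\<close> by its left derivative
  \<open>\<lambda>u. f (x # u)\<close>; hence the induction with \<open>f\<close> arbitrary.\<close>

lemma conv_assoc: "conv (conv f g) h w = conv f (conv g h) w"
proof (induction w arbitrary: f)
  case (Cons x w)
  have "conv (\<lambda>u. conv f g (x # u)) h w = conv (\<lambda>u. f [] * g (x # u) + conv (\<lambda>u. f (x # u)) g u) h w"
    by simp
  also have "\<dots> = f [] * conv (\<lambda>u. g (x # u)) h w + conv (\<lambda>u. f (x # u)) (conv g h) w"
    by (simp only: conv_linear Cons.IH)
  finally show ?case by (simp add: algebra_simps)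
qed simp

lemma conv_zero_left: "conv (\<lambda>u. 0) g w = 0"
  by (simp add: conv_def)

lemma conv_one_left: "conv (\<lambda>w. if w = [] then 1 else 0) g w = g w"
  by (cases w) (simp_all add: conv_zero_left)

lemma conv_one_right: "conv f (\<lambda>w. if w = [] then 1 else 0) w = f w"
  by (induction w arbitrary: f) simp_all

text \<open>Transfers identities of integer convolution to series over Z/m, whose coefficients are
  reduced and are meaningful only at words in \<open>X\<close>.\<close>

lemma conv_cong_mod:
  assumes "w \<in> lists X"
    and "\<And>u. u \<in> lists X \<Longrightarrow> f u mod m = f' u mod m" "\<And>u. u \<in> lists X \<Longrightarrow> g u mod m = g' u mod m"
  shows "conv f g w mod m = conv f' g' w mod (m :: int)"
proof -
  have "take i w \<in> lists X" "drop i w \<in> lists X" for i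
    using assms(1) by (auto simp: lists_eq_set dest: in_set_takeD in_set_dropD)
  then have *: "(f (take i w) * g (drop i w)) mod m = (f' (take i w) * g' (drop i w)) mod m" for i
    by (intro mod_mult_cong assms(2,3))
  have "conv f g w mod m = (\<Sum>i\<le>length w. (f (take i w) * g (drop i w)) mod m) mod m"
    unfolding conv_def by (rule mod_sum_eq[symmetric])
  also have "\<dots> = conv f' g' w mod m" unfolding conv_def * by (rule mod_sum_eq)
  finally show ?thesis .
qed

lemma conv_inner:
  assumes "f [] = 1" "g [] = 1" "w \<noteq> []"
  shows "conv f g w = f w + g w + (\<Sum>i\<in>{0<..<length w}. f (take i w) * g (drop i w))"
proof -
  have "{..length w} = insert 0 (insert (length w) {0<..<length w})" by auto
  then show ?thesis using assms by (simp add: conv_def)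
qed

text \<open>The inverse of the series \<open>1 + x\<close>: coefficient \<open>(-1) ^ k\<close> at
  the \<open>k\<close>-th power of \<open>x\<close>, and 0 at all other words.\<close>

primrec geometric :: "'x \<Rightarrow> 'x list \<Rightarrow> int" where
  "geometric x [] = 1"
| "geometric x (y # w) = (if y = x then - geometric x w else 0)"

abbreviation one_plus :: "'x \<Rightarrow> 'x list \<Rightarrow> int" where
  "one_plus x w \<equiv> (if w = [] then 1 else 0) + (if w = [x] then 1 else 0)"

lemma conv_scale: "conv (\<lambda>u. a * f u) h w = a * conv f h w"
  by (simp add: conv_def sum_distrib_left algebra_simps)

lemma conv_one_plus_geometric: "conv (one_plus x) (geometric x) w = (if w = [] then 1 else 0)"
proof (cases w)
  case (Cons y v)
  have "conv (\<lambda>u. one_plus x (y # u)) (geometric x) v =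
      conv (\<lambda>u. (if y = x then 1 else 0) * (if u = [] then 1 else 0)) (geometric x) v"
    by (rule arg_cong[of _ _ "\<lambda>f. conv f (geometric x) v"]) auto
  then show ?thesis using Cons by (simp add: conv_scale[of "if y = x then 1 else 0"] conv_one_left)
qed simp

lemma conv_geometric_one_plus: "conv (geometric x) (one_plus x) w = (if w = [] then 1 else 0)"
proof (induction w)
  case (Cons y w)
  have "conv (\<lambda>u. geometric x (y # u)) (one_plus x) w = conv (\<lambda>u. (if y = x then -1 else 0) * geometric x u) (one_plus x) w"
    by (rule arg_cong[of _ _ "\<lambda>f. conv f (one_plus x) w"]) auto
  also have "\<dots> = (if y = x then -1 else 0) * conv (geometric x) (one_plus x) w" by (rule conv_scale)
  finally show ?case using Cons by simp
qed simp

section \<open>The compact monoid of series over Z/m and its units\<close>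

locale magnus_series = res: residues m R for m :: int and R :: "int ring" +
  fixes X :: "'a set"
begin

abbreviation M :: "('a list \<Rightarrow> int) ring" where "M \<equiv> nc_power_series R X"
abbreviation C :: "('a list \<Rightarrow> int) topology" where
  "C \<equiv> product_topology (\<lambda>_. discrete_topology (carrier R)) (lists X)"

lemma M_carrier: "carrier M = lists X \<rightarrow>\<^sub>E carrier R"
  by (simp add: nc_power_series_def)

lemma M_mult: "w \<in> lists X \<Longrightarrow> (f \<otimes>\<^bsub>M\<^esub> g) w = conv f g w mod m"
  by (simp add: nc_power_series_def res.res_mult_eq res.sum_cong conv_def)

lemma M_mult_undefined: "w \<notin> lists X \<Longrightarrow> (f \<otimes>\<^bsub>M\<^esub> g) w = undefined"
  by (simp add: nc_power_series_def)

lemma M_one: "\<one>\<^bsub>M\<^esub> = (\<lambda>w\<in>lists X. if w = [] then 1 else 0)"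
  by (rule ext) (simp add: nc_power_series_def res.res_one_eq res.res_zero_eq)

lemma M_coeff: "f \<in> carrier M \<Longrightarrow> w \<in> lists X \<Longrightarrow> f w mod m = f w"
  unfolding M_carrier by (rule res.mod_carrier_eq, rule PiE_mem)

lemma M_eqI:
  assumes "f \<in> carrier M" "g \<in> carrier M" "\<And>w. w \<in> lists X \<Longrightarrow> f w mod m = g w mod m"
  shows "f = g"
proof (rule PiE_ext)
  show "f \<in> lists X \<rightarrow>\<^sub>E carrier R" "g \<in> lists X \<rightarrow>\<^sub>E carrier R" using assms(1,2) by (simp_all only: M_carrier)
  fix w assume w: "w \<in> lists X"
  show "f w = g w" using assms(3)[OF w] by (simp only: M_coeff[OF assms(1) w] M_coeff[OF assms(2) w])
qed

lemma restrict_mod_mem: "(\<lambda>w\<in>lists X. f w mod m) \<in> carrier M"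
  unfolding M_carrier by (rule PiE_I) simp_all

lemma M_mult_closed: "f \<otimes>\<^bsub>M\<^esub> g \<in> carrier M"
  unfolding M_carrier by (rule PiE_I) (simp_all add: M_mult M_mult_undefined)

lemma M_one_closed: "\<one>\<^bsub>M\<^esub> \<in> carrier M"
  unfolding M_carrier M_one using res.m_gt_one by (intro PiE_I) (simp_all add: res.res_carrier_eq)

lemma monoid_M: "monoid M"
proof (rule monoidI)
  fix f g h assume "f \<in> carrier M" "g \<in> carrier M" "h \<in> carrier M"
  show "f \<otimes>\<^bsub>M\<^esub> g \<otimes>\<^bsub>M\<^esub> h = f \<otimes>\<^bsub>M\<^esub> (g \<otimes>\<^bsub>M\<^esub> h)"
  proof (rule M_eqI)
    fix w assume w: "w \<in> lists X"
    have "conv (f \<otimes>\<^bsub>M\<^esub> g) h w mod m = conv (conv f g) h w mod m"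
      by (rule conv_cong_mod[OF w]) (simp_all add: M_mult)
    also have "\<dots> = conv f (conv g h) w mod m" by (simp only: conv_assoc)
    also have "\<dots> = conv f (g \<otimes>\<^bsub>M\<^esub> h) w mod m"
      by (rule conv_cong_mod[OF w]) (simp_all add: M_mult)
    finally show "(f \<otimes>\<^bsub>M\<^esub> g \<otimes>\<^bsub>M\<^esub> h) w mod m = (f \<otimes>\<^bsub>M\<^esub> (g \<otimes>\<^bsub>M\<^esub> h)) w mod m"
      using w by (simp add: M_mult)
  qed (rule M_mult_closed)+
next
  fix f assume f: "f \<in> carrier M"
  have conv_one: "conv \<one>\<^bsub>M\<^esub> f w mod m = f w mod m" "conv f \<one>\<^bsub>M\<^esub> w mod m = f w mod m" if w: "w \<in> lists X" for w
  proof -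
    have "conv \<one>\<^bsub>M\<^esub> f w mod m = conv (\<lambda>w. if w = [] then 1 else 0) f w mod m"
      by (rule conv_cong_mod[OF w]) (simp_all add: M_one)
    then show "conv \<one>\<^bsub>M\<^esub> f w mod m = f w mod m" by (simp only: conv_one_left)
    have "conv f \<one>\<^bsub>M\<^esub> w mod m = conv f (\<lambda>w. if w = [] then 1 else 0) w mod m"
      by (rule conv_cong_mod[OF w]) (simp_all add: M_one)
    then show "conv f \<one>\<^bsub>M\<^esub> w mod m = f w mod m" by (simp only: conv_one_right)
  qed
  show "\<one>\<^bsub>M\<^esub> \<otimes>\<^bsub>M\<^esub> f = f" "f \<otimes>\<^bsub>M\<^esub> \<one>\<^bsub>M\<^esub> = f"
    by (rule M_eqI[OF M_mult_closed f], simp only: M_mult conv_one mod_mod_trivial)+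
qed (simp_all add: M_mult_closed M_one_closed)

lemma topspace_C: "topspace C = carrier M"
  by (simp add: M_carrier)

lemma continuous_map_conv:
  assumes "w \<in> lists X"
  shows "continuous_map (prod_topology C C) (discrete_topology UNIV) (\<lambda>z. conv (fst z) (snd z) w)"
proof -
  have c: "continuous_map (prod_topology C C) (discrete_topology (carrier R)) (\<lambda>z. fst z u)"
    "continuous_map (prod_topology C C) (discrete_topology (carrier R)) (\<lambda>z. snd z u)" if "u \<in> lists X" for u
    using continuous_map_product_then_coordinatewise(1)[OF continuous_map_fst that]
      continuous_map_product_then_coordinatewise(1)[OF continuous_map_snd that] by blast+
  have sub: "take i w \<in> lists X" "drop i w \<in> lists X" for i
    using assms by (auto simp: lists_eq_set dest: in_set_takeD in_set_dropD)
  have "continuous_map (prod_topology C C) (discrete_topology UNIV)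
      (\<lambda>z. \<Sum>i\<in>I. fst z (take i w) * snd z (drop i w))" if "finite I" for I
    using that
  proof (induction I)
    case (insert i I)
    have "continuous_map (prod_topology C C) (discrete_topology UNIV) (\<lambda>z. fst z (take i w) * snd z (drop i w))"
      by (rule continuous_map_discrete_comp2[OF c(1)[OF sub(1)] c(2)[OF sub(2)]]) simp
    from continuous_map_discrete_comp2[OF this insert.IH, of "(+)" UNIV] insert.hyps show ?case by simp
  qed simp
  then show ?thesis unfolding conv_def by simp
qed

lemma continuous_map_M_mult: "continuous_map (prod_topology C C) C (\<lambda>z. fst z \<otimes>\<^bsub>M\<^esub> snd z)"
  unfolding continuous_map_componentwise
proof (intro conjI ballI)
  show "(\<lambda>z. fst z \<otimes>\<^bsub>M\<^esub> snd z) ` topspace (prod_topology C C) \<subseteq> extensional (lists X)"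
    using M_mult_undefined by (auto simp only: extensional_def)
  fix w assume w: "w \<in> lists X"
  have "continuous_map (prod_topology C C) (discrete_topology (carrier R)) (\<lambda>z. conv (fst z) (snd z) w mod m)"
    using continuous_map_conv[OF w] continuous_map_conv[OF w]
    by (rule continuous_map_discrete_comp2[where F = "\<lambda>x y. x mod m"]) simp
  then show "continuous_map (prod_topology C C) (discrete_topology (carrier R)) (\<lambda>z. (fst z \<otimes>\<^bsub>M\<^esub> snd z) w)"
    by (simp only: M_mult[OF w])
qed

lemma compact_C: "compact_space C"
  by (simp add: compact_space_product_topology compact_space_discrete_topology res.finite)

lemma Hausdorff_C: "Hausdorff_space C"
  by (simp add: Hausdorff_space_product_topology)

abbreviation TU :: "('a list \<Rightarrow> int) topology" where "TU \<equiv> subtopology C (Units M)"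

lemma Units_carrier: "u \<in> Units M \<Longrightarrow> u \<in> carrier M"
  by (simp add: Units_def)

text \<open>Compactness and the group topology come from the compact monoid of all series. Total
  disconnectedness comes from the coefficients, each of which maps a connected set continuously into
  a discrete space.\<close>

lemma profinite_units: "profinite (units_of M) TU"
proof -
  note U = compact_monoid_topgroup_units[OF monoid_M topspace_C compact_C Hausdorff_C continuous_map_M_mult]
    compact_monoid_closedin_Units[OF monoid_M topspace_C compact_C Hausdorff_C continuous_map_M_mult]
  have "f = g" if S: "connectedin TU S" and fg: "f \<in> S" "g \<in> S" for S f g
  proof (rule M_eqI)
    have SC: "connectedin C S" "S \<subseteq> Units M" using S by (auto simp: connectedin_subtopology)
    show "f \<in> carrier M" "g \<in> carrier M" using SC fg Units_carrier by blast+
    fix w assume w: "w \<in> lists X"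
    have "continuous_map C (discrete_topology (carrier R)) (\<lambda>f. f w)"
      by (rule continuous_map_product_projection[OF w])
    then have "connectedin (discrete_topology (carrier R)) ((\<lambda>f. f w) ` S)"
      using SC(1) by (rule connectedin_continuous_map_image)
    then obtain a where "(\<lambda>f. f w) ` S \<subseteq> {a}" by (auto simp: connectedin_discrete_topology)
    then have "f w = a" "g w = a" using fg by blast+
    then show "f w mod m = g w mod m" by simp
  qed
  moreover have "compact_space TU"
    using closedin_compact_space[OF compact_C U(2)] by (rule compact_space_subtopology)
  moreover have "Hausdorff_space TU" using Hausdorff_C by (rule Hausdorff_space_subtopology)
  ultimately show ?thesis using U(1) by (simp add: profinite_def profinite_axioms_def)
qed

definition gen :: "'a \<Rightarrow> 'a list \<Rightarrow> int" where
  "gen x = \<one>\<^bsub>M\<^esub> \<oplus>\<^bsub>M\<^esub> nc_var R X x"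

lemma gen_eq: "gen x = (\<lambda>w\<in>lists X. one_plus x w mod m)"
  unfolding gen_def
  by (rule ext) (simp add: nc_power_series_def nc_var_def res.res_add_eq res.res_one_eq res.res_zero_eq)

lemma gen_Units: "gen x \<in> Units M"
proof -
  let ?g = "\<lambda>w\<in>lists X. geometric x w mod m"
  have g: "gen x \<in> carrier M" "?g \<in> carrier M" unfolding gen_eq by (rule restrict_mod_mem)+
  have "gen x \<otimes>\<^bsub>M\<^esub> ?g = \<one>\<^bsub>M\<^esub>"
  proof (rule M_eqI[OF M_mult_closed M_one_closed])
    fix w assume w: "w \<in> lists X"
    have "conv (gen x) ?g w mod m = conv (one_plus x) (geometric x) w mod m"
      by (rule conv_cong_mod[OF w]) (simp_all add: gen_eq)
    then show "(gen x \<otimes>\<^bsub>M\<^esub> ?g) w mod m = \<one>\<^bsub>M\<^esub> w mod m"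
      using w by (simp add: M_mult M_one conv_one_plus_geometric)
  qed
  moreover have "?g \<otimes>\<^bsub>M\<^esub> gen x = \<one>\<^bsub>M\<^esub>"
  proof (rule M_eqI[OF M_mult_closed M_one_closed])
    fix w assume w: "w \<in> lists X"
    have "conv ?g (gen x) w mod m = conv (geometric x) (one_plus x) w mod m"
      by (rule conv_cong_mod[OF w]) (simp_all add: gen_eq)
    then show "(?g \<otimes>\<^bsub>M\<^esub> gen x) w mod m = \<one>\<^bsub>M\<^esub> w mod m"
      using w by (simp add: M_mult M_one conv_geometric_one_plus)
  qed
  ultimately show ?thesis using g unfolding Units_def by blast
qed

text \<open>A basic neighbourhood of 1 restricts finitely many coefficients, and
  \<open>gen x\<close> differs from 1 only at the word \<open>[x]\<close>; so only letters whose
  one-letter word is restricted can fail.\<close>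

lemma gen_converges_to_one: "converges_to_one X (units_of M) TU gen"
  unfolding converges_to_one_def
proof (intro allI impI, elim conjE)
  fix U assume U: "U \<lhd> units_of M" "openin TU U"
  have "\<one>\<^bsub>M\<^esub> \<in> U"
    using subgroup.one_closed[OF normal_imp_subgroup[OF U(1)]] by (simp add: units_of_one)
  obtain V where V: "openin C V" "U = V \<inter> Units M"
    using U(2) unfolding openin_subtopology by blast
  then have "\<one>\<^bsub>M\<^esub> \<in> V" using \<open>\<one>\<^bsub>M\<^esub> \<in> U\<close> by blast
  from bspec[OF openin_product_topology_alt[THEN iffD1, OF V(1)] this]
  obtain B where B: "finite {w \<in> lists X. B w \<noteq> topspace (discrete_topology (carrier R))}"
      "\<one>\<^bsub>M\<^esub> \<in> Pi\<^sub>E (lists X) B" "Pi\<^sub>E (lists X) B \<subseteq> V"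
    by (elim exE conjE)
  let ?F = "{w \<in> lists X. B w \<noteq> topspace (discrete_topology (carrier R))}"
  have "{x \<in> X. gen x \<notin> U} \<subseteq> hd ` ?F"
  proof
    fix x assume "x \<in> {x \<in> X. gen x \<notin> U}"
    then have x: "x \<in> X" "gen x \<notin> U" by auto
    have "[x] \<in> ?F"
    proof (rule ccontr)
      assume n: "[x] \<notin> ?F"
      have "gen x \<in> Pi\<^sub>E (lists X) B"
      proof (rule PiE_I)
        fix w assume w: "w \<in> lists X"
        show "gen x w \<in> B w"
        proof (cases "w = [x]")
          case True
          then have "B w = carrier R" using n x(1) by simp
          then show ?thesis using w by (simp add: gen_eq)
        next
          case False
          then have "gen x w = \<one>\<^bsub>M\<^esub> w" using w res.m_gt_one by (simp add: gen_eq M_one)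
          then show ?thesis using PiE_mem[OF B(2) w] by simp
        qed
      qed (simp add: gen_eq)
      then show False using B(3) V(2) x(2) gen_Units by blast
    qed
    then show "x \<in> hd ` ?F" by (rule image_eqI[rotated]) simp
  qed
  then show "finite {x \<in> X. gen x \<notin> U}" using B(1) by (rule finite_subset[OF _ finite_imageI])
qed

end


section \<open>The Magnus homomorphism\<close>

locale free_magnus = profinite G T + magnus_series m R X
  for G :: "'a monoid" (structure) and T :: "'a topology" and m :: int and R :: "int ring" and X :: "'a set" +
  assumes free: "free_profinite_group G T X"
begin

definition \<Lambda> :: "'a \<Rightarrow> 'a list \<Rightarrow> int" where
  "\<Lambda> = magnus G T X R (discrete_topology (carrier R))"

text \<open>The units are functions of type \<open>'a list \<Rightarrow> int\<close>, the type for
  which the universal property is stated. It therefore applies as it stands and gives the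
  \<open>THE\<close> in \<open>magnus\<close> its value.\<close>

lemma magnus_properties:
  "\<Lambda> \<in> hom G (units_of M)" "continuous_map T TU \<Lambda>" "x \<in> X \<Longrightarrow> \<Lambda> x = gen x"
proof -
  have "profinite_group (units_of M) TU"
    unfolding profinite_group_iff by (rule profinite_units)
  moreover have "gen \<in> X \<rightarrow> carrier (units_of M)"
    using gen_Units by (simp add: units_of_carrier)
  ultimately have "\<exists>!\<phi>. \<phi> \<in> extensional (carrier G) \<and> \<phi> \<in> hom G (units_of M) \<and> continuous_map T TU \<phi> \<and>
      (\<forall>x\<in>X. \<phi> x = gen x)"
    using free gen_converges_to_one unfolding free_profinite_group_def by blast
  from theI'[OF this]
  have "\<Lambda> \<in> extensional (carrier G) \<and> \<Lambda> \<in> hom G (units_of M) \<and> continuous_map T TU \<Lambda> \<and> (\<forall>x\<in>X. \<Lambda> x = gen x)"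
    unfolding \<Lambda>_def magnus_def gen_def .
  then show "\<Lambda> \<in> hom G (units_of M)" "continuous_map T TU \<Lambda>" "x \<in> X \<Longrightarrow> \<Lambda> x = gen x" by blast+
qed

lemma X_carrier: "x \<in> X \<Longrightarrow> x \<in> carrier G"
  using free unfolding free_profinite_group_def by blast

lemma \<Lambda>_carrier:
  assumes "g \<in> carrier G"
  shows "\<Lambda> g \<in> carrier M"
proof -
  have "\<Lambda> g \<in> carrier (units_of M)" using magnus_properties(1) assms by (rule hom_in_carrier)
  then show ?thesis using Units_carrier by (simp add: units_of_carrier)
qed

lemma \<Lambda>_mod: "g \<in> carrier G \<Longrightarrow> w \<in> lists X \<Longrightarrow> \<Lambda> g w mod m = \<Lambda> g w"
  by (rule M_coeff[OF \<Lambda>_carrier])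

lemma \<Lambda>_mult:
  "g \<in> carrier G \<Longrightarrow> h \<in> carrier G \<Longrightarrow> w \<in> lists X \<Longrightarrow> \<Lambda> (g \<otimes> h) w = conv (\<Lambda> g) (\<Lambda> h) w mod m"
  using hom_mult[OF magnus_properties(1)] by (simp add: units_of_mult M_mult)

lemma \<Lambda>_one: "\<Lambda> \<one> = \<one>\<^bsub>M\<^esub>"
proof -
  interpret V: group "units_of M" by (rule monoid.units_group[OF monoid_M])
  interpret group_hom G "units_of M" \<Lambda> by unfold_locales (rule magnus_properties(1))
  show ?thesis using hom_one by (simp add: units_of_one)
qed

lemma \<Lambda>_continuous:
  assumes "w \<in> lists X"
  shows "continuous_map T (discrete_topology (carrier R)) (\<lambda>g. \<Lambda> g w)"
proof -
  have "continuous_map T C \<Lambda>"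
    using magnus_properties(2) by (simp only: continuous_map_in_subtopology)
  then show ?thesis using assms by (rule continuous_map_product_then_coordinatewise(1))
qed

text \<open>The elements with constant coefficient 1 form a closed subgroup that contains
  \<open>X\<close>, and \<open>X\<close> generates topologically.\<close>

lemma \<Lambda>_Nil:
  assumes "g \<in> carrier G"
  shows "\<Lambda> g [] = 1"
proof -
  let ?H = "{g \<in> carrier G. \<Lambda> g [] \<in> {1}}"
  have nil: "[] \<in> lists X" by simp
  have mult: "\<Lambda> (g \<otimes> h) [] = (\<Lambda> g [] * \<Lambda> h []) mod m" if "g \<in> carrier G" "h \<in> carrier G" for g h
    using \<Lambda>_mult[OF that nil] by simp
  have one: "\<Lambda> \<one> [] = 1" by (simp add: \<Lambda>_one M_one)
  have "closed_generate G T X \<subseteq> ?H"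
  proof (rule closed_generate_subset)
    show "subgroup ?H G"
    proof (rule subgroupI)
      show "?H \<noteq> {}" using one by blast
      fix g assume "g \<in> ?H"
      then have g: "g \<in> carrier G" "\<Lambda> g [] = 1" by auto
      have "\<Lambda> (inv g) [] mod m = 1" using mult[OF g(1) inv_closed[OF g(1)]] g one by simp
      then show "inv g \<in> ?H" using g \<Lambda>_mod[OF inv_closed[OF g(1)] nil] by simp
    next
      fix g h assume "g \<in> ?H" "h \<in> ?H"
      then show "g \<otimes> h \<in> ?H" using mult[of g h] res.m_gt_one by simp
    qed auto
    have "closedin (discrete_topology (carrier R)) ({1} \<inter> carrier R)" by simp
    from closedin_continuous_map_preimage[OF \<Lambda>_continuous[OF nil] this]
    have "closedin T {g \<in> carrier G. \<Lambda> g [] \<in> {1} \<inter> carrier R}" by simp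
    also have "{g \<in> carrier G. \<Lambda> g [] \<in> {1} \<inter> carrier R} = ?H"
      using res.m_gt_one by (simp add: res.res_carrier_eq)
    finally show "closedin T ?H" .
    have "\<Lambda> x [] = 1" if "x \<in> X" for x
      using that magnus_properties(3)[OF that] res.m_gt_one by (simp add: gen_eq)
    then show "X \<subseteq> ?H" using X_carrier by auto
  qed
  moreover have "closed_generate G T X = carrier G"
    using free unfolding free_profinite_group_def by blast
  ultimately show ?thesis using assms by auto
qed

lemma \<Lambda>_mult_inner:
  assumes "g \<in> carrier G" "h \<in> carrier G" "w \<in> lists X" "w \<noteq> []"
  shows "\<Lambda> (g \<otimes> h) w = (\<Lambda> g w + \<Lambda> h w + (\<Sum>i\<in>{0<..<length w}. \<Lambda> g (take i w) * \<Lambda> h (drop i w))) mod m"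
  unfolding \<Lambda>_mult[OF assms(1-3)] by (subst conv_inner) (use assms in \<open>simp_all add: \<Lambda>_Nil\<close>)

lemma take_drop_lists: "w \<in> lists X \<Longrightarrow> take i w \<in> lists X" "w \<in> lists X \<Longrightarrow> drop i w \<in> lists X"
  by (auto simp: lists_eq_set dest: in_set_takeD in_set_dropD)

text \<open>In the product of \<open>g [^] q\<close> with \<open>g\<close> every cross term contains
  a nonempty proper suffix, shorter than \<open>k\<close>, at which \<open>g\<close> has coefficient
  0. So taking powers is linear up to degree \<open>k\<close>.\<close>

lemma \<Lambda>_pow:
  assumes g: "g \<in> carrier G"
    and low: "\<forall>v\<in>lists X. v \<noteq> [] \<longrightarrow> length v < k \<longrightarrow> \<Lambda> g v = 0"
    and v: "v \<in> lists X" "v \<noteq> []" "length v \<le> k"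
  shows "\<Lambda> (g [^] (q::nat)) v = (int q * \<Lambda> g v) mod m"
proof (induction q)
  case 0
  then show ?case using v by (simp add: \<Lambda>_one M_one)
next
  case (Suc q)
  have gq: "g [^] q \<in> carrier G" using g by simp
  have "(\<Sum>i\<in>{0<..<length v}. \<Lambda> (g [^] q) (take i v) * \<Lambda> g (drop i v)) = 0"
  proof (rule sum.neutral, rule ballI)
    fix i assume "i \<in> {0<..<length v}"
    then have "drop i v \<noteq> []" "length (drop i v) < k" using v by auto
    then have "\<Lambda> g (drop i v) = 0" using low take_drop_lists(2)[OF v(1)] by blast
    then show "\<Lambda> (g [^] q) (take i v) * \<Lambda> g (drop i v) = 0" by simp
  qed
  then have "\<Lambda> (g [^] Suc q) v = (int q * \<Lambda> g v mod m + \<Lambda> g v) mod m"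
    using \<Lambda>_mult_inner[OF gq g v(1,2)] Suc by simp
  also have "\<dots> = (int q * \<Lambda> g v + \<Lambda> g v) mod m" by (rule mod_add_left_eq)
  also have "int q * \<Lambda> g v + \<Lambda> g v = int (Suc q) * \<Lambda> g v" by (simp add: algebra_simps)
  finally show ?case .
qed

text \<open>Compare the coefficients of \<open>B A [A, B] = A B\<close>.\<close>

lemma \<Lambda>_commutator:
  assumes A: "A \<in> carrier G" and B: "B \<in> carrier G" and ab: "0 < a" "0 < b"
    and lowA: "\<forall>v\<in>lists X. v \<noteq> [] \<longrightarrow> length v < a \<longrightarrow> \<Lambda> A v = 0"
    and lowB: "\<forall>v\<in>lists X. v \<noteq> [] \<longrightarrow> length v < b \<longrightarrow> \<Lambda> B v = 0"
    and v: "v \<in> lists X" "v \<noteq> []" "length v \<le> a + b"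
  shows "\<Lambda> (commutator G A B) v = (if length v = a + b
    then (\<Lambda> A (take a v) * \<Lambda> B (drop a v) - \<Lambda> B (take b v) * \<Lambda> A (drop b v)) mod m else 0)"
  using v
proof (induction "length v" arbitrary: v rule: less_induct)
  case less
  note v = less.prems
  let ?K = "commutator G A B" and ?F = "B \<otimes> A"
  have K: "?K \<in> carrier G" and F: "?F \<in> carrier G" using A B by simp_all
  have FK: "?F \<otimes> ?K = A \<otimes> B" using A B by (simp add: commutator_def m_assoc)
  \<comment> \<open>If two series vanish in positive degrees below \<open>c\<close> and below
    \<open>d\<close>, a word of length at most \<open>c + d\<close> has one possible cross term: the
    cut after \<open>c\<close> letters, at length exactly \<open>c + d\<close>. The general form
    serves both orders of \<open>A\<close> and \<open>B\<close>.\<close>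
  have inner: "(\<Sum>i\<in>{0<..<length v}. \<Lambda> P (take i v) * \<Lambda> Q (drop i v)) =
      (if length v = c + d then \<Lambda> P (take c v) * \<Lambda> Q (drop c v) else 0)"
    if cd: "c + d = a + b" "0 < c" "0 < d"
      and P: "\<forall>v\<in>lists X. v \<noteq> [] \<longrightarrow> length v < c \<longrightarrow> \<Lambda> P v = 0"
      and Q: "\<forall>v\<in>lists X. v \<noteq> [] \<longrightarrow> length v < d \<longrightarrow> \<Lambda> Q v = 0" for P Q c d
  proof -
    have "(\<Sum>i\<in>{0<..<length v}. \<Lambda> P (take i v) * \<Lambda> Q (drop i v)) =
        (\<Sum>i\<in>{0<..<length v}. if i = c then (if length v = c + d then \<Lambda> P (take c v) * \<Lambda> Q (drop c v) else 0) else 0)"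
    proof (rule sum.cong[OF refl])
      fix i assume i: "i \<in> {0<..<length v}"
      have t: "take i v \<in> lists X" "drop i v \<in> lists X" using v(1) by (rule take_drop_lists)+
      consider "i < c" | "length v < i + d" | "i = c" "length v = c + d" using v(3) cd by linarith
      then show "\<Lambda> P (take i v) * \<Lambda> Q (drop i v) =
          (if i = c then (if length v = c + d then \<Lambda> P (take c v) * \<Lambda> Q (drop c v) else 0) else 0)"
      proof cases
        case 1
        then have "take i v \<noteq> []" "length (take i v) < c" using i by auto
        then have "\<Lambda> P (take i v) = 0" using P t by blast
        then show ?thesis using 1 by simp
      next
        case 2
        then have "drop i v \<noteq> []" "length (drop i v) < d" using i by auto
        then have "\<Lambda> Q (drop i v) = 0" using Q t by blast
        moreover have "i \<noteq> c \<or> length v \<noteq> c + d" using 2 by auto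
        ultimately show ?thesis by auto
      qed simp
    qed
    also have "\<dots> = (if length v = c + d then \<Lambda> P (take c v) * \<Lambda> Q (drop c v) else 0)"
      using cd by (subst sum.delta) auto
    finally show ?thesis .
  qed
  \<comment> \<open>Proper suffixes have length below \<open>a + b\<close>, where the commutator has
    coefficient 0 by induction; so the coefficients of \<open>?F\<close> and of the commutator
    simply add.\<close>
  have "(\<Sum>i\<in>{0<..<length v}. \<Lambda> ?F (take i v) * \<Lambda> ?K (drop i v)) = 0"
  proof (rule sum.neutral, rule ballI)
    fix i assume i: "i \<in> {0<..<length v}"
    have len: "length (drop i v) < length v" "drop i v \<noteq> []" "length (drop i v) \<le> a + b"
      "length (drop i v) \<noteq> a + b" using i v(3) by auto
    have "\<Lambda> ?K (drop i v) = 0"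
      using less.hyps[OF len(1) take_drop_lists(2)[OF v(1)] len(2,3)] by (simp only: len(4) if_False)
    then show "\<Lambda> ?F (take i v) * \<Lambda> ?K (drop i v) = 0" by simp
  qed
  with \<Lambda>_mult_inner[OF F K v(1,2)] have "\<Lambda> (A \<otimes> B) v = (\<Lambda> ?F v + \<Lambda> ?K v) mod m" by (simp add: FK)
  then have "(\<Lambda> ?F v + \<Lambda> ?K v) mod m = \<Lambda> (A \<otimes> B) v mod m" by simp
  from mod_diff_cong[OF this refl, of "\<Lambda> ?F v"]
  have "\<Lambda> ?K v mod m = (\<Lambda> (A \<otimes> B) v - \<Lambda> ?F v) mod m" by (simp only: add_diff_cancel_left')
  then have "\<Lambda> ?K v = (\<Lambda> (A \<otimes> B) v - \<Lambda> ?F v) mod m" by (simp only: \<Lambda>_mod[OF K v(1)])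
  also have "\<dots> = ((\<Lambda> A v + \<Lambda> B v + (if length v = a + b then \<Lambda> A (take a v) * \<Lambda> B (drop a v) else 0)) -
      (\<Lambda> B v + \<Lambda> A v + (if length v = b + a then \<Lambda> B (take b v) * \<Lambda> A (drop b v) else 0))) mod m"
    unfolding \<Lambda>_mult_inner[OF A B v(1,2)] \<Lambda>_mult_inner[OF B A v(1,2)]
      inner[OF refl ab lowA lowB] inner[OF add.commute ab(2,1) lowB lowA] by (rule mod_diff_eq)
  also have "\<dots> = (if length v = a + b
    then (\<Lambda> A (take a v) * \<Lambda> B (drop a v) - \<Lambda> B (take b v) * \<Lambda> A (drop b v)) mod m else 0)"
    by (simp add: add.commute)
  finally show ?case .
qed

lemma \<Lambda>_gen: "x \<in> X \<Longrightarrow> w \<in> lists X \<Longrightarrow> \<Lambda> x w = one_plus x w mod m"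
  by (simp add: magnus_properties(3) gen_eq)

end

section \<open>Unipotent representations formed by Magnus coefficients\<close>

locale magnus_matrix = free_magnus G T m R X + un: unipotent m R d
  for G :: "'a monoid" (structure) and T :: "'a topology" and m :: int and R :: "int ring" and X :: "'a set"
    and d :: nat +
  fixes w :: "'a list"
  assumes d_eq: "d = length w + 1" and w: "w \<in> lists X"
begin

definition mat :: "'a \<Rightarrow> nat \<times> nat \<Rightarrow> int" where
  "mat g = (\<lambda>(i, j)\<in>{1..d} \<times> {1..d}.
     if i < j then \<Lambda> g (take (j - i) (drop (i - 1) w)) else if i = j then 1 else 0)"

lemma factor_lists: "take k (drop l w) \<in> lists X"
  using w by (intro take_drop_lists)

lemma mat_closed:
  assumes g: "g \<in> carrier G"
  shows "mat g \<in> carrier un.U"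
  unfolding un.mem_carrier_iff
proof (intro conjI ballI impI)
  show "mat g \<in> {1..d} \<times> {1..d} \<rightarrow>\<^sub>E {0..m - 1}"
  proof (rule PiE_I)
    fix z assume "z \<in> {1..d} \<times> {1..d}"
    then obtain i j where z: "z = (i, j)" "i \<in> {1..d}" "j \<in> {1..d}" by blast
    have "\<Lambda> g (take (j - i) (drop (i - 1) w)) \<in> carrier R"
      using \<Lambda>_carrier[OF g] factor_lists unfolding M_carrier by (rule PiE_mem)
    then show "mat g z \<in> {0..m - 1}" using z res.m_gt_one by (simp add: mat_def res.res_carrier_eq)
  qed (auto simp: mat_def)
qed (simp_all add: mat_def)

lemma mat_hom: "mat \<in> hom G un.U"
proof (rule homI)
  fix g h assume g: "g \<in> carrier G" and h: "h \<in> carrier G"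
  have gh: "g \<otimes> h \<in> carrier G" using g h by simp
  show "mat (g \<otimes> h) = mat g \<otimes>\<^bsub>un.U\<^esub> mat h"
  proof (rule un.eqI[OF mat_closed[OF gh] un.mult_mem[OF mat_closed[OF g] mat_closed[OF h]]])
    fix i j assume ij: "i \<in> {1..d}" "j \<in> {1..d}" "i < j"
    let ?v = "take (j - i) (drop (i - 1) w)"
    have len: "length ?v = j - i" using ij d_eq by auto
    then have ne: "?v \<noteq> []" using ij by auto
    have "(\<Sum>l\<in>{0<..<length ?v}. \<Lambda> g (take l ?v) * \<Lambda> h (drop l ?v)) =
        (\<Sum>k\<in>{i<..<j}. mat g (i, k) * mat h (k, j))"
    \<comment> \<open>Cutting the factor after \<open>l\<close> letters corresponds to passing
      through the matrix index \<open>l + i\<close>.\<close>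
    proof (rule sum.reindex_bij_witness[of _ "\<lambda>k. k - i" "\<lambda>l. l + i"])
      fix l assume "l \<in> {0<..<length ?v}"
      then have l: "0 < l" "l < j - i" using len by auto
      have t: "take l ?v = take (l + i - i) (drop (i - 1) w)" using l by (simp add: min_def)
      have dr: "drop l ?v = take (j - (l + i)) (drop (l + i - 1) w)"
        using ij l by (simp add: drop_take add.commute)
      have "i < l + i" "l + i < j" "l + i \<in> {1..d}" using ij l by auto
      then have "mat g (i, l + i) = \<Lambda> g (take l ?v)" "mat h (l + i, j) = \<Lambda> h (drop l ?v)"
        unfolding t dr using ij by (simp_all add: mat_def)
      then show "mat g (i, l + i) * mat h (l + i, j) = \<Lambda> g (take l ?v) * \<Lambda> h (drop l ?v)" by simp
    qed (use len in auto)
    moreover have "mat g (i, j) = \<Lambda> g ?v" "mat h (i, j) = \<Lambda> h ?v" "mat (g \<otimes> h) (i, j) = \<Lambda> (g \<otimes> h) ?v"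
      using ij by (simp_all add: mat_def)
    ultimately show "mat (g \<otimes> h) (i, j) mod m = (mat g \<otimes>\<^bsub>un.U\<^esub> mat h) (i, j) mod m"
      by (simp only: un.mult_entry_upper[OF mat_closed[OF g] mat_closed[OF h] ij] \<Lambda>_mult_inner[OF g h factor_lists ne])
  qed
qed (rule mat_closed)

lemma mat_entry_open:
  assumes z: "z \<in> {1..d} \<times> {1..d}"
  shows "openin T {g \<in> carrier G. mat g z = c}"
proof -
  obtain i j where ij: "z = (i, j)" "i \<in> {1..d}" "j \<in> {1..d}" using z by blast
  show ?thesis
  proof (cases "i < j")
    case True
    let ?v = "take (j - i) (drop (i - 1) w)"
    have "openin (discrete_topology (carrier R)) ({c} \<inter> carrier R)" by simp
    from openin_continuous_map_preimage[OF \<Lambda>_continuous[OF factor_lists] this]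
    have "openin T {g \<in> carrier G. \<Lambda> g ?v \<in> {c} \<inter> carrier R}" by simp
    also have "{g \<in> carrier G. \<Lambda> g ?v \<in> {c} \<inter> carrier R} = {g \<in> carrier G. mat g z = c}"
    proof (rule Collect_cong, rule conj_cong[OF refl])
      fix g assume g: "g \<in> carrier G"
      have "\<Lambda> g ?v \<in> carrier R"
        using \<Lambda>_carrier[OF g] factor_lists unfolding M_carrier by (rule PiE_mem)
      then show "\<Lambda> g ?v \<in> {c} \<inter> carrier R \<longleftrightarrow> mat g z = c" using ij True by (simp add: mat_def)
    qed
    finally show ?thesis .
  next
    case False
    then have "{g \<in> carrier G. mat g z = c} = (if (if i = j then 1 else 0) = c then carrier G else {})"
      using ij by (auto simp: mat_def)
    then show ?thesis using openin_topspace[of T] by simp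
  qed
qed

lemma mat_continuous: "continuous_map T (discrete_topology (carrier un.U)) mat"
  unfolding continuous_map_def
proof (intro conjI allI impI)
  show "mat \<in> topspace T \<rightarrow> topspace (discrete_topology (carrier un.U))" using mat_closed by simp
  fix V
  show "openin T {g \<in> topspace T. mat g \<in> V}"
  proof (subst openin_subopen, intro ballI)
    fix g assume "g \<in> {g \<in> topspace T. mat g \<in> V}"
    then have g: "g \<in> carrier G" "mat g \<in> V" by auto
    \<comment> \<open>A matrix has finitely many entries, so prescribing all of them is an open
      condition.\<close>
    let ?O = "(\<Inter>z\<in>{1..d} \<times> {1..d}. {h \<in> carrier G. mat h z = mat g z}) \<inter> topspace T"
    have "openin T ?O" by (rule openin_INT[OF _ mat_entry_open]) simp_all
    moreover have "g \<in> ?O" using g by simp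
    moreover have "?O \<subseteq> {g \<in> topspace T. mat g \<in> V}"
    proof
      fix h assume h: "h \<in> ?O"
      then have hc: "h \<in> carrier G" by simp
      have "mat h = mat g"
      proof (rule un.eqI[OF mat_closed[OF hc] mat_closed[OF g(1)]])
        fix i j assume "i \<in> {1..d}" "j \<in> {1..d}"
        then have "mat h (i, j) = mat g (i, j)" using h by blast
        then show "mat h (i, j) mod m = mat g (i, j) mod m" by simp
      qed
      then show "h \<in> {g \<in> topspace T. mat g \<in> V}" using hc g(2) by simp
    qed
    ultimately show "\<exists>O'. openin T O' \<and> g \<in> O' \<and> O' \<subseteq> {g \<in> topspace T. mat g \<in> V}" by blast
  qed
qed

end

theorem trg_pairing_alpha:
  assumes free: "free_profinite_group G T X" and p: "prime p" and n: "2 \<le> n"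
    and w: "w \<in> lists X" "w \<noteq> []" "length w \<le> n"
    and \<sigma>: "\<sigma> \<in> lower_p_central G T p n"
  shows "trg_pairing G T p n \<sigma> (alpha G T X p n w) =
    magnus_coeff G T X (residue_ring (int (p ^ (n - length w + 1))))
      (discrete_topology (carrier (residue_ring (int (p ^ (n - length w + 1)))))) w \<sigma> div int p ^ (n - length w)"
proof -
  let ?s = "length w"
  interpret profinite G T
    using free unfolding free_profinite_group_def profinite_group_iff by blast
  interpret E: unipotent_extension p n ?s
    using p w by unfold_locales auto
  have R: "residue_ring (int (p ^ (n - length w + 1))) = residue_ring E.modulus"
    by (simp add: E.modulus_def)
  interpret fm: free_magnus G T E.modulus "residue_ring E.modulus" X
    by (intro free_magnus.intro profinite_axioms magnus_series.intro residues.intro E.res.m_gt_one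
      free_magnus_axioms.intro free)
  interpret mm: magnus_matrix G T E.modulus "residue_ring E.modulus" X E.dim w
    by unfold_locales (simp_all add: E.dim_def w)
  have rho: "rho G T X p n w = mm.mat"
    by (rule ext) (simp only: rho_def Let_def mm.mat_def magnus_coeff_def fm.\<Lambda>_def R
      E.res.res_one_eq E.res.res_zero_eq E.dim_def[symmetric])
  interpret rep: unipotent_representation G T p n ?s mm.mat
    using n mm.mat_hom mm.mat_continuous by unfold_locales auto
  \<comment> \<open>\<open>rho_bar\<close> is a \<open>the_elem\<close> over a coset; it has a value
    because \<open>\<psi>\<close> is constant on the cosets of the \<open>n\<close>-th term.\<close>
  have bar: "rho_bar G T X p n w (rep.N #>\<^bsub>G\<^esub> g) = rep.\<psi> g" if g: "g \<in> carrier G" for g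
  proof -
    have "(\<lambda>\<sigma>. rep.\<psi> \<sigma>) ` (rep.N #>\<^bsub>G\<^esub> g) = {rep.\<psi> g}"
    proof (intro equalityI image_subsetI)
      fix h assume "h \<in> rep.N #>\<^bsub>G\<^esub> g"
      then obtain k where "k \<in> rep.N" "h = k \<otimes>\<^bsub>G\<^esub> g" by (auto simp: r_coset_def)
      then show "rep.\<psi> h \<in> {rep.\<psi> g}" using rep.\<psi>_N_mult g by simp
    next
      have "g \<in> rep.N #>\<^bsub>G\<^esub> g" using g subgroup_lower_p_central by (rule rcos_self)
      then have "rep.\<psi> g \<in> (\<lambda>\<sigma>. rep.\<psi> \<sigma>) ` (rep.N #>\<^bsub>G\<^esub> g)" by (rule imageI)
      then show "{rep.\<psi> g} \<subseteq> (\<lambda>\<sigma>. rep.\<psi> \<sigma>) ` (rep.N #>\<^bsub>G\<^esub> g)"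
        by (simp only: insert_subset empty_subsetI simp_thms)
    qed
    then show ?thesis unfolding rho_bar_def rho E.UU_eq E.UU_lower_eq by (simp only: the_elem_eq)
  qed
  have "trg_pairing G T p n \<sigma> (alpha G T X p n w) = E.coord (mm.mat \<sigma>)"
    unfolding alpha_def Let_def by (rule rep.trg_pairing_H2_pullback[OF bar \<sigma>])
  \<comment> \<open>The corner belongs to the factor that is all of \<open>w\<close>.\<close>
  also have "take (E.dim - 1) w = w" by (simp add: E.dim_def)
  then have "mm.mat \<sigma> (1, E.dim) = fm.\<Lambda> \<sigma> w"
    using E.dim_range by (simp add: mm.mat_def)
  then have "E.coord (mm.mat \<sigma>) = fm.\<Lambda> \<sigma> w div int p ^ (n - ?s)"
    by (simp only: E.coord_def)
  finally show ?thesis unfolding magnus_coeff_def R fm.\<Lambda>_def .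
qed


section \<open>Lyndon words\<close>

lemma lexord_append_same_length:
  assumes "\<And>x. (x, x) \<notin> R" "length u = length u'"
  shows "(u @ v, u' @ v') \<in> lexord R \<longleftrightarrow> (u, u') \<in> lexord R \<or> u = u' \<and> (v, v') \<in> lexord R"
  using assms(2) by (induction u u' rule: list_induct2) (auto simp: assms(1))

locale alphabet =
  fixes X :: "'x set" and r :: "'x rel"
  assumes linear: "linear_order_on X r"
begin

abbreviation lt :: "'x list \<Rightarrow> 'x list \<Rightarrow> bool" where "lt \<equiv> alp_less r"

lemma lt_irrefl: "\<not> lt v v"
  unfolding alp_less_def by (rule lexord_irreflexive) simp

lemma lt_trans: "lt u v \<Longrightarrow> lt v w \<Longrightarrow> lt u w"
  unfolding alp_less_def
proof (rule lexord_trans)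
  show "trans (r - Id)"
    using linear by (auto simp: linear_order_on_def partial_order_on_def preorder_on_def intro: trans_diff_Id)
qed

lemma lt_asym: "lt u v \<Longrightarrow> \<not> lt v u"
  using lt_trans lt_irrefl by blast

lemma lt_total:
  assumes "v \<in> lists X" "w \<in> lists X"
  shows "lt v w \<or> v = w \<or> lt w v"
  using assms
proof (induction v arbitrary: w)
  case Nil
  then show ?case by (cases w) (auto simp: alp_less_def)
next
  case (Cons x v)
  show ?case
  proof (cases w)
    case Nil
    then show ?thesis by (simp add: alp_less_def)
  next
    case w: (Cons y u)
    have "x \<in> X" "y \<in> X" "lt v u \<or> v = u \<or> lt u v" using Cons w by auto
    moreover have "(x, y) \<in> r \<or> x = y \<or> (y, x) \<in> r"
      using linear \<open>x \<in> X\<close> \<open>y \<in> X\<close> unfolding linear_order_on_def total_on_def by blast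
    ultimately show ?thesis unfolding w alp_less_def by auto
  qed
qed

lemma lt_append_iff:
  "length u = length u' \<Longrightarrow> lt (u @ v) (u' @ v') \<longleftrightarrow> lt u u' \<or> u = u' \<and> lt v v'"
  unfolding alp_less_def by (rule lexord_append_same_length) auto

text \<open>A word that is not Lyndon has a smaller proper suffix; descent on the length ends at a
  Lyndon suffix.\<close>

lemma lyndon_suffix_le:
  assumes "v \<in> lists X" "v \<noteq> []"
  obtains k where "k < length v" "lyndon r (drop k v)" "drop k v = v \<or> lt (drop k v) v"
proof -
  have "\<exists>k<length v. lyndon r (drop k v) \<and> (drop k v = v \<or> lt (drop k v) v)"
    using assms
  proof (induction "length v" arbitrary: v rule: less_induct)
    case less
    show ?case
    proof (cases "lyndon r v")
      case True
      then show ?thesis using less.prems by (intro exI[of _ 0]) simp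
    next
      case False
      then obtain u t where ut: "v = u @ t" "u \<noteq> []" "t \<noteq> []" "\<not> lt v t"
        using less.prems unfolding lyndon_def by blast
      have t: "t \<in> lists X" "v \<noteq> t" using less.prems ut by auto
      then have tv: "lt t v" using lt_total less.prems ut by blast
      obtain k where k: "k < length t" "lyndon r (drop k t)" "drop k t = t \<or> lt (drop k t) t"
        using less.hyps[of t] ut t by auto
      have "drop (length u + k) v = drop k t" using ut by simp
      moreover have "lt (drop k t) v" using k(3) tv lt_trans by auto
      ultimately show ?thesis using k ut by (intro exI[of _ "length u + k"]) simp
    qed
  qed
  then show thesis using that by blast
qed

text \<open>Below or equal to any proper suffix there is a Lyndon one; by maximality it lies inside
  the longest, and a Lyndon word is smaller than its own proper suffixes. So the second standard
  factor is the least nonempty proper suffix.\<close>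

lemma std_factor_minimal:
  assumes w: "w \<in> lists X" "0 < k" "k < length w"
  shows "drop (std_cut r w) w = drop k w \<or> lt (drop (std_cut r w) w) (drop k w)"
proof -
  let ?c = "std_cut r w"
  have c: "0 < ?c" "?c < length w" "lyndon r (drop ?c w)" using std_cut[of w r] w by auto
  have "drop k w \<in> lists X" "drop k w \<noteq> []" using w by (auto simp: lists_eq_set dest: in_set_dropD)
  then obtain l where l: "l < length (drop k w)" "lyndon r (drop l (drop k w))"
    "drop l (drop k w) = drop k w \<or> lt (drop l (drop k w)) (drop k w)"
    by (rule lyndon_suffix_le)
  let ?i = "l + k"
  have i: "0 < ?i" "?i < length w" "lyndon r (drop ?i w)" using l w by simp_all
  then have ci: "?c \<le> ?i" unfolding std_cut_def by (intro Least_le) simp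
  have "drop ?c w = drop ?i w \<or> lt (drop ?c w) (drop ?i w)"
  proof (cases "?c = ?i")
    case False
    have "drop ?c w = take (?i - ?c) (drop ?c w) @ drop ?i w"
      using ci by (metis append_take_drop_id drop_drop le_add_diff_inverse2)
    moreover have "take (?i - ?c) (drop ?c w) \<noteq> []" "drop ?i w \<noteq> []" using False ci c i by auto
    ultimately show ?thesis using c(3) unfolding lyndon_def by blast
  qed simp
  then show ?thesis using l(3) lt_trans by auto
qed

lemma lyndon_std_prefix:
  assumes w: "w \<in> lists X" "lyndon r w" "1 < length w"
  shows "lyndon r (take (std_cut r w) w)"
  unfolding lyndon_def
proof (intro conjI allI impI)
  let ?c = "std_cut r w"
  let ?w1 = "take ?c w" and ?w2 = "drop ?c w"
  have c: "0 < ?c" "?c < length w" using std_cut[OF w(3), of r] by auto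
  show "?w1 \<noteq> []" using c by auto
  fix u v assume "?w1 = u @ v \<and> u \<noteq> [] \<and> v \<noteq> []"
  then have uv: "?w1 = u @ v" "u \<noteq> []" "v \<noteq> []" by auto
  have weq: "w = ?w1 @ ?w2" by simp
  then have w_split: "w = u @ (v @ ?w2)" using uv by (metis append.assoc)
  have w_lt: "lt (?w1 @ ?w2) (v @ ?w2)"
    using w(2) w_split uv unfolding lyndon_def by (metis append_take_drop_id append_is_Nil_conv)
  show "lt ?w1 v"
  proof (rule ccontr)
    assume "\<not> lt ?w1 v"
    moreover have "?w1 \<in> lists X" using w(1) by (auto simp: lists_eq_set dest: in_set_takeD)
    moreover from this have "v \<in> lists X" unfolding uv(1) by simp
    moreover have "?w1 \<noteq> v" using uv by auto
    ultimately have "lt v ?w1" using lt_total by blast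
    then consider t where "?w1 = v @ t" "t \<noteq> []"
      | p x y s t where "v = p @ x # s" "?w1 = p @ y # t" "(x, y) \<in> r - Id"
      unfolding alp_less_def lexord_def by (auto simp: neq_Nil_conv)
    then show False
    proof cases
      \<comment> \<open>Here \<open>v\<close> is a proper prefix of \<open>?w1\<close>. Cancelling
        it leaves a proper suffix of \<open>w\<close> that is smaller than \<open>?w2\<close>,
        against the minimality of the second factor.\<close>
      case 1
      have "lt (v @ (t @ ?w2)) (v @ ?w2)" using w_lt unfolding 1(1) by simp
      then have "lt (t @ ?w2) ?w2" using lt_append_iff[of v v] lt_irrefl by blast
      moreover have w2: "w = v @ (t @ ?w2)" using weq 1(1) by (metis append.assoc)
      then have "drop (length v) w = t @ ?w2" by (metis append_eq_conv_conj)
      moreover have "length v < length w"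
        using arg_cong[OF w2, of length] 1(2) by (simp add: length_greater_0_conv[symmetric] del: length_greater_0_conv)
      then have "?w2 = drop (length v) w \<or> lt ?w2 (drop (length v) w)"
        using uv by (intro std_factor_minimal[OF w(1)]) auto
      ultimately show False using 1(2) lt_asym[of "t @ ?w2" ?w2] by auto
    next
      \<comment> \<open>Here \<open>v\<close> and \<open>?w1\<close> differ at a letter, so
        \<open>v\<close> stays smaller after \<open>?w2\<close> is appended to both, although
        \<open>w\<close> is smaller than its proper suffixes.\<close>
      case 2
      have "lt (v @ ?w2) (?w1 @ ?w2)"
        unfolding 2 alp_less_def using 2(3) by (auto intro: lexord_append_left_rightI)
      then show False using w_lt lt_asym by blast
    qed
  qed
qed

end


section \<open>Magnus coefficients of the Lyndon elements\<close>

text \<open>The lengths of the standard factors add up, and under commutators so do the indices of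
  the filtration.\<close>

lemma (in profinite) tau_mem_lower_p_central:
  assumes "X \<subseteq> carrier G" "w \<in> lists X" "w \<noteq> []"
  shows "tau G r w \<in> lower_p_central G T p (length w)"
  using assms(2,3)
proof (induction "length w" arbitrary: w rule: less_induct)
  case less
  show ?case
  proof (cases "length w \<le> 1")
    case True
    with less.prems obtain x where "w = [x]" by (cases w) auto
    with less.prems assms(1) show ?thesis by (auto simp: tau.simps[of G r "[x]"])
  next
    case False
    let ?c = "std_cut r w"
    have c: "0 < ?c" "?c < length w" using std_cut[of w r] False by auto
    have "take ?c w \<in> lists X" "drop ?c w \<in> lists X"
      using less.prems by (auto simp: lists_eq_set dest: in_set_takeD in_set_dropD)
    moreover have "length (take ?c w) < length w" "take ?c w \<noteq> []" "length (drop ?c w) < length w" "drop ?c w \<noteq> []"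
      using c by auto
    ultimately have "tau G r (take ?c w) \<in> lower_p_central G T p (length (take ?c w))"
      "tau G r (drop ?c w) \<in> lower_p_central G T p (length (drop ?c w))"
      by (blast intro: less.hyps)+
    then have "commutator G (tau G r (take ?c w)) (tau G r (drop ?c w)) \<in>
        lower_p_central G T p (length (take ?c w) + length (drop ?c w))"
      using c by (intro commutator_mem_lower_p_central_add) auto
    moreover have "length (take ?c w) + length (drop ?c w) = length w" using c by simp
    ultimately show ?thesis using False by (simp add: tau.simps[of G r w])
  qed
qed

lemma (in free_magnus) \<Lambda>_tau:
  assumes "linear_order_on X r" "lyndon r w" "w \<in> lists X"
  shows "tau G r w \<in> carrier G"
    and "\<forall>v\<in>lists X. v \<noteq> [] \<longrightarrow> length v < length w \<longrightarrow> \<Lambda> (tau G r w) v = 0"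
    and "v \<in> lists X \<Longrightarrow> length v = length w \<Longrightarrow> alp_less r v w \<Longrightarrow> \<Lambda> (tau G r w) v = 0"
    and "\<Lambda> (tau G r w) w = 1"
proof -
  interpret alphabet X r by unfold_locales fact
  have "tau G r w \<in> carrier G \<and>
    (\<forall>v\<in>lists X. v \<noteq> [] \<longrightarrow> length v < length w \<longrightarrow> \<Lambda> (tau G r w) v = 0) \<and>
    (\<forall>v\<in>lists X. length v = length w \<longrightarrow> alp_less r v w \<longrightarrow> \<Lambda> (tau G r w) v = 0) \<and>
    \<Lambda> (tau G r w) w = 1" (is "?P w")
    using assms(2,3)
  proof (induction "length w" arbitrary: w rule: less_induct)
    case less
    have wne: "w \<noteq> []" using less.prems by (simp add: lyndon_def)
    show ?case
    proof (cases "length w \<le> 1")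
      case True
      then obtain x where w: "w = [x]" using wne by (cases w) auto
      have x: "x \<in> X" using less.prems w by simp
      have tau: "tau G r w = x" by (simp add: tau.simps[of G r "[x]"] w)
      have "\<Lambda> x v = 0" if "v \<in> lists X" "length v = length w" "alp_less r v w" for v
      proof -
        have "v \<noteq> [x]" "v \<noteq> []" using that w lt_irrefl by auto
        then show ?thesis using \<Lambda>_gen[OF x that(1)] by simp
      qed
      moreover have "\<Lambda> x w = 1" using \<Lambda>_gen[OF x, of w] less.prems w res.m_gt_one by simp
      ultimately show ?thesis unfolding tau using X_carrier[OF x] w by simp
    next
      case False
      let ?c = "std_cut r w"
      define w1 w2 where "w1 = take ?c w" and "w2 = drop ?c w"
      have c: "0 < ?c" "?c < length w" "lyndon r w2" using std_cut[of w r] False by (auto simp: w2_def)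
      have w12: "w = w1 @ w2" "w1 \<noteq> []" "w2 \<noteq> []" using c by (auto simp: w1_def w2_def)
      have wX: "w1 \<in> lists X" "w2 \<in> lists X" using less.prems(2) unfolding w12(1) by simp_all
      have ly1: "lyndon r w1" unfolding w1_def using less.prems False by (intro lyndon_std_prefix) auto
      have "length w1 < length w" "length w2 < length w" using w12 by auto
      then have P1: "?P w1" and P2: "?P w2" using less.hyps ly1 c(3) wX by blast+
      define A B a b where "A = tau G r w1" and "B = tau G r w2" and "a = length w1" and "b = length w2"
      have A: "A \<in> carrier G" "\<forall>v\<in>lists X. v \<noteq> [] \<longrightarrow> length v < a \<longrightarrow> \<Lambda> A v = 0"
          "\<And>v. v \<in> lists X \<Longrightarrow> length v = a \<Longrightarrow> lt v w1 \<Longrightarrow> \<Lambda> A v = 0" "\<Lambda> A w1 = 1"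
        using P1 unfolding A_def a_def by blast+
      have B: "B \<in> carrier G" "\<forall>v\<in>lists X. v \<noteq> [] \<longrightarrow> length v < b \<longrightarrow> \<Lambda> B v = 0"
          "\<And>v. v \<in> lists X \<Longrightarrow> length v = b \<Longrightarrow> lt v w2 \<Longrightarrow> \<Lambda> B v = 0" "\<Lambda> B w2 = 1"
        using P2 unfolding B_def b_def by blast+
      have ab: "0 < a" "0 < b" "length w = a + b" using w12 by (simp_all add: a_def b_def)
      have tau: "tau G r w = commutator G A B"
        using False by (simp add: tau.simps[of G r w] A_def B_def w1_def w2_def)
      note coeff = \<Lambda>_commutator[OF A(1) B(1) ab(1,2) A(2) B(2)]
      \<comment> \<open>\<open>w\<close> is longer than \<open>w2\<close>, hence no prefix of it:
        the comparison is decided at a letter and persists after \<open>w1\<close> is appended to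
        \<open>w2\<close>.\<close>
      have "lt w w2" using less.prems(1) w12 unfolding lyndon_def by blast
      then have w_swap: "lt w (w2 @ w1)"
        using lexord_sufI[of w w2 "r - Id" "[]" w1] ab by (simp add: alp_less_def b_def)
      \<comment> \<open>A word that is at most \<open>w\<close> lies below \<open>w2 @ w1\<close>,
        so one of its two parts lies below \<open>w2\<close> or \<open>w1\<close>, where the
        matching coefficient is 0. Hence the product in the order \<open>B\<close>, \<open>A\<close>
        contributes only to words above \<open>w\<close>.\<close>
      have BA: "\<Lambda> B (take b v) * \<Lambda> A (drop b v) = 0"
        if v: "v \<in> lists X" "length v = a + b" and le: "v = w \<or> lt v w" for v
      proof -
        have "lt (take b v @ drop b v) (w2 @ w1)" using le w_swap lt_trans by auto
        moreover have "length (take b v) = length w2" using v(2) by (simp add: b_def)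
        ultimately have "lt (take b v) w2 \<or> lt (drop b v) w1"
          by (simp only: lt_append_iff) blast
        then show ?thesis
        proof
          assume "lt (take b v) w2"
          then have "\<Lambda> B (take b v) = 0" using v by (intro B(3) take_drop_lists) auto
          then show ?thesis by simp
        next
          assume "lt (drop b v) w1"
          then have "\<Lambda> A (drop b v) = 0" using v by (intro A(3) take_drop_lists) auto
          then show ?thesis by simp
        qed
      qed
      have "\<Lambda> (tau G r w) v = 0" if v: "v \<in> lists X" "v \<noteq> []" "length v < length w" for v
        using coeff[OF v(1,2)] v(3) ab(3) by (simp add: tau)
      moreover have "\<Lambda> (tau G r w) v = 0" if v: "v \<in> lists X" "length v = length w" "lt v w" for v
      proof -
        \<comment> \<open>The same comparison of parts, now with \<open>w1 @ w2\<close> itself,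
          removes the product in the order \<open>A\<close>, \<open>B\<close> strictly below
          \<open>w\<close>.\<close>
        have "lt (take a v @ drop a v) (w1 @ w2)" using v(3) w12(1) by simp
        moreover have "length (take a v) = length w1" using v(2) ab(3) by (simp add: a_def)
        ultimately have "lt (take a v) w1 \<or> take a v = w1 \<and> lt (drop a v) w2"
          by (simp only: lt_append_iff)
        then have "\<Lambda> A (take a v) = 0 \<or> \<Lambda> B (drop a v) = 0"
        proof
          assume "lt (take a v) w1"
          then have "\<Lambda> A (take a v) = 0" using v ab by (intro A(3) take_drop_lists) auto
          then show ?thesis ..
        next
          assume "take a v = w1 \<and> lt (drop a v) w2"
          then have "\<Lambda> B (drop a v) = 0" using v ab by (intro B(3) take_drop_lists) auto
          then show ?thesis ..
        qed
        moreover have "v \<noteq> []" using v(2) wne by auto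
        ultimately show ?thesis using coeff[OF v(1)] BA[OF v(1)] v(2,3) ab(3) by (auto simp: tau)
      qed
      moreover have "\<Lambda> (tau G r w) w = 1"
      proof -
        have "take a w = w1" "drop a w = w2" using w12(1) by (simp_all add: a_def)
        then show ?thesis
          using coeff[OF less.prems(2) wne] BA[OF less.prems(2)] ab(3) A(4) B(4) res.m_gt_one by (simp add: tau)
      qed
      ultimately show ?thesis using A(1) B(1) by (simp add: tau)
    qed
  qed
  then show "tau G r w \<in> carrier G"
    "\<forall>v\<in>lists X. v \<noteq> [] \<longrightarrow> length v < length w \<longrightarrow> \<Lambda> (tau G r w) v = 0"
    "v \<in> lists X \<Longrightarrow> length v = length w \<Longrightarrow> alp_less r v w \<Longrightarrow> \<Lambda> (tau G r w) v = 0"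
    "\<Lambda> (tau G r w) w = 1" by blast+
qed

theorem corollary8p3:
  fixes S :: "'a monoid" and T :: "'a topology" and X :: "'a set" and r :: "'a rel"
    and p n :: nat
  assumes "prime p"
    and "X \<noteq> {}"
    and "linear_order_on X r"
    and "free_profinite_group S T X"
    and "n \<ge> 2"
  shows "\<forall>w\<in>Lyn_le r X n. \<forall>w'\<in>Lyn_le r X n.
    (let m = trg_pairing S T p n (tau S r w [^]\<^bsub>S\<^esub> p ^ (n - length w)) (alpha S T X p n w')
     in (w' = w \<longrightarrow> m = \<one>\<^bsub>residue_ring (int p)\<^esub>) \<and>
        (prec r w' w \<longrightarrow> m = \<zero>\<^bsub>residue_ring (int p)\<^esub>))"
proof (intro ballI)
  fix w w' assume "w \<in> Lyn_le r X n" "w' \<in> Lyn_le r X n"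
  then have w: "w \<in> lists X" "lyndon r w" "length w \<le> n" "w \<noteq> []"
    and w': "w' \<in> lists X" "length w' \<le> n" "w' \<noteq> []"
    by (auto simp: Lyn_le_def lyndon_def)
  \<comment> \<open>The exponent is that of the row word \<open>w\<close>, whereas the modulus is
    that of the column word \<open>w'\<close>.\<close>
  let ?q = "p ^ (n - length w)" and ?m = "int (p ^ (n - length w' + 1))"
  have p: "1 < p" using assms(1) by (rule prime_gt_1_nat)
  have m_eq: "?m = int p * int p ^ (n - length w')" by simp
  interpret profinite S T
    using assms(4) unfolding free_profinite_group_def profinite_group_iff by blast
  have m: "1 < ?m"
  proof -
    have "1 < p ^ (n - length w' + 1)" using p by (intro one_less_power) simp_all
    then have "int 1 < ?m" by (simp only: of_nat_less_iff)
    then show ?thesis by (simp only: of_nat_1)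
  qed
  interpret fm: free_magnus S T ?m "residue_ring ?m" X
    by (intro free_magnus.intro profinite_axioms magnus_series.intro residues.intro m
      free_magnus_axioms.intro assms(4))
  have XS: "X \<subseteq> carrier S" using fm.X_carrier by blast
  let ?t = "tau S r w"
  note tau = fm.\<Lambda>_tau[OF assms(3) w(2,1)]
  \<comment> \<open>\<open>?t\<close> lies in the term indexed by the length of \<open>w\<close>,
    and each of the \<open>n - length w\<close> successive \<open>p\<close>-th powers raises the
    index by one.\<close>
  have "?t [^]\<^bsub>S\<^esub> ?q \<in> lower_p_central S T p (length w + (n - length w))"
    by (rule pow_pow_mem_lower_p_central[OF tau_mem_lower_p_central[OF XS w(1,4)]])
  then have "?t [^]\<^bsub>S\<^esub> ?q \<in> lower_p_central S T p n" using w(3) by simp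
  note pairing = trg_pairing_alpha[OF assms(4,1,5) w'(1,3,2) this, unfolded magnus_coeff_def, folded fm.\<Lambda>_def]
  have pow: "fm.\<Lambda> (?t [^]\<^bsub>S\<^esub> ?q) w' = (int ?q * fm.\<Lambda> ?t w') mod ?m" if "length w' \<le> length w"
    by (rule fm.\<Lambda>_pow[OF tau(1) tau(2) w'(1,3) that])
  have "trg_pairing S T p n (?t [^]\<^bsub>S\<^esub> ?q) (alpha S T X p n w') = 1" if "w' = w"
  proof -
    have "fm.\<Lambda> (?t [^]\<^bsub>S\<^esub> ?q) w' = int ?q mod ?m" using pow that tau(4) by simp
    \<comment> \<open>For \<open>w' = w\<close> the modulus is \<open>p\<close> times
      \<open>?q\<close>, so reduction leaves \<open>?q\<close> alone and the division by it gives
      1.\<close>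
    also have "\<dots> = int p ^ (n - length w')"
      using p that by (simp add: m_eq)
    finally show ?thesis unfolding pairing using p by simp
  qed
  moreover have "trg_pairing S T p n (?t [^]\<^bsub>S\<^esub> ?q) (alpha S T X p n w') = 0" if "prec r w' w"
  proof -
    have "length w' < length w \<or> length w' = length w \<and> alp_less r w' w"
      using that by (auto simp: prec_def prec_eq_def alp_le_def)
    \<comment> \<open>The two ways of preceding \<open>w\<close> match the two vanishing statements
      for \<open>?t\<close>, in lower degree and alphabetically below \<open>w\<close>; in these
      degrees taking the power multiplies the coefficient by a number.\<close>
    then have "fm.\<Lambda> ?t w' = 0" "length w' \<le> length w" using tau(2,3) w' by auto
    then show ?thesis unfolding pairing using pow by simp
  qed
  ultimately show "let m = trg_pairing S T p n (tau S r w [^]\<^bsub>S\<^esub> p ^ (n - length w)) (alpha S T X p n w')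
     in (w' = w \<longrightarrow> m = \<one>\<^bsub>residue_ring (int p)\<^esub>) \<and>
        (prec r w' w \<longrightarrow> m = \<zero>\<^bsub>residue_ring (int p)\<^esub>)"
    by (simp add: residue_ring_def)
qed

end
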